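(* Let $\alpha,\beta$ be inner functions, let $k\in\mathbb{N}$, and let $U$ be a bounded linear operator from $K_\alpha$ into $K_\beta$. Then $U\in\mathcal{S}_k(\alpha,\beta)$ if and only if there exist functions $\chi\in K_\alpha$ and $\psi_0,\ldots,\psi_{k-1}\in K_\beta$ such that $$U-S_\beta U(S_\alpha^* )^k=k_0^\beta\otimes \chi +\sum_{j=0}^{k-1} \psi_j\otimes k_{0,j}^\alpha .$$
   Context: $\mathbb{T}$ is the unit circle, $\mathbb{D}$ the open unit disk, $L^2=L^2(\mathbb{T})$ with normalized Lebesgue measure, $H^2$ the Hardy space (functions analytic in $\mathbb{D}$, identified with boundary functions, a closed subspace of $L^2$). $\mathbb{N}=\{1,2,\dots\}$. An inner function $\alpha$ is a bounded analytic function in $\mathbb{D}$ whose boundary values have modulus one a.e. on $\mathbb{T}$. $K_\alpha=H^2\ominus\alpha H^2$, $K_\alpha^\infty=K_\alpha\cap H^\infty$ (dense in $K_\alpha$), and $P_\alpha$ is the orthogonal projection of $L^2$ onto $K_\alpha$. For $k\in\mathbb{N}$, $W_k$ is the bounded operator on $L^2$ with $W_k(z^n)=z^{n/k}$ if $k$ divides $n$ and $W_k(z^n)=0$ otherwise ($n\in\mathbb{Z}$). For $\varphi\in L^2$, $U_\varphi^{\alpha,\beta}f=P_\beta W_k(\varphi f)$ for $f\in K_\alpha^\infty$. $\mathcal{S}_k(\alpha,\beta)$ is the set of all $U_\varphi^{\alpha,\beta}$, $\varphi\in L^2$, that extend boundedly to $K_\alpha$ (identified with their extensions $K_\alpha\to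 K_\beta$). The compressed shift is $S_\alpha f=P_\alpha(zf)$, $f\in K_\alpha$; its adjoint is $S_\alpha^*f=(f-f(0))/z$. For $n\ge 0$, $k_{0,n}^\alpha=P_\alpha(n!z^n)\in K_\alpha$ is the function with $f^{(n)}(0)=\langle f,k_{0,n}^\alpha\rangle$ for all $f\in K_\alpha$, and $k_0^\alpha=k_{0,0}^\alpha=1-\overline{\alpha(0)}\alpha$ (similarly for $\beta$). $(f\otimes g)h=\langle h,g\rangle f$. *)

theory Defs
  imports "HOL-Analysis.Analysis"
begin

text \<open>
  Elements of $L^2$ of the unit circle are represented by square-integrable functions, so equality
  of two elements is equality almost everywhere and every set of functions below is closed under it.
  An operator is a map on representatives; its values are relevant only up to null sets.
\<close>

type_synonym cfun = "complex \<Rightarrow> complex"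

text \<open>
  Normalized Lebesgue measure on the circle. Its space is the circle itself, not the whole plane, so
  that measurability of \<open>\<lambda>\<zeta>. F (r * \<zeta>)\<close> does not depend on the values of \<open>F\<close> outside the disk.
\<close>

definition circle :: "complex measure" where
  "circle = distr (uniform_measure lborel {0..2 * pi}) (restrict_space borel (sphere 0 1)) cis"

definition L2 :: "cfun set" where
  "L2 = {f \<in> borel_measurable circle. integrable circle (\<lambda>\<zeta>. (norm (f \<zeta>))\<^sup>2)}"

definition ip :: "cfun \<Rightarrow> cfun \<Rightarrow> complex" where
  "ip f g = (LINT \<zeta>|circle. f \<zeta> * cnj (g \<zeta>))"

definition l2norm :: "cfun \<Rightarrow> real" where
  "l2norm f = sqrt (LINT \<zeta>|circle. (norm (f \<zeta>))\<^sup>2)"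

definition bounded_op :: "cfun set \<Rightarrow> cfun set \<Rightarrow> (cfun \<Rightarrow> cfun) \<Rightarrow> bool" where
  "bounded_op X Y T \<longleftrightarrow>
     (\<forall>f\<in>X. T f \<in> Y) \<and>
     (\<forall>f\<in>X. \<forall>g\<in>X. \<forall>a b. AE \<zeta> in circle.
        T (\<lambda>z. a * f z + b * g z) \<zeta> = a * T f \<zeta> + b * T g \<zeta>) \<and>
     (\<exists>C. \<forall>f\<in>X. l2norm (T f) \<le> C * l2norm f)"

definition proj :: "cfun set \<Rightarrow> cfun \<Rightarrow> cfun" where
  "proj X f = (SOME g. g \<in> X \<and> (\<forall>h\<in>X. ip (\<lambda>\<zeta>. f \<zeta> - g \<zeta>) h = 0))"

definition adj :: "cfun set \<Rightarrow> (cfun \<Rightarrow> cfun) \<Rightarrow> cfun \<Rightarrow> cfun" where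
  "adj X T f = (SOME g. g \<in> X \<and> (\<forall>h\<in>X. ip (T h) f = ip h g))"

definition tensor :: "cfun \<Rightarrow> cfun \<Rightarrow> cfun \<Rightarrow> cfun" where
  "tensor f g h = (\<lambda>\<zeta>. ip h g * f \<zeta>)"

definition hardy2_disk :: "cfun set" where
  "hardy2_disk = {F. F holomorphic_on ball 0 1 \<and>
     (\<exists>C. \<forall>r\<in>{0..<1}. l2norm (\<lambda>\<zeta>. F (complex_of_real r * \<zeta>)) \<le> C)}"

definition hardy_inf_disk :: "cfun set" where
  "hardy_inf_disk = {F. F holomorphic_on ball 0 1 \<and> bounded (F ` ball 0 1)}"

text \<open>
  The boundary function of an analytic function, as the $L^2$-limit of its dilations. For members
  of \<open>hardy2_disk\<close> this is the same as the almost everywhere radial limit (Fatou).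
\<close>

definition boundary_function :: "cfun \<Rightarrow> cfun \<Rightarrow> bool" where
  "boundary_function F f \<longleftrightarrow> f \<in> L2 \<and>
     ((\<lambda>r. l2norm (\<lambda>\<zeta>. F (complex_of_real r * \<zeta>) - f \<zeta>)) \<longlongrightarrow> 0) (at_left 1)"

definition H2 :: "cfun set" where
  "H2 = {f. \<exists>F\<in>hardy2_disk. boundary_function F f}"

definition Hinf :: "cfun set" where
  "Hinf = {f. \<exists>F\<in>hardy_inf_disk. boundary_function F f}"

definition inner_function :: "cfun \<Rightarrow> bool" where
  "inner_function \<alpha> \<longleftrightarrow> \<alpha> \<in> hardy_inf_disk \<and>
     (AE \<zeta> in circle. \<exists>l. ((\<lambda>r. \<alpha> (complex_of_real r * \<zeta>)) \<longlongrightarrow> l) (at_left 1) \<and> norm l = 1)"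

text \<open>
  The inner function is given on the disk, so the product \<open>\<alpha> * F\<close> is formed there and then
  passed to the boundary.
\<close>

definition inner_times_H2 :: "cfun \<Rightarrow> cfun set" where
  "inner_times_H2 \<alpha> = {h. \<exists>F\<in>hardy2_disk. boundary_function (\<lambda>z. \<alpha> z * F z) h}"

definition model_space :: "cfun \<Rightarrow> cfun set" where
  "model_space \<alpha> = {f \<in> H2. \<forall>h\<in>inner_times_H2 \<alpha>. ip f h = 0}"

definition model_space_inf :: "cfun \<Rightarrow> cfun set" where
  "model_space_inf \<alpha> = model_space \<alpha> \<inter> Hinf"

definition W :: "nat \<Rightarrow> cfun \<Rightarrow> cfun" where
  "W k = (SOME T. bounded_op L2 L2 T \<and>
     (\<forall>n::int. AE \<zeta> in circle.
        T (\<lambda>z. z powi n) \<zeta> = (if int k dvd n then \<zeta> powi (n div int k) else 0)))"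

definition U_op :: "nat \<Rightarrow> cfun \<Rightarrow> cfun \<Rightarrow> cfun \<Rightarrow> cfun" where
  "U_op k \<beta> \<phi> f = proj (model_space \<beta>) (W k (\<lambda>\<zeta>. \<phi> \<zeta> * f \<zeta>))"

text \<open>
  The bounded operators \<open>U\<close> on the model space of \<open>\<alpha>\<close> that extend \<open>U_op k \<beta> \<phi>\<close>, which is defined
  on the dense subspace of bounded functions, for some \<open>\<phi>\<close> in $L^2$.
\<close>

definition S_class :: "nat \<Rightarrow> cfun \<Rightarrow> cfun \<Rightarrow> (cfun \<Rightarrow> cfun) set" where
  "S_class k \<alpha> \<beta> = {U. bounded_op (model_space \<alpha>) (model_space \<beta>) U \<and>
     (\<exists>\<phi>\<in>L2. \<forall>f\<in>model_space_inf \<alpha>. AE \<zeta> in circle. U f \<zeta> = U_op k \<beta> \<phi> f \<zeta>)}"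

definition comp_shift :: "cfun \<Rightarrow> cfun \<Rightarrow> cfun" where
  "comp_shift \<alpha> f = proj (model_space \<alpha>) (\<lambda>\<zeta>. \<zeta> * f \<zeta>)"

definition comp_shift_adj :: "cfun \<Rightarrow> cfun \<Rightarrow> cfun" where
  "comp_shift_adj \<alpha> = adj (model_space \<alpha>) (comp_shift \<alpha>)"

text \<open>
  The kernel of the \<open>n\<close>-th derivative at the origin.
\<close>

definition ker0 :: "cfun \<Rightarrow> nat \<Rightarrow> cfun" where
  "ker0 \<alpha> n = proj (model_space \<alpha>) (\<lambda>\<zeta>. fact n * \<zeta> ^ n)"

end

(*
  Everything is expressed through Fourier coefficients. Write S' for the adjoint of the compressed
  shift; it deletes the coefficient of index 0 and moves the others down by one, while W k keeps the
  coefficients whose index is a multiple of k. Hence, for bounded f,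

    W k (phi S'^k f) = (W k (phi f) - sum_{j<k} f_j W k (phi z^j)) / z,

  and pairing with S' g, which is (g - g_0) / z, yields the displacement identity, where xi is the
  projection of cnj phi and psi_j is the projection of W k (phi z^j) / j! corrected by a multiple
  of the kernel at 0.

  Conversely, iterating the displacement identity n times leaves a remainder of at most a constant
  times the norm of S'^n g, which tends to 0. So <U f, g> is a series in xi and the psi_j, and for
  bounded f and g this series is <W k (phi f), g> with phi = cnj xi + sum_{j<k} j! z^(-j) psi_j(z^k).
  Projections of trigonometric polynomials are bounded, so bounded functions are dense in the model
  spaces and suffice in both directions.
*)

theory Submission
  imports Defs "HOL-Complex_Analysis.Cauchy_Integral_Formula"
begin

text \<open>Projections, adjoints and \<open>W k\<close> are chosen by \<open>SOME\<close>, and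
  operators act on representatives, so equalities of functions hold only a.e. The proof therefore
  computes with numbers that do not see null sets: Fourier coefficients and inner products.
  Uniqueness of coefficients and Riesz-Fischer lead from them back to functions.

  The symbol \<phi> is only in L2, so \<phi> f is in L2 only for bounded f. This forces the detour
  over bounded functions: in f for necessity, and in f and g for sufficiency, where an L2 factor of
  the symbol has to be moved onto g.

  The shape of the symbol comes from the rule that \<open>W k\<close> maps F(z) \<psi>(z^k) to
  \<open>W k F\<close> times \<psi>. For F = z^(-j) f with j < k, the function \<open>W k F\<close>
  is analytic with coefficients f_(k i + j), and exactly these multiply \<psi>_j in the iterated
  identity. The factors j! are those of the kernels. Each iteration shifts f by k indices but g by
  one, which matches the action of \<open>W k\<close> on indices.\<close>

subsection \<open>Integration on the circle\<close>

lemma sets_circle [measurable_cong]: "sets circle = sets (restrict_space borel (sphere 0 1))"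
  by (simp add: circle_def)

lemma space_circle [simp]: "space circle = sphere 0 1"
  by (simp add: circle_def space_restrict_space)

lemma cis_measurable [measurable]:
  "cis \<in> uniform_measure lborel {0..2*pi} \<rightarrow>\<^sub>M restrict_space borel (sphere 0 1)"
proof -
  have "cis \<in> borel_measurable borel"
    by (intro borel_measurable_continuous_onI continuous_intros)
  then have "cis \<in> borel \<rightarrow>\<^sub>M restrict_space borel (sphere 0 1)"
    by (intro measurable_restrict_space2) auto
  then show ?thesis
    by (simp cong: measurable_cong_sets)
qed

lemma emeasure_circle: "emeasure circle (space circle) = 1"
proof -
  have "emeasure (uniform_measure lborel {0..2*pi}) UNIV = 1"
    using emeasure_uniform_measure[of "{0..2*pi}" lborel UNIV]
    by (simp add: ennreal_divide_self divide_ennreal flip: ennreal_1)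
  moreover have "cis -` space circle \<inter> space (uniform_measure lborel {0..2 * pi}) = UNIV"
    by auto
  ultimately show ?thesis
    unfolding circle_def
    by (subst emeasure_distr[OF cis_measurable])
      (auto simp: space_restrict_space sets_restrict_space intro!: rev_image_eqI[of UNIV])
qed

interpretation circle: finite_measure circle
  by (rule finite_measureI) (simp only: emeasure_circle, simp)

lemma measure_circle [simp]: "measure circle (sphere 0 1) = 1"
  using emeasure_circle by (simp add: Sigma_Algebra.measure_def)

lemma integral_circle_const [simp]: "(LINT z|circle. (c::'a::{banach,second_countable_topology})) = c"
  by simp

lemma continuous_on_circle_measurable:
  fixes f :: "complex \<Rightarrow> 'a::topological_space"
  assumes "continuous_on (sphere 0 1) f"
  shows "f \<in> borel_measurable circle"
  using borel_measurable_continuous_on_restrict[OF assms] sets_circle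
  by (simp cong: measurable_cong_sets)

lemma continuous_on_power_int_sphere: "continuous_on (sphere 0 1) (\<lambda>z::complex. z powi n)"
  by (auto intro!: continuous_intros)

lemma power_int_measurable [measurable]: "(\<lambda>z. z powi n) \<in> borel_measurable circle"
  by (rule continuous_on_circle_measurable[OF continuous_on_power_int_sphere])

lemma AE_circleI: "(\<And>z. norm z = 1 \<Longrightarrow> P z) \<Longrightarrow> AE z in circle. P z"
  by (rule AE_I2) (auto simp: dist_norm)

lemma cis_power_int: "cis t powi n = cis (of_int n * t)"
  by (cases n rule: int_cases2) (auto simp: power_int_minus Complex.DeMoivre cis_inverse)

lemma inverse_circle: "norm z = 1 \<Longrightarrow> inverse z = cnj z"
  by (simp add: divide_conv_cnj inverse_eq_divide)

lemma cnj_power_int_circle: "norm z = 1 \<Longrightarrow> cnj (z powi n) = z powi (- n)"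
  by (simp add: power_int_minus power_int_inverse flip: inverse_circle)

lemma integral_circle_cis:
  fixes f :: "complex \<Rightarrow> complex"
  assumes "f \<in> borel_measurable circle"
  shows "(LINT z|circle. f z) = (LINT t|uniform_measure lborel {0..2*pi}. f (cis t))"
  unfolding circle_def
  by (rule integral_distr) (use assms sets_circle in \<open>auto cong: measurable_cong_sets\<close>)

lemma integral_circle_power_int: "(LINT z|circle. z powi n) = (if n = 0 then 1 else 0)"
proof (cases "n = 0")
  case False
  \<comment> \<open>For n different from 0 this is a primitive of \<open>cis (of_int n * t)\<close>;
    being 2 pi-periodic, it has increment 0 over the interval.\<close>
  let ?c = "\<lambda>t::real. inverse (\<i> * of_int n) * cis (of_int n * t)"
  have d: "(?c has_vector_derivative cis (of_int n * t)) (at t within {0..2*pi})" for t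
    using False
    by (auto intro!: derivative_eq_intros simp: has_vector_derivative_def fun_eq_iff
        scaleR_conv_of_real field_simps)
  have "(LINT t|lborel. indicator {0..2*pi} t *\<^sub>R cis (of_int n * t)) = ?c (2*pi) - ?c 0"
    by (rule integral_FTC_Icc) (use d in \<open>auto intro!: continuous_intros\<close>)
  also have "cis (of_int n * (2*pi)) = 1"
    by (metis cis_multiple_2pi Ints_of_int mult.commute mult.left_commute)
  then have "?c (2*pi) - ?c 0 = 0"
    by simp
  finally have i0: "(LINT t|lborel. indicator {0..2*pi} t *\<^sub>R cis (of_int n * t)) = 0" .
  have "(\<lambda>x. indicator {0..2 * pi} x / emeasure lborel {0..2 * pi}) =
      (\<lambda>x. ennreal (indicator {0..2 * pi} x / (2*pi)))"
    by (auto simp: fun_eq_iff indicator_def divide_ennreal ennreal_1[symmetric] simp del: ennreal_1)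
  then have "uniform_measure lborel {0..2*pi} =
      density lborel (\<lambda>x. ennreal (indicator {0..2 * pi} x / (2*pi)))"
    by (simp add: uniform_measure_def)
  then have "(LINT t|uniform_measure lborel {0..2*pi}. cis (of_int n * t)) =
      (LINT t|lborel. (indicator {0..2 * pi} t / (2*pi)) *\<^sub>R cis (of_int n * t))"
    by (simp add: integral_density borel_measurable_continuous_onI continuous_intros)
  also have "\<dots> = (LINT t|lborel. (1/(2*pi)) *\<^sub>R (indicator {0..2 * pi} t *\<^sub>R cis (of_int n * t)))"
    by simp
  also have "\<dots> = 0"
    by (subst integral_scaleR_right) (use i0 in simp)
  finally show ?thesis
    using False by (simp add: integral_circle_cis cis_power_int)
qed simp

subsection \<open>Fourier coefficients\<close>

text \<open>\<open>z powi (- n)\<close> takes the place of the conjugate of \<open>z powi n\<close>,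
  with which it agrees on the circle, so that multiplication by powers of z becomes index
  arithmetic. The coefficients are also used for products of two L2 functions, which are only
  integrable.\<close>

definition fcoef :: "cfun \<Rightarrow> int \<Rightarrow> complex" where
  "fcoef f n = (LINT z|circle. f z * z powi (- n))"

lemma integrable_mult_bounded:
  fixes f g :: cfun
  assumes "integrable circle f" "g \<in> borel_measurable circle" "AE z in circle. norm (g z) \<le> C"
  shows "integrable circle (\<lambda>z. g z * f z)"
proof (rule Bochner_Integration.integrable_bound)
  show "integrable circle (\<lambda>z. C * norm (f z))"
    using assms by auto
  show "AE z in circle. norm (g z * f z) \<le> norm (C * norm (f z))"
    using assms(3)
    by eventually_elim (auto simp: norm_mult abs_mult intro!: mult_right_mono intro: order_trans abs_ge_self)
qed (use assms in measurable)

lemma integrable_mult_continuous: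
  fixes f g :: cfun
  assumes "integrable circle f" "continuous_on (sphere 0 1) g"
  shows "integrable circle (\<lambda>z. g z * f z)"
proof -
  have "compact (g ` sphere 0 1)"
    using assms(2) by (rule compact_continuous_image) auto
  then obtain C where "\<And>z. z \<in> sphere 0 1 \<Longrightarrow> norm (g z) \<le> C"
    using compact_imp_bounded bounded_iff by (metis imageI)
  then show ?thesis
    by (intro integrable_mult_bounded[of _ _ C] AE_circleI continuous_on_circle_measurable assms) auto
qed

lemma integrable_continuous_circle:
  fixes g :: cfun
  assumes "continuous_on (sphere 0 1) g"
  shows "integrable circle g"
  using integrable_mult_continuous[OF _ assms, of "\<lambda>_. 1"] by simp

lemma fcoef_integrable: "integrable circle f \<Longrightarrow> integrable circle (\<lambda>z. f z * z powi n)"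
  using integrable_mult_continuous[OF _ continuous_on_power_int_sphere] by (simp add: mult.commute)

lemma fcoef_cong_AE:
  assumes "AE z in circle. f z = g z" "f \<in> borel_measurable circle" "g \<in> borel_measurable circle"
  shows "fcoef f n = fcoef g n"
  unfolding fcoef_def
  by (rule integral_cong_AE) (use assms in \<open>measurable; fastforce\<close>)+

lemma fcoef_lincomb:
  assumes "integrable circle f" "integrable circle g"
  shows "fcoef (\<lambda>z. a * f z + b * g z) n = a * fcoef f n + b * fcoef g n"
proof -
  have "fcoef (\<lambda>z. a * f z + b * g z) n =
      (LINT z|circle. a * (f z * z powi (-n)) + b * (g z * z powi (-n)))"
    unfolding fcoef_def by (simp add: algebra_simps)
  also have "\<dots> = a * fcoef f n + b * fcoef g n"
    unfolding fcoef_def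
    by (subst Bochner_Integration.integral_add) (auto intro!: fcoef_integrable assms)
  finally show ?thesis .
qed

lemma fcoef_diff:
  "integrable circle f \<Longrightarrow> integrable circle g \<Longrightarrow> fcoef (\<lambda>z. f z - g z) n = fcoef f n - fcoef g n"
  using fcoef_lincomb[of f g 1 "-1"] by simp

lemma fcoef_cmult: "fcoef (\<lambda>z. c * f z) n = c * fcoef f n"
  by (simp add: fcoef_def mult.assoc)

lemma fcoef_power_int: "fcoef (\<lambda>z. z powi m) n = (if n = m then 1 else 0)"
proof -
  have "fcoef (\<lambda>z. z powi m) n = (LINT z|circle. z powi (m - n))"
    unfolding fcoef_def
    by (rule integral_cong_AE)
      (auto intro!: AE_circleI simp: power_int_minus divide_inverse intro: power_int_diff[symmetric, unfolded divide_inverse])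
  then show ?thesis
    by (simp add: integral_circle_power_int)
qed

lemma fcoef_mult_power_int:
  assumes "f \<in> borel_measurable circle"
  shows "fcoef (\<lambda>z. z powi m * f z) n = fcoef f (n - m)"
  unfolding fcoef_def
proof (rule integral_cong_AE)
  show "AE z in circle. z powi m * f z * z powi - n = f z * z powi - (n - m)"
  proof (rule AE_circleI)
    fix z :: complex assume "norm z = 1"
    then have "z \<noteq> 0" by auto
    then have "z powi (- (n - m)) = z powi m * z powi (-n)"
      by (simp add: power_int_add[symmetric])
    then show "z powi m * f z * z powi - n = f z * z powi - (n - m)"
      by simp
  qed
qed (use assms in measurable)

text \<open>
  Multipliers that preserve the class of integrable functions with vanishing Fourier coefficients
  form an algebra containing the coordinates, to which Stone--Weierstrass applies.
\<close>

lemma fcoef_zero_integral_continuous: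
  fixes g :: "complex \<Rightarrow> real"
  assumes f: "integrable circle f" "\<And>n. fcoef f n = 0" and g: "continuous_on (sphere 0 1) g"
  shows "(LINT z|circle. g z *\<^sub>R f z) = 0"
proof -
  define Z where "Z = {f. integrable circle f \<and> (\<forall>n. fcoef f n = 0)}"
  define P where "P p \<longleftrightarrow> continuous_on (sphere 0 1) p \<and>
    (\<forall>f\<in>Z. (\<lambda>z. complex_of_real (p z) * f z) \<in> Z)" for p :: "complex \<Rightarrow> real"
  have Zlin: "(\<lambda>z. a * f z + b * g z) \<in> Z" if "f \<in> Z" "g \<in> Z" for f g a b
    using that by (auto simp: Z_def fcoef_lincomb)
  have Zpow: "(\<lambda>z. z powi m * f z) \<in> Z" if "f \<in> Z" for f m
    using that
    by (auto simp: Z_def fcoef_mult_power_int intro!: integrable_mult_continuous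
        continuous_on_power_int_sphere)
  \<comment> \<open>Real and imaginary part are combinations of z and 1/z only on the circle, so
    membership in Z must not depend on values elsewhere.\<close>
  have Zcong: "f \<in> Z" if "g \<in> Z" "\<And>z. norm z = 1 \<Longrightarrow> f z = g z" for f g
  proof -
    have *: "integrable circle f \<longleftrightarrow> integrable circle g"
      using that by (intro Bochner_Integration.integrable_cong) auto
    moreover have "fcoef f n = fcoef g n" for n
      unfolding fcoef_def using that by (intro Bochner_Integration.integral_cong) auto
    ultimately show ?thesis
      using that by (auto simp: Z_def)
  qed
  have const: "P (\<lambda>_. c)" for c
    using Zlin[of _ _ "of_real c" 0] by (auto simp: P_def)

  have PRe: "P Re"
    unfolding P_def
  proof (intro conjI ballI)
    fix f assume "f \<in> Z"
    then have "(\<lambda>z. (1/2) * (z powi 1 * f z) + (1/2) * (z powi (-1) * f z)) \<in> Z"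
      by (intro Zlin Zpow)
    then show "(\<lambda>z. complex_of_real (Re z) * f z) \<in> Z"
      by (rule Zcong)
        (auto simp: inverse_circle complex_eq_iff power_int_minus diff_divide_distrib add_divide_distrib)
  qed (intro continuous_intros)
  have ImE: "complex_of_real (Im z) = -\<i>/2 * z + \<i>/2 * cnj z" for z
    by (simp add: complex_eq_iff)
  have PIm: "P Im"
    unfolding P_def
  proof (intro conjI ballI)
    fix f assume "f \<in> Z"
    then have "(\<lambda>z. (-\<i>/2) * (z powi 1 * f z) + (\<i>/2) * (z powi (-1) * f z)) \<in> Z"
      by (intro Zlin Zpow)
    then show "(\<lambda>z. complex_of_real (Im z) * f z) \<in> Z"
      by (rule Zcong) (simp add: ImE inverse_circle power_int_minus algebra_simps)
  qed (intro continuous_intros)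
  have Padd: "P (\<lambda>x. p x + q x)" if "P p \<and> P q" for p q
    unfolding P_def
  proof (intro conjI ballI)
    fix f assume "f \<in> Z"
    then show "(\<lambda>z. complex_of_real (p z + q z) * f z) \<in> Z"
      using that Zlin[of "\<lambda>z. of_real (p z) * f z" "\<lambda>z. of_real (q z) * f z" 1 1]
      by (auto simp: P_def algebra_simps)
  qed (use that in \<open>auto simp: P_def intro!: continuous_intros\<close>)
  have Pmult: "P (\<lambda>x. p x * q x)" if "P p \<and> P q" for p q
    using that by (auto simp: P_def mult.assoc intro!: continuous_intros)
  have fZ: "f \<in> Z"
    using f by (auto simp: Z_def)
  have sep: "\<exists>p. P p \<and> p x \<noteq> p y" if "x \<noteq> y" for x y
    using that PRe PIm by (auto simp: complex_eq_iff)
  have "norm (LINT z|circle. g z *\<^sub>R f z) \<le> e * (LINT z|circle. norm (f z))" if e: "e > 0" for e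
  proof -
    have "\<exists>p. P p \<and> (\<forall>x\<in>sphere 0 1. \<bar>g x - p x\<bar> < e)"
      by (rule Stone_Weierstrass_HOL[where P=P])
        (use const Padd Pmult sep g e in \<open>auto simp: P_def\<close>)
    then obtain p where p: "P p" "\<And>x. x \<in> sphere 0 1 \<Longrightarrow> \<bar>g x - p x\<bar> < e"
      by auto
    have pf: "(\<lambda>z. complex_of_real (p z) * f z) \<in> Z"
      using p fZ by (auto simp: P_def)
    then have "fcoef (\<lambda>z. complex_of_real (p z) * f z) 0 = 0"
      by (simp add: Z_def)
    then have p0: "(LINT z|circle. complex_of_real (p z) * f z) = 0"
      by (simp add: fcoef_def)
    have ig: "integrable circle (\<lambda>z. complex_of_real (g z) * f z)"
      by (intro integrable_mult_continuous f continuous_intros g)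
    have "(LINT z|circle. g z *\<^sub>R f z) =
        (LINT z|circle. complex_of_real (g z) * f z - complex_of_real (p z) * f z)"
      using ig pf p0 by (subst Bochner_Integration.integral_diff)
        (auto simp: Z_def scaleR_conv_of_real)
    also have "norm \<dots> \<le> (LINT z|circle. norm (complex_of_real (g z) * f z - complex_of_real (p z) * f z))"
      by (rule integral_norm_bound)
    also have "\<dots> \<le> (LINT z|circle. e * norm (f z))"
    proof (rule integral_mono_AE)
      show "AE z in circle. norm (complex_of_real (g z) * f z - complex_of_real (p z) * f z) \<le> e * norm (f z)"
      proof (rule AE_circleI)
        fix z :: complex assume "norm z = 1"
        then have "\<bar>g z - p z\<bar> \<le> e"
          using p(2)[of z] by auto
        moreover have "complex_of_real (g z) * f z - complex_of_real (p z) * f z =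
          complex_of_real (g z - p z) * f z"
          by (simp add: algebra_simps)
        ultimately show "norm (complex_of_real (g z) * f z - complex_of_real (p z) * f z) \<le> e * norm (f z)"
          by (simp only: norm_mult norm_of_real) (intro mult_right_mono, auto)
      qed
    qed (use ig pf f in \<open>auto simp: Z_def\<close>)
    finally show ?thesis by simp
  qed
  note * = this
  have "norm (LINT z|circle. g z *\<^sub>R f z) \<le> 0 + e" if e: "e > 0" for e
  proof -
    \<comment> \<open>Dividing e by 1 + I rather than by I covers functions with L1 norm 0.\<close>
    define I where "I = (LINT z|circle. norm (f z))"
    have I: "I \<ge> 0" unfolding I_def by simp
    have "norm (LINT z|circle. g z *\<^sub>R f z) \<le> e / (1 + I) * I"
      using *[of "e / (1 + I)"] e I unfolding I_def by simp
    also have "\<dots> \<le> e"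
      using e I by (simp add: field_simps)
    finally show ?thesis by simp
  qed
  then show ?thesis
    by (metis field_le_epsilon norm_le_zero_iff)
qed

text \<open>The functions \<open>?g n\<close> are continuous and decrease to the indicator of C, so
  dominated convergence carries the vanishing from continuous multipliers to closed sets.
  Nonemptiness excludes the default value \<open>infdist z {} = 0\<close>, for which
  \<open>?g n\<close> would be constantly 1; empty intersections are treated apart where this is
  applied.\<close>

lemma fcoef_zero_integral_closed:
  assumes f: "integrable circle f" "\<And>n. fcoef f n = 0" and C: "closed C" "C \<noteq> {}"
  shows "(LINT z|circle. indicator C z *\<^sub>R f z) = 0"
proof -
  let ?g = "\<lambda>n z. max 0 (1 - real n * infdist z C)"
  have [measurable]: "C \<inter> sphere 0 1 \<in> sets circle"
    using C by (auto simp: sets_circle sets_restrict_space)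
  have m: "(\<lambda>z. indicator C z *\<^sub>R f z) \<in> borel_measurable circle"
  proof -
    have "(\<lambda>z. indicator (C \<inter> sphere 0 1) z *\<^sub>R f z) \<in> borel_measurable circle"
      using f by measurable
    then show ?thesis
      by (rule measurable_cong[THEN iffD1, rotated]) (auto simp: indicator_def)
  qed
  have cont: "continuous_on (sphere 0 1) (?g n)" for n
    by (intro continuous_intros)
  have "(\<lambda>n. LINT z|circle. ?g n z *\<^sub>R f z) \<longlonglongrightarrow> (LINT z|circle. indicator C z *\<^sub>R f z)"
  proof (rule integral_dominated_convergence)
    show "integrable circle (\<lambda>z. norm (f z))"
      using f by simp
    show "AE z in circle. (\<lambda>n. ?g n z *\<^sub>R f z) \<longlonglongrightarrow> indicator C z *\<^sub>R f z"
    proof (rule AE_I2)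
      fix z
      have "(\<lambda>n. ?g n z) \<longlonglongrightarrow> indicator C z"
      proof (cases "z \<in> C")
        case False
        then have d: "infdist z C > 0"
          using C by (metis in_closed_iff_infdist_zero infdist_nonneg less_eq_real_def)
        have "\<forall>\<^sub>F n in sequentially. ?g n z = 0"
          using eventually_ge_at_top[of "nat \<lceil>1 / infdist z C\<rceil>"]
        proof eventually_elim
          case (elim n)
          then have "1 / infdist z C \<le> real n" by linarith
          then show ?case using d by (simp add: field_simps)
        qed
        then show ?thesis
          using False by (simp add: tendsto_eventually)
      qed auto
      then show "(\<lambda>n. ?g n z *\<^sub>R f z) \<longlonglongrightarrow> indicator C z *\<^sub>R f z"
        by (intro tendsto_intros)
    qed
    show "AE z in circle. norm (?g n z *\<^sub>R f z) \<le> norm (f z)" for n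
      by (rule AE_I2) (auto intro!: mult_left_le_one_le simp: infdist_nonneg max_def)
    show "(\<lambda>z. ?g n z *\<^sub>R f z) \<in> borel_measurable circle" for n
      using f continuous_on_circle_measurable[OF cont] by measurable
  qed (rule m)
  then have "(\<lambda>n::nat. 0::complex) \<longlonglongrightarrow> (LINT z|circle. indicator C z *\<^sub>R f z)"
    by (simp add: fcoef_zero_integral_continuous[OF f cont])
  then show ?thesis
    by (metis LIMSEQ_const_iff)
qed

text \<open>Closed sets generate the Borel sets and are stable under intersection, and the sets over
  which the integral vanishes form a Dynkin system; hence the integral vanishes over every
  measurable set, which forces the function to be 0 a.e.\<close>

theorem fcoef_zero_imp_AE_zero:
  assumes f: "integrable circle f" "\<And>n. fcoef f n = 0"
  shows "AE z in circle. f z = 0"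
proof (rule circle.density_zero)
  fix A assume A: "A \<in> sets circle"
  \<comment> \<open>The integral over the whole circle, from which the complement case
    subtracts.\<close>
  have zero: "set_lebesgue_integral circle (sphere 0 1) f = 0"
    using fcoef_zero_integral_closed[OF f, of "sphere 0 1"] 
    by (simp add: set_lebesgue_integral_def)
  have borel: "set_lebesgue_integral circle (B \<inter> sphere 0 1) f = 0" if "B \<in> sets borel" for B
  proof -
    have m: "X \<in> sigma_sets UNIV (Collect closed) \<Longrightarrow> X \<inter> sphere 0 1 \<in> sets circle" for X :: "complex set"
      by (auto simp: sets_circle sets_restrict_space borel_eq_closed)
    have int: "X \<in> sigma_sets UNIV (Collect closed) \<Longrightarrow> set_integrable circle (X \<inter> sphere 0 1) f"
      for X :: "complex set"
      using m f unfolding set_integrable_def by (intro integrable_mult_indicator) auto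
    have "B \<in> sigma_sets UNIV (Collect closed)"
      using that by (simp add: borel_eq_closed)
    then show ?thesis
    proof (induction B rule: sigma_sets_induct_disjoint[rotated 2, consumes 1, case_names basic empty compl union Int closed])
      case (basic X)
      then show ?case
      proof (cases "X \<inter> sphere 0 1 = {}")
        case False
        then show ?thesis
          using fcoef_zero_integral_closed[OF f, of "X \<inter> sphere 0 1"] basic
          by (simp add: set_lebesgue_integral_def closed_Int)
      qed (simp add: set_lebesgue_integral_def)
    next
      case (compl X)
      have "set_lebesgue_integral circle ((UNIV - X) \<inter> sphere 0 1 \<union> X \<inter> sphere 0 1) f =
          set_lebesgue_integral circle ((UNIV - X) \<inter> sphere 0 1) f + set_lebesgue_integral circle (X \<inter> sphere 0 1) f"
        by (rule set_integral_Un) (use compl int in \<open>auto intro: sigma_sets.Compl\<close>)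
      moreover have "(UNIV - X) \<inter> sphere 0 1 \<union> X \<inter> sphere 0 1 = sphere 0 1" by auto
      ultimately show ?case
        using compl zero by simp
    next
      case (union X)
      have "set_lebesgue_integral circle (\<Union>i. X i \<inter> sphere 0 1) f =
          (\<Sum>i. set_lebesgue_integral circle (X i \<inter> sphere 0 1) f)"
        by (rule lebesgue_integral_countable_add)
          (use union m in \<open>auto simp: disjoint_family_on_def range_subsetD
            intro!: int[of "\<Union>(range X)", simplified Int_UN_distrib2 UN_simps] sigma_sets.Union\<close>)
      then show ?case
        using union by simp
    qed (auto simp: Int_stable_def set_lebesgue_integral_def)
  qed
  obtain B where "B \<in> sets borel" "A = B \<inter> sphere 0 1"
    using A by (auto simp: sets_circle sets_restrict_space)
  then show "set_lebesgue_integral circle A f = 0"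
    using borel by simp
qed (rule f)

text \<open>The usual way below to identify two functions, in particular when one was obtained by
  choice: only coefficients have to be compared. Integrability suffices, so it also applies to
  products of L2 functions.\<close>

lemma fcoef_eq_imp_AE_eq:
  assumes "integrable circle f" "integrable circle g" "\<And>n. fcoef f n = fcoef g n"
  shows "AE z in circle. f z = g z"
  using fcoef_zero_imp_AE_zero[of "\<lambda>z. f z - g z"] assms by (simp add: fcoef_diff)

subsection \<open>The space \<open>L2\<close>\<close>

lemma L2_measurable [measurable_dest]: "f \<in> L2 \<Longrightarrow> f \<in> borel_measurable circle"
  by (simp add: L2_def)

lemma L2_square_integrable: "f \<in> L2 \<Longrightarrow> integrable circle (\<lambda>z. (norm (f z))\<^sup>2)"
  by (simp add: L2_def)

lemma L2_bound:
  assumes "integrable circle h" "f \<in> borel_measurable circle" "AE z in circle. (norm (f z))\<^sup>2 \<le> h z"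
  shows "f \<in> L2"
proof -
  have "integrable circle (\<lambda>z. (norm (f z))\<^sup>2)"
  proof (rule Bochner_Integration.integrable_bound[OF assms(1)])
    show "AE z in circle. norm ((norm (f z))\<^sup>2) \<le> norm (h z)"
      using assms(3) by eventually_elim auto
  qed (use assms in measurable)
  then show ?thesis
    using assms by (simp add: L2_def)
qed

lemma L2_mult_bounded:
  assumes "f \<in> L2" "g \<in> borel_measurable circle" "AE z in circle. norm (g z) \<le> C"
  shows "(\<lambda>z. g z * f z) \<in> L2"
proof (rule L2_bound)
  show "integrable circle (\<lambda>z. C\<^sup>2 * (norm (f z))\<^sup>2)"
    using L2_square_integrable[OF assms(1)] by simp
  show "AE z in circle. (norm (g z * f z))\<^sup>2 \<le> C\<^sup>2 * (norm (f z))\<^sup>2"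
    using assms(3)
    by eventually_elim (auto simp: norm_mult power_mult_distrib intro!: mult_right_mono power_mono)
qed (use assms in measurable)

lemma L2_continuous:
  assumes "continuous_on (sphere 0 1) g"
  shows "g \<in> L2"
proof -
  have "integrable circle (\<lambda>z. complex_of_real ((norm (g z))\<^sup>2))"
    by (intro integrable_continuous_circle continuous_intros assms)
  then have "integrable circle (\<lambda>z. (norm (g z))\<^sup>2)"
    using integrable_Re by fastforce
  then show ?thesis
    using continuous_on_circle_measurable[OF assms] by (simp add: L2_def)
qed

lemma L2_mult_continuous:
  fixes f g :: cfun
  assumes "f \<in> L2" "continuous_on (sphere 0 1) g"
  shows "(\<lambda>z. g z * f z) \<in> L2"
proof -
  have "compact (g ` sphere 0 1)"
    using assms(2) by (rule compact_continuous_image) auto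
  then obtain C where "\<And>z. z \<in> sphere 0 1 \<Longrightarrow> norm (g z) \<le> C"
    using compact_imp_bounded bounded_iff by (metis imageI)
  then show ?thesis
    by (intro L2_mult_bounded[of _ _ C] AE_circleI continuous_on_circle_measurable assms) auto
qed

lemma L2_power_int: "(\<lambda>z. z powi n) \<in> L2"
  by (rule L2_continuous[OF continuous_on_power_int_sphere])

lemma L2_mult_power_int: "f \<in> L2 \<Longrightarrow> (\<lambda>z. z powi n * f z) \<in> L2"
  by (rule L2_mult_continuous[OF _ continuous_on_power_int_sphere])

lemma cnj_measurable [measurable]: "cnj \<in> borel_measurable borel"
  by (intro borel_measurable_continuous_onI continuous_intros)

lemma L2_cnj: "f \<in> L2 \<Longrightarrow> (\<lambda>z. cnj (f z)) \<in> L2"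
  by (auto simp: L2_def)

lemma L2_lincomb:
  assumes "f \<in> L2" "g \<in> L2"
  shows "(\<lambda>z. a * f z + b * g z) \<in> L2"
proof (rule L2_bound)
  show "integrable circle (\<lambda>z. 2 * (norm a)\<^sup>2 * (norm (f z))\<^sup>2 + 2 * (norm b)\<^sup>2 * (norm (g z))\<^sup>2)"
    using assms[THEN L2_square_integrable] by simp
  have "(norm (x + y))\<^sup>2 \<le> 2 * (norm x)\<^sup>2 + 2 * (norm y)\<^sup>2" for x y :: complex
  proof -
    have "(norm (x + y))\<^sup>2 \<le> (norm x + norm y)\<^sup>2"
      by (intro power_mono norm_triangle_ineq) auto
    also have "\<dots> \<le> 2 * (norm x)\<^sup>2 + 2 * (norm y)\<^sup>2"
      using sum_squares_bound[of "norm x" "norm y"] by (simp add: power2_sum)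
    finally show ?thesis .
  qed
  from this[of "a * _" "b * _"]
  show "AE z in circle. (norm (a * f z + b * g z))\<^sup>2 \<le>
      2 * (norm a)\<^sup>2 * (norm (f z))\<^sup>2 + 2 * (norm b)\<^sup>2 * (norm (g z))\<^sup>2"
    by (auto simp: norm_mult power_mult_distrib mult.assoc)
qed (use assms in measurable)

lemma L2_add: "f \<in> L2 \<Longrightarrow> g \<in> L2 \<Longrightarrow> (\<lambda>z. f z + g z) \<in> L2"
  using L2_lincomb[of f g 1 1] by simp

lemma L2_diff: "f \<in> L2 \<Longrightarrow> g \<in> L2 \<Longrightarrow> (\<lambda>z. f z - g z) \<in> L2"
  using L2_lincomb[of f g 1 "-1"] by simp

lemma L2_cmult: "f \<in> L2 \<Longrightarrow> (\<lambda>z. c * f z) \<in> L2"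
  using L2_lincomb[of f f c 0] by simp

lemma L2_zero [simp]: "(\<lambda>z. 0) \<in> L2"
  by (simp add: L2_def)

lemma L2_const [simp]: "(\<lambda>z. c) \<in> L2"
  by (simp add: L2_def)

lemma L2_sum: "(\<And>i. i \<in> I \<Longrightarrow> f i \<in> L2) \<Longrightarrow> (\<lambda>z. \<Sum>i\<in>I. f i z) \<in> L2"
  by (induction I rule: infinite_finite_induct) (auto intro: L2_add)

lemma L2_mult_integrable:
  assumes "f \<in> L2" "g \<in> L2"
  shows "integrable circle (\<lambda>z. f z * g z)"
proof (rule Bochner_Integration.integrable_bound)
  show "integrable circle (\<lambda>z. (norm (f z))\<^sup>2 + (norm (g z))\<^sup>2)"
    using assms[THEN L2_square_integrable] by simp
  have "x * y \<le> x\<^sup>2 + y\<^sup>2" if "x \<ge> 0" "y \<ge> 0" for x y :: real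
    using sum_squares_bound[of x y] mult_nonneg_nonneg[OF that] by linarith
  then show "AE z in circle. norm (f z * g z) \<le> norm ((norm (f z))\<^sup>2 + (norm (g z))\<^sup>2)"
    by (intro AE_I2) (simp add: norm_mult)
qed (use assms in measurable)

lemma L2_integrable: "f \<in> L2 \<Longrightarrow> integrable circle f"
  using L2_mult_integrable[of f "\<lambda>_. 1"] by simp

lemma ip_integrable: "f \<in> L2 \<Longrightarrow> g \<in> L2 \<Longrightarrow> integrable circle (\<lambda>z. f z * cnj (g z))"
  by (intro L2_mult_integrable L2_cnj)

lemma ip_cong_AE:
  assumes "AE z in circle. f z = f' z" "AE z in circle. g z = g' z"
    "f \<in> L2" "f' \<in> L2" "g \<in> L2" "g' \<in> L2"
  shows "ip f g = ip f' g'"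
  unfolding ip_def
proof (rule integral_cong_AE)
  show "AE x in circle. f x * cnj (g x) = f' x * cnj (g' x)"
    using assms(1,2) by eventually_elim simp
qed (use assms in measurable)

lemma ip_commute: "ip g f = cnj (ip f g)"
proof -
  have "ip g f = (LINT z|circle. cnj (f z * cnj (g z)))"
    by (simp add: ip_def mult.commute)
  also have "\<dots> = cnj (LINT z|circle. f z * cnj (g z))"
    by (rule Bochner_Integration.integral_cnj)
  finally show ?thesis
    by (simp add: ip_def)
qed

lemma ip_lincomb_left:
  assumes "f \<in> L2" "g \<in> L2" "h \<in> L2"
  shows "ip (\<lambda>z. a * f z + b * g z) h = a * ip f h + b * ip g h"
proof -
  have "ip (\<lambda>z. a * f z + b * g z) h = (LINT z|circle. a * (f z * cnj (h z)) + b * (g z * cnj (h z)))"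
    by (simp add: ip_def algebra_simps)
  then show ?thesis
    using ip_integrable assms by (simp add: ip_def)
qed

lemma ip_lincomb_right:
  assumes "f \<in> L2" "g \<in> L2" "h \<in> L2"
  shows "ip h (\<lambda>z. a * f z + b * g z) = cnj a * ip h f + cnj b * ip h g"
  by (subst (1 2 3) ip_commute) (simp add: ip_lincomb_left assms)

lemma ip_add_left: "f \<in> L2 \<Longrightarrow> g \<in> L2 \<Longrightarrow> h \<in> L2 \<Longrightarrow> ip (\<lambda>z. f z + g z) h = ip f h + ip g h"
  using ip_lincomb_left[of f g h 1 1] by simp

lemma ip_diff_left: "f \<in> L2 \<Longrightarrow> g \<in> L2 \<Longrightarrow> h \<in> L2 \<Longrightarrow> ip (\<lambda>z. f z - g z) h = ip f h - ip g h"
  using ip_lincomb_left[of f g h 1 "-1"] by simp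

lemma ip_diff_right: "f \<in> L2 \<Longrightarrow> g \<in> L2 \<Longrightarrow> h \<in> L2 \<Longrightarrow> ip h (\<lambda>z. f z - g z) = ip h f - ip h g"
  using ip_lincomb_right[of f g h 1 "-1"] by simp

lemma ip_cmult_left: "ip (\<lambda>z. c * f z) h = c * ip f h"
  by (simp add: ip_def mult.assoc)

lemma ip_cmult_right: "ip h (\<lambda>z. c * f z) = cnj c * ip h f"
  by (simp add: ip_def mult.left_commute)

lemma ip_sum_left:
  assumes "\<And>i. i \<in> I \<Longrightarrow> f i \<in> L2" "h \<in> L2"
  shows "ip (\<lambda>z. \<Sum>i\<in>I. f i z) h = (\<Sum>i\<in>I. ip (f i) h)"
  unfolding ip_def sum_distrib_right
  by (rule Bochner_Integration.integral_sum) (use assms ip_integrable in auto)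

lemma fcoef_eq_ip: "fcoef f n = ip f (\<lambda>z. z powi n)"
  unfolding fcoef_def ip_def
  by (rule Bochner_Integration.integral_cong)
    (auto simp: cnj_power_int_circle simp del: complex_cnj_power_int)

lemma l2norm_nonneg [simp]: "l2norm f \<ge> 0"
  by (simp add: l2norm_def)

lemma l2norm_power2: "(l2norm f)\<^sup>2 = (LINT z|circle. (norm (f z))\<^sup>2)"
  by (simp add: l2norm_def)

lemma ip_self: "ip f f = of_real ((l2norm f)\<^sup>2)"
proof -
  have "ip f f = (LINT z|circle. complex_of_real ((norm (f z))\<^sup>2))"
    unfolding ip_def by (simp add: complex_norm_square[symmetric] del: of_real_power)
  then show ?thesis
    by (simp only: integral_complex_of_real l2norm_power2)
qed

lemma l2norm_cong_AE:
  assumes "AE z in circle. f z = g z" "f \<in> borel_measurable circle" "g \<in> borel_measurable circle"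
  shows "l2norm f = l2norm g"
proof -
  have "(LINT z|circle. (norm (f z))\<^sup>2) = (LINT z|circle. (norm (g z))\<^sup>2)"
    by (rule integral_cong_AE) (use assms in \<open>measurable; fastforce\<close>)+
  then show ?thesis by (simp add: l2norm_def)
qed

lemma l2norm_eq_0_AE:
  assumes "f \<in> L2" "l2norm f = 0"
  shows "AE z in circle. f z = 0"
proof -
  have "(LINT z|circle. (norm (f z))\<^sup>2) = 0"
    using assms l2norm_power2[of f] by simp
  then have "AE z in circle. (norm (f z))\<^sup>2 = 0"
    by (subst (asm) integral_nonneg_eq_0_iff_AE) (use L2_square_integrable[OF assms(1)] in auto)
  then show ?thesis by simp
qed

text \<open>The pointwise bound x y \<le> t x^2 / 2 + y^2 / (2 t) is integrated, with t the ratio of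
  the two norms. The norms are first enlarged by e > 0, so that the ratio exists and is positive,
  and e tends to 0 at the end.\<close>

lemma Cauchy_Schwarz_L1:
  assumes "f \<in> L2" "g \<in> L2"
  shows "(LINT z|circle. norm (f z * g z)) \<le> l2norm f * l2norm g"
proof -
  let ?I = "LINT z|circle. norm (f z * g z)"
  have "?I \<le> (l2norm f + e) * (l2norm g + e)" if e: "e > 0" for e
  proof -
    define A B where AB: "A = l2norm f + e" "B = l2norm g + e"
    have pos: "A > 0" "B > 0" "l2norm f \<le> A" "l2norm g \<le> B"
      using e l2norm_nonneg[of f] l2norm_nonneg[of g] unfolding AB by linarith+
    define t where "t = B / A"
    have t: "t > 0" using pos by (simp add: t_def)
    have "?I \<le> (LINT z|circle. t / 2 * (norm (f z))\<^sup>2 + 1 / (2 * t) * (norm (g z))\<^sup>2)"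
    proof (rule integral_mono)
      fix z
      have "0 \<le> (t * norm (f z) - norm (g z))\<^sup>2" by simp
      then show "norm (f z * g z) \<le> t / 2 * (norm (f z))\<^sup>2 + 1 / (2 * t) * (norm (g z))\<^sup>2"
        using t by (simp add: norm_mult power2_diff field_simps power2_eq_square)
    qed (use assms L2_square_integrable L2_mult_integrable in auto)
    also have "\<dots> = t / 2 * (l2norm f)\<^sup>2 + 1 / (2 * t) * (l2norm g)\<^sup>2"
      using assms[THEN L2_square_integrable] by (simp add: l2norm_power2)
    also have "\<dots> \<le> t / 2 * A\<^sup>2 + 1 / (2 * t) * B\<^sup>2"
      using t pos by (intro add_mono mult_left_mono power_mono) auto
    also have "\<dots> = A * B"
      using pos by (simp add: t_def field_simps power2_eq_square)
    finally show ?thesis by (simp add: AB)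
  qed
  moreover have "((\<lambda>e. (l2norm f + e) * (l2norm g + e)) \<longlongrightarrow> (l2norm f + 0) * (l2norm g + 0)) (at_right 0)"
    by (intro tendsto_intros)
  ultimately show ?thesis
    using tendsto_lowerbound[of "\<lambda>e. (l2norm f + e) * (l2norm g + e)" _ "at_right 0" ?I]
    by (simp add: eventually_at_right_less eventually_at_right_field)
      (metis add.right_neutral trivial_limit_at_right_real gt_ex)
qed

lemma Cauchy_Schwarz: "f \<in> L2 \<Longrightarrow> g \<in> L2 \<Longrightarrow> norm (ip f g) \<le> l2norm f * l2norm g"
  unfolding ip_def
  using Cauchy_Schwarz_L1[of f g]
  by (intro order_trans[OF integral_norm_bound]) (simp add: norm_mult)

lemma L1_le_l2norm:
  assumes "f \<in> L2"
  shows "(LINT z|circle. norm (f z)) \<le> l2norm f"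
  using Cauchy_Schwarz_L1[OF assms, of "\<lambda>_. 1"] by (simp add: l2norm_def)

lemma norm_fcoef_le_l2norm: "f \<in> L2 \<Longrightarrow> norm (fcoef f n) \<le> l2norm f"
proof -
  assume f: "f \<in> L2"
  have "norm (fcoef f n) \<le> (LINT z|circle. norm (f z * z powi (-n)))"
    unfolding fcoef_def by (rule integral_norm_bound)
  also have "\<dots> = (LINT z|circle. norm (f z))"
    by (rule Bochner_Integration.integral_cong) (auto simp: norm_mult norm_power_int)
  finally show ?thesis
    using L1_le_l2norm[OF f] by simp
qed

lemma l2norm_le_bounded:
  assumes "f \<in> L2" "g \<in> borel_measurable circle" "AE z in circle. norm (g z) \<le> C" "C \<ge> 0"
  shows "l2norm (\<lambda>z. g z * f z) \<le> C * l2norm f"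
proof (rule power2_le_imp_le)
  have "(l2norm (\<lambda>z. g z * f z))\<^sup>2 \<le> (LINT z|circle. C\<^sup>2 * (norm (f z))\<^sup>2)"
    unfolding l2norm_power2
  proof (rule integral_mono_AE)
    show "AE z in circle. (norm (g z * f z))\<^sup>2 \<le> C\<^sup>2 * (norm (f z))\<^sup>2"
      using assms(3)
      by eventually_elim (auto simp: norm_mult power_mult_distrib intro!: mult_right_mono power_mono)
  qed (use assms L2_square_integrable L2_mult_bounded in auto)
  then show "(l2norm (\<lambda>z. g z * f z))\<^sup>2 \<le> (C * l2norm f)\<^sup>2"
    by (simp add: l2norm_power2 power_mult_distrib)
qed (use assms in simp)

subsection \<open>Riesz--Fischer and Parseval\<close>

text \<open>Arbitrary finite index sets are allowed because Fourier series are summed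
  unconditionally, along \<open>finite_subsets_at_top\<close>.\<close>

definition trig :: "(int \<Rightarrow> complex) \<Rightarrow> int set \<Rightarrow> cfun" where
  "trig c F = (\<lambda>z. \<Sum>n\<in>F. c n * z powi n)"

lemma L2_trig [simp]: "trig c F \<in> L2"
  unfolding trig_def by (intro L2_sum L2_cmult L2_power_int)

lemma trig_measurable [measurable]: "trig c F \<in> borel_measurable circle"
  by (rule L2_measurable) simp

lemma ip_trig_left: "f \<in> L2 \<Longrightarrow> ip (trig c F) f = (\<Sum>n\<in>F. c n * cnj (fcoef f n))"
  unfolding trig_def fcoef_eq_ip
  by (subst ip_sum_left)
    (auto intro!: L2_cmult L2_power_int sum.cong simp: ip_cmult_left simp flip: ip_commute)

lemma fcoef_trig: 
  assumes "finite F"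
  shows "fcoef (trig c F) n = (if n \<in> F then c n else 0)"
proof -
  have "fcoef (trig c F) n = (\<Sum>m\<in>F. c m * cnj (fcoef (\<lambda>z. z powi n) m))"
    by (simp only: fcoef_eq_ip[of "trig c F"] ip_trig_left[OF L2_power_int])
  also have "\<dots> = (\<Sum>m\<in>F. if m = n then c m else 0)"
    by (rule sum.cong) (auto simp: fcoef_power_int)
  finally show ?thesis
    using assms by simp
qed

lemma l2norm_trig: "finite F \<Longrightarrow> (l2norm (trig c F))\<^sup>2 = (\<Sum>n\<in>F. (norm (c n))\<^sup>2)"
proof -
  assume F: "finite F"
  have "complex_of_real ((l2norm (trig c F))\<^sup>2) = ip (trig c F) (trig c F)"
    by (rule ip_self[symmetric])
  also have "\<dots> = (\<Sum>n\<in>F. c n * cnj (c n))"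
    by (simp add: ip_trig_left fcoef_trig F)
  also have "\<dots> = complex_of_real (\<Sum>n\<in>F. (norm (c n))\<^sup>2)"
    by (simp add: complex_norm_square del: of_real_power)
  finally show ?thesis
    by (simp only: of_real_eq_iff)
qed

text \<open>Pythagoras for the projection onto the span of finitely many powers. Nonnegativity of
  the left side is Bessel's inequality, and once the full sum is known to equal the squared norm the
  identity gives convergence of the partial sums.\<close>

lemma l2norm_diff_trig:
  assumes "f \<in> L2" "finite F"
  shows "(l2norm (\<lambda>z. f z - trig (fcoef f) F z))\<^sup>2 = (l2norm f)\<^sup>2 - (\<Sum>n\<in>F. (norm (fcoef f n))\<^sup>2)"
proof -
  let ?s = "trig (fcoef f) F" and ?S = "\<Sum>n\<in>F. (norm (fcoef f n))\<^sup>2"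
  have sf: "ip ?s f = of_real ?S"
    by (simp add: ip_trig_left assms complex_norm_square del: of_real_power)
  have fs: "ip f ?s = of_real ?S"
    by (subst ip_commute) (simp only: sf complex_cnj_complex_of_real)
  have ss: "ip ?s ?s = of_real ?S"
    by (simp only: ip_self l2norm_trig[OF assms(2)])
  have "complex_of_real ((l2norm (\<lambda>z. f z - ?s z))\<^sup>2) = ip (\<lambda>z. f z - ?s z) (\<lambda>z. f z - ?s z)"
    by (rule ip_self[symmetric])
  also have "\<dots> = ip f f - ip f ?s - (ip ?s f - ip ?s ?s)"
    by (simp add: ip_diff_left ip_diff_right L2_diff assms)
  also have "\<dots> = of_real ((l2norm f)\<^sup>2 - ?S)"
    unfolding fs sf ss ip_self[of f] by simp
  finally show ?thesis
    by (simp only: of_real_eq_iff)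
qed

lemma Bessel:
  assumes "f \<in> L2"
  shows "(\<lambda>n. (norm (fcoef f n))\<^sup>2) summable_on UNIV"
    and "infsum (\<lambda>n. (norm (fcoef f n))\<^sup>2) UNIV \<le> (l2norm f)\<^sup>2"
proof -
  have le: "(\<Sum>n\<in>F. (norm (fcoef f n))\<^sup>2) \<le> (l2norm f)\<^sup>2" if "finite F" for F
    using l2norm_diff_trig[OF assms that] zero_le_power2[of "l2norm (\<lambda>z. f z - trig (fcoef f) F z)"]
    by linarith
  show s: "(\<lambda>n. (norm (fcoef f n))\<^sup>2) summable_on UNIV"
    by (rule nonneg_bdd_above_summable_on) (use le in \<open>auto intro!: bdd_aboveI2\<close>)
  show "infsum (\<lambda>n. (norm (fcoef f n))\<^sup>2) UNIV \<le> (l2norm f)\<^sup>2"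
    by (rule infsum_le_finite_sums[OF s]) (use le in auto)
qed

text \<open>
  The partial sums are taken along a sequence with geometrically small increments, so that they
  converge almost everywhere.
\<close>

theorem Riesz_Fischer:
  assumes c: "(\<lambda>n. (norm (c n))\<^sup>2) summable_on (UNIV :: int set)"
  obtains f where "f \<in> L2" "\<And>n. fcoef f n = c n"
    "(l2norm f)\<^sup>2 \<le> infsum (\<lambda>n. (norm (c n))\<^sup>2) UNIV"
proof -
  define S where "S = infsum (\<lambda>n. (norm (c n))\<^sup>2) UNIV"
  define I where "I = (\<lambda>N::nat. {- int N..int N})"
  define Q where "Q = (\<lambda>F. \<Sum>n\<in>F. (norm (c n))\<^sup>2)"
  have Qle: "Q F \<le> S" if "finite F" for F
    unfolding Q_def S_def by (rule finite_sum_le_infsum[OF c]) (use that in auto)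
  have Qlim: "\<exists>N. \<forall>n\<ge>N. S - Q (I n) \<le> (1/4)^j" for j
  proof -
    have "(Q \<longlongrightarrow> S) (finite_subsets_at_top UNIV)"
      using has_sum_infsum[OF c] unfolding has_sum_def Q_def S_def .
    then have "\<forall>\<^sub>F F in finite_subsets_at_top UNIV. Q F > S - (1/4)^j"
      by (rule order_tendstoD) simp
    then obtain X where X: "finite X" "\<And>F. finite F \<Longrightarrow> X \<subseteq> F \<Longrightarrow> Q F > S - (1/4)^j"
      by (auto simp: eventually_finite_subsets_at_top)
    define N where "N = Max ((\<lambda>x. nat \<bar>x\<bar>) ` X)"
    have N: "nat \<bar>x\<bar> \<le> N" if "x \<in> X" for x
      unfolding N_def using X(1) that by (intro Max_ge) auto
    have "S - Q (I n) \<le> (1/4)^j" if "n \<ge> N" for n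
    proof -
      have "X \<subseteq> I n"
      proof
        fix x assume "x \<in> X"
        then have "nat \<bar>x\<bar> \<le> n" using N that order_trans by blast
        then show "x \<in> I n" by (auto simp: I_def)
      qed
      then show ?thesis
        using X(2)[of "I n"] by (simp add: I_def)
    qed
    then show ?thesis by blast
  qed
  then have "\<exists>M. \<forall>j. \<forall>n\<ge>M j. S - Q (I n) \<le> (1/4)^j"
    by (intro choice allI)
  then obtain M where M: "\<And>j n. n \<ge> M j \<Longrightarrow> S - Q (I n) \<le> (1/4)^j"
    by blast
  \<comment> \<open>Summing the \<open>M i\<close> makes N monotone and at least \<open>M j\<close>;
    the extra j forces N to infinity, so that every index eventually lies in
    \<open>I (N j)\<close>.\<close>
  define N where "N = (\<lambda>j. j + (\<Sum>i\<le>j. M i))"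
  have NM: "N j \<ge> M j" for j
    unfolding N_def using member_le_sum[of j "{..j}" M] by simp
  have Nj: "N j \<ge> j" for j
    by (simp add: N_def)
  have NSuc: "N j \<le> N (Suc j)" for j
    by (simp add: N_def)
  define s where "s = (\<lambda>j. trig c (I (N j)))"
  define d where "d = (\<lambda>j z. s (Suc j) z - s j z)"
  have sL2 [simp]: "s j \<in> L2" for j by (simp add: s_def)
  have sm: "s j \<in> borel_measurable circle" for j by (simp add: s_def)
  have dL2 [simp]: "d j \<in> L2" for j unfolding d_def by (intro L2_diff) auto
  have d_trig: "d j = trig c (I (N (Suc j)) - I (N j))" for j
    using NSuc[of j] unfolding d_def s_def trig_def I_def
    by (subst sum_diff) (auto simp: fun_eq_iff)
  \<comment> \<open>The squared norm is a difference of two partial sums, both at most S and the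
    smaller one within (1/4)^j of S; the root gives a summable bound.\<close>
  have dnorm: "l2norm (d j) \<le> (1/2)^j" for j
  proof (rule power2_le_imp_le)
    have "(l2norm (d j))\<^sup>2 = Q (I (N (Suc j)) - I (N j))"
      unfolding d_trig Q_def by (rule l2norm_trig) (auto simp: I_def)
    also have "\<dots> = Q (I (N (Suc j))) - Q (I (N j))"
      unfolding Q_def using NSuc[of j] by (subst sum_diff) (auto simp: I_def)
    also have "\<dots> \<le> (1/4)^j"
      using Qle[of "I (N (Suc j))"] M[OF NM, of j] by (simp add: I_def)
    also have "(1/4::real)^j = ((1/2)^j)\<^sup>2"
      by (subst power_mult[symmetric], subst mult.commute, subst power_mult) (simp add: power2_eq_square)
    finally show "(l2norm (d j))\<^sup>2 \<le> ((1/2)^j)\<^sup>2" .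
  qed simp
  have d1: "(LINT z|circle. norm (d j z)) \<le> (1/2)^j" for j
    by (rule order_trans[OF L1_le_l2norm[OF dL2] dnorm])
  have sumd1: "summable (\<lambda>j. LINT z|circle. norm (d j z))"
    by (rule summable_comparison_test'[of "\<lambda>j. (1/2)^j" 0]) (use d1 in auto)
  have d_int: "integrable circle (d j)" for j
    by (rule L2_integrable) simp
  have dm [measurable]: "d j \<in> borel_measurable circle" for j
    by (rule L2_measurable) simp
  have ndm: "(\<lambda>z. norm (d j z)) \<in> borel_measurable circle" for j
    by (rule borel_measurable_integrable[OF integrable_norm[OF d_int]])
  have AEsum: "AE z in circle. summable (\<lambda>j. norm (d j z))"
  proof -
    have "(\<integral>\<^sup>+z. (\<Sum>j. ennreal (norm (d j z))) \<partial>circle) = (\<Sum>j. \<integral>\<^sup>+z. ennreal (norm (d j z)) \<partial>circle)"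
      by (rule nn_integral_suminf)
        (intro measurable_compose[OF ndm measurable_ennreal])
    also have "\<dots> = (\<Sum>j. ennreal (LINT z|circle. norm (d j z)))"
      by (rule suminf_cong, rule nn_integral_eq_integral, rule integrable_norm[OF d_int], simp)
    finally have "(\<integral>\<^sup>+z. (\<Sum>j. ennreal (norm (d j z))) \<partial>circle) = (\<Sum>j. ennreal (LINT z|circle. norm (d j z)))" .
    moreover have "(\<Sum>j. ennreal (LINT z|circle. norm (d j z))) \<noteq> top"
      by (rule ennreal_suminf_neq_top[OF sumd1]) simp
    ultimately have "(\<integral>\<^sup>+z. (\<Sum>j. ennreal (norm (d j z))) \<partial>circle) \<noteq> \<infinity>"
      by (simp only: infinity_ennreal_def not_False_eq_True)
    then have "AE z in circle. (\<Sum>j. ennreal (norm (d j z))) \<noteq> \<infinity>"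
      by (intro nn_integral_PInf_AE borel_measurable_suminf_order
        measurable_compose[OF ndm measurable_ennreal])
    then show ?thesis
    proof eventually_elim
      case (elim z)
      show ?case
        by (rule summable_suminf_not_top[OF norm_ge_zero]) (use elim in simp)
    qed
  qed
  \<comment> \<open>Where the series diverges its value is unspecified; by \<open>AEsum\<close> this
    concerns a null set only.\<close>
  define f where "f = (\<lambda>z. s 0 z + (\<Sum>j. d j z))"
  have fm [measurable]: "f \<in> borel_measurable circle"
    unfolding f_def by (intro borel_measurable_add borel_measurable_suminf dm sm)
  have tele: "(\<Sum>i<j. d i z) = s j z - s 0 z" for j z
    unfolding d_def by (rule sum_lessThan_telescope)
  have AElim: "AE z in circle. (\<lambda>j. s j z) \<longlonglongrightarrow> f z"
    using AEsum
  proof eventually_elim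
    case (elim z)
    then have "(\<lambda>j. \<Sum>i<j. d i z) \<longlonglongrightarrow> (\<Sum>j. d j z)"
      by (rule summable_LIMSEQ[OF summable_norm_cancel])
    then have "(\<lambda>j. s 0 z + (s j z - s 0 z)) \<longlonglongrightarrow> f z"
      unfolding tele f_def by (intro tendsto_intros)
    then show ?case by simp
  qed
  have S0: "S \<ge> 0" unfolding S_def by (intro infsum_nonneg) auto
  \<comment> \<open>Fatou's lemma; membership in L2 and the norm bound both come from this
    estimate.\<close>
  have nn: "(\<integral>\<^sup>+z. ennreal ((norm (f z))\<^sup>2) \<partial>circle) \<le> ennreal S"
  proof -
    have "(\<integral>\<^sup>+z. ennreal ((norm (f z))\<^sup>2) \<partial>circle) =
        (\<integral>\<^sup>+z. liminf (\<lambda>j. ennreal ((norm (s j z))\<^sup>2)) \<partial>circle)"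
    proof (rule nn_integral_cong_AE)
      show "AE z in circle. ennreal ((norm (f z))\<^sup>2) = liminf (\<lambda>j. ennreal ((norm (s j z))\<^sup>2))"
        using AElim
      proof eventually_elim
        case (elim z)
        then have "(\<lambda>j. ennreal ((norm (s j z))\<^sup>2)) \<longlonglongrightarrow> ennreal ((norm (f z))\<^sup>2)"
          by (intro tendsto_intros)
        then show ?case
          by (intro lim_imp_Liminf[symmetric] sequentially_bot)
      qed
    qed
    also have "\<dots> \<le> liminf (\<lambda>j. \<integral>\<^sup>+z. ennreal ((norm (s j z))\<^sup>2) \<partial>circle)"
      by (rule nn_integral_liminf)
        (rule measurable_compose[OF borel_measurable_integrable[OF L2_square_integrable[OF sL2]] measurable_ennreal])
    also have "\<dots> \<le> liminf (\<lambda>j. ennreal S)"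
    proof (intro Liminf_mono always_eventually allI)
      fix j
      have "(\<integral>\<^sup>+z. ennreal ((norm (s j z))\<^sup>2) \<partial>circle) = ennreal ((l2norm (s j))\<^sup>2)"
        unfolding l2norm_power2
        by (rule nn_integral_eq_integral) (auto intro: L2_square_integrable)
      also have "(l2norm (s j))\<^sup>2 = Q (I (N j))"
        unfolding s_def Q_def by (rule l2norm_trig) (simp add: I_def)
      also have "ennreal \<dots> \<le> ennreal S"
        by (intro ennreal_leI Qle) (simp add: I_def)
      finally show "(\<integral>\<^sup>+z. ennreal ((norm (s j z))\<^sup>2) \<partial>circle) \<le> ennreal S" .
    qed
    also have "\<dots> = ennreal S"
      by (simp add: Liminf_const)
    finally show ?thesis .
  qed
  have fint: "integrable circle (\<lambda>z. (norm (f z))\<^sup>2)"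
  proof (rule integrableI_bounded)
    show "(\<integral>\<^sup>+z. ennreal (norm ((norm (f z))\<^sup>2)) \<partial>circle) < \<infinity>"
      using le_less_trans[OF nn ennreal_less_top] by simp
  qed (intro borel_measurable_power measurable_compose[OF fm borel_measurable_norm])
  then have fL2: "f \<in> L2"
    by (simp add: L2_def fm)
  have "ennreal ((l2norm f)\<^sup>2) \<le> ennreal S"
    unfolding l2norm_power2
    using nn nn_integral_eq_integral[OF fint] by simp
  then have fnorm: "(l2norm f)\<^sup>2 \<le> S"
    using S0 by simp
  have fc: "fcoef f n = c n" for n
  proof -
    have nd: "norm (d j z * z powi (-n)) = norm (d j z)" if "norm z = 1" for j z
      using that by (simp add: norm_mult norm_power_int)
    have i1: "(LINT z|circle. norm (d j z * z powi (-n))) = (LINT z|circle. norm (d j z))" for j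
      by (rule Bochner_Integration.integral_cong) (auto simp: nd)
    \<comment> \<open>Summability of the L1 norms of the increments permits termwise integration, so
      each coefficient passes to the limit.\<close>
    have *: "(\<lambda>j. LINT z|circle. d j z * z powi (-n)) sums (LINT z|circle. (\<Sum>j. d j z * z powi (-n)))"
    proof (rule sums_integral)
      show "AE z in circle. summable (\<lambda>j. norm (d j z * z powi - n))"
        using AEsum AE_circleI[of "\<lambda>z. norm z = 1", simplified]
        by eventually_elim (simp only: nd)
      show "summable (\<lambda>j. LINT z|circle. norm (d j z * z powi - n))"
        unfolding i1 by (rule sumd1)
    qed (rule fcoef_integrable[OF d_int])
    have "(LINT z|circle. (\<Sum>j. d j z * z powi (-n))) = (LINT z|circle. (f z - s 0 z) * z powi (-n))"
    proof (rule integral_cong_AE)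
      show "AE z in circle. (\<Sum>j. d j z * z powi (-n)) = (f z - s 0 z) * z powi (-n)"
        using AEsum
      proof eventually_elim
        case (elim z)
        then show ?case
          using suminf_mult2[OF summable_norm_cancel[OF elim], of "z powi (-n)"] by (simp add: f_def)
      qed
    next
      show "(\<lambda>z. \<Sum>j. d j z * z powi (-n)) \<in> borel_measurable circle"
        by (intro borel_measurable_suminf borel_measurable_times dm power_int_measurable)
      show "(\<lambda>z. (f z - s 0 z) * z powi (-n)) \<in> borel_measurable circle"
        by (intro borel_measurable_times borel_measurable_diff fm sm power_int_measurable)
    qed
    with * have "(\<lambda>j. fcoef (d j) n) sums fcoef (\<lambda>z. f z - s 0 z) n"
      by (simp add: fcoef_def)
    then have "(\<lambda>j. \<Sum>i<j. fcoef (d i) n) \<longlonglongrightarrow> fcoef f n - fcoef (s 0) n"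
      unfolding sums_def fcoef_diff[OF L2_integrable[OF fL2] L2_integrable[OF sL2]] .
    moreover have "(\<Sum>i<j. fcoef (d i) n) = fcoef (s j) n - fcoef (s 0) n" for j
      unfolding d_def fcoef_diff[OF L2_integrable[OF sL2] L2_integrable[OF sL2]]
      by (rule sum_lessThan_telescope)
    ultimately have "(\<lambda>j. (fcoef (s j) n - fcoef (s 0) n) + fcoef (s 0) n) \<longlonglongrightarrow>
        (fcoef f n - fcoef (s 0) n) + fcoef (s 0) n"
      by (intro tendsto_add tendsto_const) simp
    then have l1: "(\<lambda>j. fcoef (s j) n) \<longlonglongrightarrow> fcoef f n"
      by simp
    have "\<forall>\<^sub>F j in sequentially. fcoef (s j) n = c n"
      using eventually_ge_at_top[of "nat \<bar>n\<bar>"]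
    proof eventually_elim
      case (elim j)
      then have "n \<in> I (N j)"
        using Nj[of j] unfolding I_def by auto
      then show ?case
        by (simp add: s_def fcoef_trig I_def)
    qed
    then have l2: "(\<lambda>j. fcoef (s j) n) \<longlonglongrightarrow> c n"
      by (rule tendsto_eventually)
    show ?thesis
      by (rule LIMSEQ_unique[OF l1 l2])
  qed
  show thesis
    by (rule that[OF fL2 fc]) (use fnorm S_def in simp)
qed

text \<open>Bessel gives one inequality. For the other, the function rebuilt from the coefficients
  by Riesz-Fischer has squared norm at most the sum, and uniqueness of coefficients makes it equal
  to f a.e.\<close>

theorem Parseval_norm:
  assumes "f \<in> L2"
  shows "((\<lambda>n. (norm (fcoef f n))\<^sup>2) has_sum (l2norm f)\<^sup>2) UNIV"
proof -
  obtain g where g: "g \<in> L2" "\<And>n. fcoef g n = fcoef f n"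
    "(l2norm g)\<^sup>2 \<le> infsum (\<lambda>n. (norm (fcoef f n))\<^sup>2) UNIV"
    by (rule Riesz_Fischer[OF Bessel(1)[OF assms]]) blast
  have "AE z in circle. g z = f z"
    by (rule fcoef_eq_imp_AE_eq) (use g assms L2_integrable in auto)
  then have "l2norm g = l2norm f"
    by (rule l2norm_cong_AE) (use g assms in measurable)
  then have "infsum (\<lambda>n. (norm (fcoef f n))\<^sup>2) UNIV = (l2norm f)\<^sup>2"
    using g(3) Bessel(2)[OF assms] by simp
  then show ?thesis
    using has_sum_infsum[OF Bessel(1)[OF assms]] by simp
qed

lemma trig_tendsto:
  assumes "f \<in> L2"
  shows "((\<lambda>F. l2norm (\<lambda>z. f z - trig (fcoef f) F z)) \<longlongrightarrow> 0) (finite_subsets_at_top UNIV)"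
proof -
  have "((\<lambda>F. (l2norm f)\<^sup>2 - (\<Sum>n\<in>F. (norm (fcoef f n))\<^sup>2)) \<longlongrightarrow> (l2norm f)\<^sup>2 - (l2norm f)\<^sup>2)
      (finite_subsets_at_top UNIV)"
    by (intro tendsto_intros Parseval_norm[OF assms, unfolded has_sum_def])
  then have "((\<lambda>F. (l2norm (\<lambda>z. f z - trig (fcoef f) F z))\<^sup>2) \<longlongrightarrow> 0) (finite_subsets_at_top UNIV)"
    by (subst tendsto_cong) (auto intro!: eventually_finite_subsets_at_top_weakI l2norm_diff_trig assms)
  from tendsto_real_sqrt[OF this] show ?thesis
    by simp
qed

theorem Parseval:
  assumes "f \<in> L2" "g \<in> L2"
  shows "((\<lambda>n. fcoef f n * cnj (fcoef g n)) has_sum ip f g) UNIV"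
  unfolding has_sum_def
proof (rule Lim_transform2)
  show "((\<lambda>F. ip f g) \<longlongrightarrow> ip f g) (finite_subsets_at_top UNIV)"
    by (rule tendsto_const)
  have "((\<lambda>F. ip (\<lambda>z. f z - trig (fcoef f) F z) g) \<longlongrightarrow> 0) (finite_subsets_at_top UNIV)"
  proof (rule Lim_null_comparison)
    show "\<forall>\<^sub>F F in finite_subsets_at_top UNIV. norm (ip (\<lambda>z. f z - trig (fcoef f) F z) g) \<le>
        l2norm (\<lambda>z. f z - trig (fcoef f) F z) * l2norm g"
      by (intro always_eventually allI Cauchy_Schwarz L2_diff assms L2_trig)
    show "((\<lambda>F. l2norm (\<lambda>z. f z - trig (fcoef f) F z) * l2norm g) \<longlongrightarrow> 0) (finite_subsets_at_top UNIV)"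
      by (rule tendsto_mult_left_zero[OF trig_tendsto[OF assms(1)]])
  qed
  then show "((\<lambda>F. ip f g - (\<Sum>n\<in>F. fcoef f n * cnj (fcoef g n))) \<longlongrightarrow> 0) (finite_subsets_at_top UNIV)"
    by (simp only: ip_diff_left[OF assms(1) L2_trig assms(2)] ip_trig_left[OF assms(2)])
qed



text \<open>Density of trigonometric polynomials, phrased for functionals. In this form it
  identifies \<open>W k\<close> and yields the density of bounded functions in a model
  space.\<close>

lemma bounded_functional_eq_zero:
  assumes lin: "\<And>f g a b. f \<in> L2 \<Longrightarrow> g \<in> L2 \<Longrightarrow> \<Lambda> (\<lambda>z. a * f z + b * g z) = a * \<Lambda> f + b * (\<Lambda> g :: complex)"
    and bound: "\<And>f. f \<in> L2 \<Longrightarrow> norm (\<Lambda> f) \<le> C * l2norm f"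
    and zero: "\<And>n. \<Lambda> (\<lambda>z. z powi n) = 0"
    and f: "f \<in> L2"
  shows "\<Lambda> f = 0"
proof -
  have tz: "\<Lambda> (trig c F) = 0" if "finite F" for c F
    using that
  proof (induction F)
    case empty
    have "\<Lambda> (\<lambda>z. 0 * (0::complex) + 0 * 0) = 0 * \<Lambda> (\<lambda>z. 0) + 0 * \<Lambda> (\<lambda>z. 0)"
      by (rule lin) auto
    then show ?case by (simp add: trig_def)
  next
    case (insert n F)
    have "\<Lambda> (\<lambda>z. c n * z powi n + 1 * trig c F z) = c n * \<Lambda> (\<lambda>z. z powi n) + 1 * \<Lambda> (trig c F)"
      by (rule lin) (auto intro: L2_power_int)
    then show ?case
      using insert zero by (simp add: trig_def)
  qed
  have "norm (\<Lambda> f) \<le> C * l2norm (\<lambda>z. f z - trig (fcoef f) F z)" if "finite F" for F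
  proof -
    have "\<Lambda> (\<lambda>z. 1 * f z + (-1) * trig (fcoef f) F z) = \<Lambda> f"
      by (subst lin) (use f tz[OF that] in auto)
    then show ?thesis
      using bound[of "\<lambda>z. f z - trig (fcoef f) F z"] f by (simp add: L2_diff)
  qed
  moreover have "((\<lambda>F. C * l2norm (\<lambda>z. f z - trig (fcoef f) F z)) \<longlongrightarrow> C * 0) (finite_subsets_at_top UNIV)"
    by (intro tendsto_intros trig_tendsto f)
  ultimately have "norm (\<Lambda> f) \<le> C * 0"
    by (intro tendsto_lowerbound[of _ "C * 0" "finite_subsets_at_top UNIV"])
      (auto intro: eventually_finite_subsets_at_top_weakI)
  then show ?thesis by simp
qed

subsection \<open>The Hardy space\<close>

text \<open>One analytic factor already removes all terms of negative index; the other factor can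
  then be the image under \<open>W k\<close> of a product.\<close>

lemma Parseval_nat:
  assumes "f \<in> L2" "g \<in> L2" "\<And>n. n < 0 \<Longrightarrow> fcoef g n = 0"
  shows "(\<lambda>n::nat. fcoef f (int n) * cnj (fcoef g (int n))) sums ip f g"
proof -
  have "((\<lambda>n. fcoef f n * cnj (fcoef g n)) has_sum ip f g) (range int)"
    using Parseval[OF assms(1,2)]
  proof (rule has_sum_cong_neutral[THEN iffD1, rotated -1])
    fix n :: int assume "n \<in> UNIV - range int"
    then have "n < 0"
      by (metis DiffD2 not_less rangeI zero_le_imp_eq_int)
    then show "fcoef f n * cnj (fcoef g n) = 0"
      using assms(3) by simp
  qed auto
  then have "((\<lambda>n. fcoef f (int n) * cnj (fcoef g (int n))) has_sum ip f g) UNIV"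
    by (subst (asm) has_sum_reindex) (auto simp: o_def)
  then show ?thesis
    by (rule has_sum_imp_sums)
qed

lemma Parseval_norm_nat:
  assumes "f \<in> L2" "\<And>n. n < 0 \<Longrightarrow> fcoef f n = 0"
  shows "(\<lambda>n::nat. (norm (fcoef f (int n)))\<^sup>2) sums (l2norm f)\<^sup>2"
proof -
  have "(\<lambda>n::nat. Re (fcoef f (int n) * cnj (fcoef f (int n)))) sums Re (ip f f)"
    by (intro sums_Re Parseval_nat assms)
  then show ?thesis
    by (simp add: ip_self complex_norm_square[symmetric] del: of_real_power)
qed

section \<open>Taylor coefficients, dilations and boundary functions\<close>

definition has_taylor :: "cfun \<Rightarrow> (nat \<Rightarrow> complex) \<Rightarrow> bool" where
  "has_taylor F a \<longleftrightarrow> (\<forall>w. norm w < 1 \<longrightarrow> (\<lambda>n. a n * w ^ n) sums F w)"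

lemma holomorphic_has_taylor:
  assumes "F holomorphic_on ball 0 1"
  obtains a where "has_taylor F a"
proof
  show "has_taylor F (\<lambda>n. (deriv ^^ n) F 0 / fact n)"
    unfolding has_taylor_def using holomorphic_power_series[OF assms] by auto
qed

lemma has_taylor_holomorphic: "has_taylor F a \<Longrightarrow> F holomorphic_on ball 0 1"
  by (rule power_series_holomorphic[of 0 1 a]) (auto simp: has_taylor_def)

lemma dilation_continuous:
  assumes "F holomorphic_on ball 0 1" "r \<in> {0..<1}"
  shows "continuous_on (sphere 0 1) (\<lambda>z. F (complex_of_real r * z))"
proof (rule continuous_on_compose2[OF holomorphic_on_imp_continuous_on[OF assms(1)]])
  show "(\<lambda>z. complex_of_real r * z) ` sphere 0 1 \<subseteq> ball 0 1"
    using assms(2) by (auto simp: norm_mult)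
qed (intro continuous_intros)

lemma dilation_L2:
  "F holomorphic_on ball 0 1 \<Longrightarrow> r \<in> {0..<1} \<Longrightarrow> (\<lambda>z. F (complex_of_real r * z)) \<in> L2"
  by (intro L2_continuous dilation_continuous)

lemma has_taylor_abs_summable:
  assumes "has_taylor F a" "norm w < 1"
  shows "summable (\<lambda>n. norm (a n * w ^ n))"
proof -
  obtain R where R: "norm w < R" "R < 1"
    using assms(2) dense by auto
  then have R0: "0 \<le> R"
    using norm_ge_zero[of w] by linarith
  have "summable (\<lambda>n. a n * (complex_of_real R) ^ n)"
    using assms(1) R R0 unfolding has_taylor_def
    by (intro sums_summable[of _ "F (complex_of_real R)"]) auto
  then show ?thesis
    by (rule powser_insidea) (use R R0 in simp)
qed

lemma fcoef_dilation:
  assumes F: "has_taylor F a" and r: "r \<in> {0..<1}"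
  shows "fcoef (\<lambda>z. F (complex_of_real r * z)) n = (if n \<ge> 0 then a (nat n) * of_real r ^ nat n else 0)"
proof -
  have sa: "summable (\<lambda>n. norm (a n * (complex_of_real r) ^ n))"
    by (rule has_taylor_abs_summable[OF F]) (use r in simp)
  define t where "t = (\<lambda>j z. (a j * of_real r ^ j) * z powi (int j))"
  have tn: "norm (t j z * z powi (-n)) = norm (a j * of_real r ^ j)" if "norm z = 1" for j z
    using that by (simp add: t_def norm_mult norm_power_int norm_power)
  have ti: "integrable circle (\<lambda>z. t j z * z powi (-n))" for j
    unfolding t_def by (intro fcoef_integrable L2_integrable L2_cmult L2_power_int)
  have "(\<lambda>j. LINT z|circle. t j z * z powi (-n)) sums (LINT z|circle. (\<Sum>j. t j z * z powi (-n)))"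
  proof (rule sums_integral)
    show "AE z in circle. summable (\<lambda>j. norm (t j z * z powi (-n)))"
      by (rule AE_circleI) (use sa in \<open>simp only: tn\<close>)
    have "(LINT z|circle. norm (t j z * z powi (-n))) = (LINT z|circle. norm (a j * of_real r ^ j))" for j
      by (rule Bochner_Integration.integral_cong) (auto simp only: tn space_circle mem_sphere_0)
    then show "summable (\<lambda>j. LINT z|circle. norm (t j z * z powi (-n)))"
      using sa by simp
  qed (rule ti)
  also have "(LINT z|circle. (\<Sum>j. t j z * z powi (-n))) = fcoef (\<lambda>z. F (complex_of_real r * z)) n"
    unfolding fcoef_def
  proof (rule Bochner_Integration.integral_cong)
    fix z assume "z \<in> space circle"
    then have z: "norm z = 1" by simp
    have "(\<lambda>j. a j * (of_real r * z) ^ j) sums F (of_real r * z)"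
      using F r z unfolding has_taylor_def by (auto simp: norm_mult)
    then have "(\<lambda>j. t j z) sums F (of_real r * z)"
      by (simp add: t_def power_mult_distrib mult.assoc)
    then show "(\<Sum>j. t j z * z powi (-n)) = F (of_real r * z) * z powi (-n)"
      by (rule sums_unique[OF sums_mult2, symmetric])
  qed simp
  also have "(\<lambda>j. LINT z|circle. t j z * z powi (-n)) =
      (\<lambda>j. if int j = n then a j * of_real r ^ j else 0)"
    unfolding t_def fcoef_def[symmetric] fcoef_cmult fcoef_power_int by auto
  finally have s: "(\<lambda>j. if int j = n then a j * of_real r ^ j else 0) sums
      fcoef (\<lambda>z. F (complex_of_real r * z)) n" .
  show ?thesis
  proof (cases "n \<ge> 0")
    case True
    then have "(\<lambda>j. if int j = n then a j * of_real r ^ j else 0) =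
        (\<lambda>j. if j = nat n then a j * of_real r ^ j else 0)"
      by (auto simp: fun_eq_iff)
    then show ?thesis
      using s sums_unique2[OF _ sums_single[of "nat n" "\<lambda>j. a j * of_real r ^ j"]] True by simp
  next
    case False
    then have "(\<lambda>j. if int j = n then a j * of_real r ^ j else 0) = (\<lambda>j. 0)"
      by (auto simp: fun_eq_iff)
    then show ?thesis
      using s sums_unique2[OF _ sums_zero] False by simp
  qed
qed

lemma eventually_at_left_1: "eventually (\<lambda>r::real. r \<in> {0..<1}) (at_left 1)"
  using eventually_at_left_real[of 0 "1::real", OF zero_less_one] by (rule eventually_mono) auto

text \<open>The dilations have the coefficients a_n r^n, which tend to a_n; they also tend to those
  of f, because a coefficient is bounded by the L2 norm.\<close>

lemma fcoef_boundary:
  assumes "has_taylor F a" "boundary_function F f"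
  shows "fcoef f n = (if n \<ge> 0 then a (nat n) else 0)"
proof -
  let ?c = "\<lambda>r. if n \<ge> 0 then a (nat n) * of_real r ^ nat n else 0"
  have f: "f \<in> L2" and lim: "((\<lambda>r. l2norm (\<lambda>z. F (complex_of_real r * z) - f z)) \<longlongrightarrow> 0) (at_left 1)"
    using assms(2) by (auto simp: boundary_function_def)
  have "((\<lambda>r. ?c r - fcoef f n) \<longlongrightarrow> 0) (at_left 1)"
  proof (rule Lim_null_comparison[OF _ lim])
    show "\<forall>\<^sub>F r in at_left 1. norm (?c r - fcoef f n) \<le> l2norm (\<lambda>z. F (complex_of_real r * z) - f z)"
      using eventually_at_left_1
    proof eventually_elim
      case (elim r)
      have d: "(\<lambda>z. F (complex_of_real r * z)) \<in> L2"
        by (rule dilation_L2[OF has_taylor_holomorphic[OF assms(1)] elim])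
      have "?c r - fcoef f n = fcoef (\<lambda>z. F (complex_of_real r * z) - f z) n"
        by (subst fcoef_diff) (simp_all add: L2_integrable d f fcoef_dilation[OF assms(1) elim])
      then show ?case
        using norm_fcoef_le_l2norm[OF L2_diff[OF d f]] by simp
    qed
  qed
  moreover have "((\<lambda>r. ?c r - fcoef f n) \<longlongrightarrow> (if n \<ge> 0 then a (nat n) * of_real 1 ^ nat n else 0) - fcoef f n)
      (at_left 1)"
    by (cases "n \<ge> 0") (simp_all only: if_True if_False, (intro tendsto_intros)+)
  ultimately have "(if n \<ge> 0 then a (nat n) * of_real 1 ^ nat n else 0) - fcoef f n = 0"
    using tendsto_unique[OF trivial_limit_at_left_real] by blast
  then show ?thesis by (simp split: if_splits)
qed

text \<open>Parseval turns the squared distance between the dilation and f into the sum of |a_n|^2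
  (1 - r^n)^2, which tends to 0 by Tannery's theorem with majorant |a_n|^2. Together with
  \<open>fcoef_boundary\<close> this replaces the limit in \<open>boundary_function\<close> by a
  comparison of coefficients.\<close>

lemma boundary_functionI:
  assumes F: "has_taylor F a" and f: "f \<in> L2" "\<And>n. fcoef f n = (if n \<ge> 0 then a (nat n) else 0)"
  shows "boundary_function F f"
proof -
  let ?D = "\<lambda>r z. F (complex_of_real r * z) - f z"
  have sf: "summable (\<lambda>n. (norm (a n))\<^sup>2)"
    using Parseval_norm_nat[OF f(1)] f(2) by (auto intro: sums_summable)
  have D: "(\<lambda>n. (norm (a n * of_real r ^ n - a n))\<^sup>2) sums (l2norm (?D r))\<^sup>2" if r: "r \<in> {0..<1}" for r
  proof -
    have d: "(\<lambda>z. F (complex_of_real r * z)) \<in> L2"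
      by (rule dilation_L2[OF has_taylor_holomorphic[OF F] r])
    have "fcoef (?D r) n = (if n \<ge> 0 then a (nat n) * of_real r ^ nat n - a (nat n) else 0)" for n
      by (subst fcoef_diff) (simp_all add: L2_integrable d f fcoef_dilation[OF F r])
    then show ?thesis
      using Parseval_norm_nat[OF L2_diff[OF d f(1)]] by simp
  qed
  have "((\<lambda>r. \<Sum>n. (norm (a n * of_real r ^ n - a n))\<^sup>2) \<longlongrightarrow> (\<Sum>n. 0)) (at_left (1::real))"
  proof (rule conjunct2[OF conjunct2[OF tannerys_theorem[of _ _ _ "\<lambda>n. (norm (a n))\<^sup>2"]]])
    fix n
    have "((\<lambda>r. (norm (a n * of_real r ^ n - a n))\<^sup>2) \<longlongrightarrow> (norm (a n * of_real 1 ^ n - a n))\<^sup>2) (at_left 1)"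
      by (intro tendsto_intros)
    then show "((\<lambda>r. (norm (a n * of_real r ^ n - a n))\<^sup>2) \<longlongrightarrow> 0) (at_left 1)"
      by simp
  next
    have "norm ((norm (a n * of_real r ^ n - a n))\<^sup>2) \<le> (norm (a n))\<^sup>2" if r: "r \<in> {0..<1}" for n and r :: real
    proof -
      have "a n * of_real r ^ n - a n = - (a n * of_real (1 - r ^ n))"
        by (simp add: algebra_simps)
      also have "norm \<dots> = norm (a n) * \<bar>1 - r ^ n\<bar>"
        by (simp only: norm_minus_cancel norm_mult norm_of_real)
      also have "\<dots> \<le> norm (a n) * 1"
        using r power_le_one[of r n] zero_le_power[of r n] by (intro mult_left_mono) (auto simp: abs_if)
      finally show ?thesis
        by simp
    qed
    then show "\<forall>\<^sub>F (n, r) in sequentially \<times>\<^sub>F at_left (1::real).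
        norm ((norm (a n * of_real r ^ n - a n))\<^sup>2) \<le> (norm (a n))\<^sup>2"
      by (auto intro!: eventually_mono[OF eventually_prodI[OF eventually_True eventually_at_left_1]])
  qed (use sf in auto)
  then have "((\<lambda>r. \<Sum>n. (norm (a n * of_real r ^ n - a n))\<^sup>2) \<longlongrightarrow> 0) (at_left (1::real))"
    by simp
  then have "((\<lambda>r. (l2norm (?D r))\<^sup>2) \<longlongrightarrow> 0) (at_left 1)"
    by (rule Lim_transform_eventually)
      (rule eventually_mono[OF eventually_at_left_1 sums_unique[OF D, symmetric]])
  from tendsto_real_sqrt[OF this] show ?thesis
    using f(1) by (simp add: boundary_function_def)
qed

lemma fcoef_has_taylor:
  assumes "f \<in> L2"
  obtains F where "has_taylor F (\<lambda>n. fcoef f (int n))"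
proof
  show "has_taylor (\<lambda>w. \<Sum>n. fcoef f (int n) * w ^ n) (\<lambda>n. fcoef f (int n))"
    unfolding has_taylor_def
  proof (intro allI impI summable_sums)
    fix w :: complex assume w: "norm w < 1"
    show "summable (\<lambda>n. fcoef f (int n) * w ^ n)"
    proof (rule summable_comparison_test'[of "\<lambda>n. l2norm f * norm w ^ n" 0])
      show "summable (\<lambda>n. l2norm f * norm w ^ n)"
        using w by (intro summable_mult summable_geometric) simp
      show "norm (fcoef f (int n) * w ^ n) \<le> l2norm f * norm w ^ n" for n
        unfolding norm_mult norm_power
        by (intro mult_right_mono norm_fcoef_le_l2norm assms) auto
    qed
  qed
qed

text \<open>Parseval on the circle of radius r bounds every partial sum of |a_n|^2 r^(2 n) by one
  constant, and in a finite sum r may tend to 1.\<close>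

lemma hardy2_disk_coeffs:
  assumes F: "F \<in> hardy2_disk" "has_taylor F a"
  shows "summable (\<lambda>n. (norm (a n))\<^sup>2)"
proof -
  obtain C where C: "\<And>r. r \<in> {0..<1} \<Longrightarrow> l2norm (\<lambda>z. F (complex_of_real r * z)) \<le> C"
    using F(1) unfolding hardy2_disk_def by blast
  have *: "(\<Sum>n<N. (norm (a n * of_real r ^ n))\<^sup>2) \<le> C\<^sup>2" if r: "r \<in> {0..<1}" for r :: real and N
  proof -
    have d: "(\<lambda>z. F (complex_of_real r * z)) \<in> L2"
      by (rule dilation_L2[OF has_taylor_holomorphic[OF F(2)] r])
    have s: "(\<lambda>n. (norm (a n * of_real r ^ n))\<^sup>2) sums (l2norm (\<lambda>z. F (complex_of_real r * z)))\<^sup>2"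
      using Parseval_norm_nat[OF d] by (simp add: fcoef_dilation[OF F(2) r])
    have "(\<Sum>n<N. (norm (a n * of_real r ^ n))\<^sup>2) \<le> (l2norm (\<lambda>z. F (complex_of_real r * z)))\<^sup>2"
      using sum_le_suminf[OF sums_summable[OF s], of "{..<N}"] sums_unique[OF s] by simp
    also have "\<dots> \<le> C\<^sup>2"
      by (intro power_mono C r l2norm_nonneg)
    finally show ?thesis .
  qed
  have "(\<Sum>n<N. (norm (a n))\<^sup>2) \<le> C\<^sup>2" for N
  proof -
    have "((\<lambda>r. \<Sum>n<N. (norm (a n * of_real r ^ n))\<^sup>2) \<longlongrightarrow> (\<Sum>n<N. (norm (a n * of_real 1 ^ n))\<^sup>2)) (at_left (1::real))"
      by (intro tendsto_intros)
    then have "(\<Sum>n<N. (norm (a n * of_real 1 ^ n))\<^sup>2) \<le> C\<^sup>2"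
    proof (rule tendsto_upperbound)
      show "\<forall>\<^sub>F r in at_left (1::real). (\<Sum>n<N. (norm (a n * of_real r ^ n))\<^sup>2) \<le> C\<^sup>2"
        using eventually_at_left_1 by eventually_elim (rule *)
    qed (rule trivial_limit_at_left_real)
    then show ?thesis by simp
  qed
  then show ?thesis
    by (intro summableI_nonneg_bounded[of _ "C\<^sup>2"]) auto
qed

lemma hardy2_disk_boundary:
  assumes F: "F \<in> hardy2_disk"
  obtains f where "boundary_function F f"
proof -
  obtain a where a: "has_taylor F a"
    using F holomorphic_has_taylor by (auto simp: hardy2_disk_def)
  define c where "c = (\<lambda>n::int. if n \<ge> 0 then a (nat n) else 0)"
  have "(\<lambda>n::nat. (norm (a n))\<^sup>2) summable_on UNIV"
    using hardy2_disk_coeffs[OF F a] by (subst summable_on_UNIV_nonneg_real_iff) auto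
  then have "(\<lambda>n. (norm (c n))\<^sup>2) summable_on range int"
    by (subst summable_on_reindex) (auto simp: o_def c_def)
  then have "(\<lambda>n. (norm (c n))\<^sup>2) summable_on UNIV"
  proof (rule summable_on_cong_neutral[THEN iffD1, rotated -1])
    fix n :: int assume "n \<in> UNIV - range int"
    then have "n < 0"
      by (metis DiffD2 not_less rangeI zero_le_imp_eq_int)
    then show "(norm (c n))\<^sup>2 = 0"
      by (simp add: c_def)
  qed auto
  then obtain f where f: "f \<in> L2" "\<And>n. fcoef f n = c n"
    by (rule Riesz_Fischer) blast
  have "boundary_function F f"
    by (rule boundary_functionI[OF a f(1)]) (simp add: f(2) c_def)
  then show thesis by (rule that)
qed

lemma boundary_hardy2_disk:
  assumes F: "has_taylor F a" and f: "boundary_function F f"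
  shows "F \<in> hardy2_disk"
proof -
  have fL2: "f \<in> L2" using f by (simp add: boundary_function_def)
  note fc = fcoef_boundary[OF F f]
  have "l2norm (\<lambda>z. F (complex_of_real r * z)) \<le> l2norm f" if r: "r \<in> {0..<1}" for r
  proof (rule power2_le_imp_le)
    have d: "(\<lambda>z. F (complex_of_real r * z)) \<in> L2"
      by (rule dilation_L2[OF has_taylor_holomorphic[OF F] r])
    have s: "(\<lambda>n. (norm (a n * of_real r ^ n))\<^sup>2) sums (l2norm (\<lambda>z. F (complex_of_real r * z)))\<^sup>2"
      using Parseval_norm_nat[OF d] by (simp add: fcoef_dilation[OF F r])
    have t: "(\<lambda>n. (norm (a n))\<^sup>2) sums (l2norm f)\<^sup>2"
      using Parseval_norm_nat[OF fL2] by (simp add: fc)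
    show "(l2norm (\<lambda>z. F (complex_of_real r * z)))\<^sup>2 \<le> (l2norm f)\<^sup>2"
    proof (rule sums_le[OF _ s t])
      fix n
      have "norm (of_real r ^ n :: complex) \<le> 1"
        using r by (simp add: norm_power power_le_one)
      then show "(norm (a n * of_real r ^ n))\<^sup>2 \<le> (norm (a n))\<^sup>2"
        by (intro power_mono) (auto simp: norm_mult mult_left_le)
    qed
  qed simp
  then show ?thesis
    using has_taylor_holomorphic[OF F] unfolding hardy2_disk_def by blast
qed

text \<open>This condition on coefficients is how the Hardy space is mostly handled from here on. In
  the converse direction the power series with the given coefficients serves as the function on the
  disk.\<close>

theorem H2_iff: "f \<in> H2 \<longleftrightarrow> f \<in> L2 \<and> (\<forall>n<0. fcoef f n = 0)"
proof
  assume "f \<in> H2"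
  then obtain F where F: "F holomorphic_on ball 0 1" "boundary_function F f"
    by (auto simp: H2_def hardy2_disk_def)
  then obtain a where "has_taylor F a"
    using holomorphic_has_taylor by blast
  then show "f \<in> L2 \<and> (\<forall>n<0. fcoef f n = 0)"
    using F(2) fcoef_boundary by (auto simp: boundary_function_def)
next
  assume f: "f \<in> L2 \<and> (\<forall>n<0. fcoef f n = 0)"
  then obtain F where F: "has_taylor F (\<lambda>n. fcoef f (int n))"
    using fcoef_has_taylor by blast
  then have "boundary_function F f"
    by (rule boundary_functionI) (use f in auto)
  then show "f \<in> H2"
    using boundary_hardy2_disk[OF F] by (auto simp: H2_def)
qed

lemma H2_L2: "f \<in> H2 \<Longrightarrow> f \<in> L2"
  by (simp add: H2_iff)

text \<open>Since the measure is normalized, L2 convergence gives L1 convergence and hence a.e.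
  convergence along a subsequence. That the radii tend to 1 from the left is recorded so that the
  limit can be compared with a radial limit.\<close>

lemma boundary_AE_subseq:
  assumes "F holomorphic_on ball 0 1" "boundary_function F f"
  obtains \<rho> where "\<And>n::nat. \<rho> n \<in> {0..<1}" "filterlim \<rho> (at_left 1) sequentially"
    "AE z in circle. (\<lambda>n. F (complex_of_real (\<rho> n) * z)) \<longlonglongrightarrow> f z"
proof -
  define \<sigma> :: "nat \<Rightarrow> real" where "\<sigma> = (\<lambda>n. 1 - inverse (real (Suc n)))"
  have \<sigma>: "\<sigma> n \<in> {0..<1}" for n
    by (simp add: \<sigma>_def inverse_le_1_iff)
  have "\<sigma> \<longlonglongrightarrow> 1 - 0"
    unfolding \<sigma>_def by (intro tendsto_diff tendsto_const LIMSEQ_inverse_real_of_nat)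
  then have lim\<sigma>: "filterlim \<sigma> (at_left 1) sequentially"
    using \<sigma> by (intro tendsto_imp_filterlim_at_left) auto
  have f: "f \<in> L2" and lim: "((\<lambda>r. l2norm (\<lambda>z. F (complex_of_real r * z) - f z)) \<longlongrightarrow> 0) (at_left 1)"
    using assms(2) by (auto simp: boundary_function_def)
  have d: "(\<lambda>z. F (complex_of_real (\<sigma> n) * z) - f z) \<in> L2" for n
    by (intro L2_diff dilation_L2 assms \<sigma> f)
  have "(\<lambda>n. LINT z|circle. norm (F (complex_of_real (\<sigma> n) * z) - f z)) \<longlonglongrightarrow> 0"
  proof (rule Lim_null_comparison)
    show "(\<lambda>n. l2norm (\<lambda>z. F (complex_of_real (\<sigma> n) * z) - f z)) \<longlonglongrightarrow> 0"
      by (rule filterlim_compose[OF lim lim\<sigma>])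
    show "\<forall>\<^sub>F n in sequentially. norm (LINT z|circle. norm (F (complex_of_real (\<sigma> n) * z) - f z)) \<le>
        l2norm (\<lambda>z. F (complex_of_real (\<sigma> n) * z) - f z)"
      using L1_le_l2norm[OF d] by (intro always_eventually) auto
  qed
  then obtain k where k: "strict_mono k"
    "AE z in circle. (\<lambda>n. F (complex_of_real (\<sigma> (k n)) * z) - f z) \<longlonglongrightarrow> 0"
    using tendsto_L1_AE_subseq[OF L2_integrable[OF d], of "\<lambda>n. n"] by auto
  show thesis
  proof (rule that[of "\<sigma> \<circ> k"])
    show "filterlim (\<sigma> \<circ> k) (at_left 1) sequentially"
      unfolding o_def by (rule filterlim_compose[OF lim\<sigma> filterlim_subseq[OF k(1)]])
    show "AE z in circle. (\<lambda>n. F (complex_of_real ((\<sigma> \<circ> k) n) * z)) \<longlonglongrightarrow> f z"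
      using k(2) by eventually_elim (simp add: LIM_zero_cancel)
  qed (use \<sigma> in auto)
qed

lemma boundary_bounded:
  assumes F: "F holomorphic_on ball 0 1" "boundary_function F f"
    and bound: "\<And>w. w \<in> ball 0 1 \<Longrightarrow> norm (F w) \<le> C"
  shows "AE z in circle. norm (f z) \<le> C"
proof -
  obtain \<rho> where \<rho>: "\<And>n::nat. \<rho> n \<in> {0..<1}" 
    and lim: "AE z in circle. (\<lambda>n. F (complex_of_real (\<rho> n) * z)) \<longlonglongrightarrow> f z"
    by (rule boundary_AE_subseq[OF F]) blast
  show ?thesis
    using lim AE_circleI[of "\<lambda>z. norm z = 1", simplified]
  proof eventually_elim
    case (elim z)
    show ?case
    proof (rule tendsto_upperbound[OF tendsto_norm[OF elim(1)]])
      show "\<forall>\<^sub>F n in sequentially. norm (F (complex_of_real (\<rho> n) * z)) \<le> C"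
        using \<rho> elim(2) by (intro always_eventually allI bound) (auto simp: norm_mult)
    qed simp
  qed
qed

lemma hardy_inf_disk_subset: "hardy_inf_disk \<subseteq> hardy2_disk"
proof
  fix F assume F: "F \<in> hardy_inf_disk"
  then have h: "F holomorphic_on ball 0 1" by (simp add: hardy_inf_disk_def)
  have "\<exists>C. \<forall>w\<in>ball 0 1. norm (F w) \<le> C"
    using F by (auto simp: hardy_inf_disk_def bounded_iff)
  then obtain C where C: "\<And>w. w \<in> ball 0 1 \<Longrightarrow> norm (F w) \<le> C"
    by blast
  have C0: "C \<ge> 0"
    by (rule order_trans[OF norm_ge_zero C[of 0]]) simp
  have "l2norm (\<lambda>z. F (complex_of_real r * z)) \<le> C" if r: "r \<in> {0..<1}" for r
  proof -
    have "l2norm (\<lambda>z. F (complex_of_real r * z) * 1) \<le> C * l2norm (\<lambda>_. 1)"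
    proof (rule l2norm_le_bounded)
      show "(\<lambda>z. F (complex_of_real r * z)) \<in> borel_measurable circle"
        by (rule L2_measurable[OF dilation_L2[OF h r]])
      show "AE z in circle. norm (F (complex_of_real r * z)) \<le> C"
        using r by (intro AE_circleI C) (auto simp: norm_mult)
    qed (use C0 in auto)
    then show ?thesis by (simp add: l2norm_def)
  qed
  then show "F \<in> hardy2_disk"
    unfolding hardy2_disk_def using h by blast
qed

lemma Hinf_H2: "f \<in> Hinf \<Longrightarrow> f \<in> H2"
  using hardy_inf_disk_subset by (auto simp: Hinf_def H2_def)

lemma Hinf_bounded:
  assumes "f \<in> Hinf"
  obtains C where "AE z in circle. norm (f z) \<le> C"
proof -
  obtain F where F: "F \<in> hardy_inf_disk" "boundary_function F f"
    using assms by (auto simp: Hinf_def)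
  then have "\<exists>C. \<forall>w\<in>ball 0 1. norm (F w) \<le> C"
    by (auto simp: hardy_inf_disk_def bounded_iff)
  then obtain C where "\<And>w. w \<in> ball 0 1 \<Longrightarrow> norm (F w) \<le> C"
    by blast
  then show thesis
    by (intro that[OF boundary_bounded[OF _ F(2)]]) (use F(1) in \<open>auto simp: hardy_inf_disk_def\<close>)
qed

lemma HinfI:
  assumes F: "F \<in> hardy_inf_disk" "boundary_function F g" and f: "f \<in> L2" "\<And>n. fcoef f n = fcoef g n"
  shows "f \<in> Hinf"
proof -
  obtain a where a: "has_taylor F a"
    using F holomorphic_has_taylor by (auto simp: hardy_inf_disk_def)
  have "boundary_function F f"
    by (rule boundary_functionI[OF a f(1)]) (simp add: f(2) fcoef_boundary[OF a F(2)])
  then show ?thesis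
    using F(1) by (auto simp: Hinf_def)
qed

text \<open>The source of the orthogonality relations below: analytic against antianalytic
  functions, or an error term against functions lacking its frequencies.\<close>

lemma ip_eq_0_disjoint:
  assumes "f \<in> L2" "g \<in> L2" "\<And>n. fcoef f n = 0 \<or> fcoef g n = 0"
  shows "ip f g = 0"
proof -
  have "(\<lambda>n. fcoef f n * cnj (fcoef g n)) = (\<lambda>n. 0)"
    using assms(3) by (auto simp: fun_eq_iff)
  then have "((\<lambda>n::int. 0) has_sum ip f g) UNIV"
    using Parseval[OF assms(1,2)] by metis
  then show ?thesis
    using has_sum_unique[OF _ has_sum_0] by blast
qed

section \<open>Coefficients of products and bounded analytic functions\<close>

lemma fcoef_cnj: "fcoef (\<lambda>z. cnj (f z)) n = cnj (fcoef f (- n))"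
proof -
  have "fcoef (\<lambda>z. cnj (f z)) n = (LINT z|circle. cnj (f z * z powi (- (- n))))"
    unfolding fcoef_def
    by (rule Bochner_Integration.integral_cong)
      (auto simp: cnj_power_int_circle simp del: complex_cnj_power_int)
  also have "\<dots> = cnj (fcoef f (- n))"
    unfolding fcoef_def by (rule Bochner_Integration.integral_cnj)
  finally show ?thesis .
qed

text \<open>The n-th coefficient of the product is the inner product of f with
  \<open>z powi n * cnj (g z)\<close>, so Parseval gives the convolution although the product itself
  need only be integrable.\<close>

lemma fcoef_mult:
  assumes "f \<in> L2" "g \<in> L2"
  shows "((\<lambda>m. fcoef f m * fcoef g (n - m)) has_sum fcoef (\<lambda>z. f z * g z) n) UNIV"
proof -
  let ?h = "\<lambda>z. z powi n * cnj (g z)"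
  have h: "?h \<in> L2"
    by (intro L2_mult_power_int L2_cnj assms)
  have "fcoef ?h m = cnj (fcoef g (n - m))" for m
    using assms(2) by (subst fcoef_mult_power_int) (auto simp: fcoef_cnj intro: L2_measurable L2_cnj)
  moreover have "ip f ?h = fcoef (\<lambda>z. f z * g z) n"
    unfolding ip_def fcoef_def
    by (rule Bochner_Integration.integral_cong)
      (auto simp: cnj_power_int_circle simp del: complex_cnj_power_int)
  ultimately show ?thesis
    using Parseval[OF assms(1) h] by simp
qed

lemma fcoef_mult_H2:
  assumes "f \<in> H2" "g \<in> H2"
  shows "fcoef (\<lambda>z. f z * g z) n =
    (if n \<ge> 0 then \<Sum>i\<le>nat n. fcoef f (int i) * fcoef g (int (nat n - i)) else 0)"
proof -
  have f: "f \<in> L2" "\<And>n. n < 0 \<Longrightarrow> fcoef f n = 0" and g: "g \<in> L2" "\<And>n. n < 0 \<Longrightarrow> fcoef g n = 0"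
    using assms by (auto simp: H2_iff)
  have "((\<lambda>m. fcoef f m * fcoef g (n - m)) has_sum fcoef (\<lambda>z. f z * g z) n) {0..n}"
    using fcoef_mult[OF f(1) g(1), of n]
    by (rule has_sum_cong_neutral[THEN iffD1, rotated -1]) (use f(2) g(2) in force)+
  then have s: "fcoef (\<lambda>z. f z * g z) n = (\<Sum>m\<in>{0..n}. fcoef f m * fcoef g (n - m))"
    by (rule has_sum_unique) (rule has_sum_finite, simp)
  show ?thesis
  proof (cases "n \<ge> 0")
    case True
    have "(\<Sum>m\<in>{0..n}. fcoef f m * fcoef g (n - m)) =
        (\<Sum>i\<le>nat n. fcoef f (int i) * fcoef g (int (nat n - i)))"
      by (rule sum.reindex_bij_witness[of _ int nat]) (use True in \<open>auto simp: of_nat_diff\<close>)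
    then show ?thesis using s True by simp
  next
    case False
    then show ?thesis using s by simp
  qed
qed

lemma H2_power_int: "n \<ge> 0 \<Longrightarrow> (\<lambda>z. z powi n) \<in> H2"
  by (auto simp: H2_iff L2_power_int fcoef_power_int)

lemma has_taylor_lincomb:
  assumes "has_taylor F a" "has_taylor G b"
  shows "has_taylor (\<lambda>z. c * F z + d * G z) (\<lambda>n. c * a n + d * b n)"
  unfolding has_taylor_def
proof (intro allI impI)
  fix w :: complex assume "norm w < 1"
  then have "(\<lambda>n. a n * w ^ n) sums F w" "(\<lambda>n. b n * w ^ n) sums G w"
    using assms by (auto simp: has_taylor_def)
  then have "(\<lambda>n. c * (a n * w ^ n) + d * (b n * w ^ n)) sums (c * F w + d * G w)"
    by (intro sums_add sums_mult)
  then show "(\<lambda>n. (c * a n + d * b n) * w ^ n) sums (c * F w + d * G w)"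
    by (simp add: algebra_simps)
qed

lemma has_taylor_mult:
  assumes "has_taylor F a" "has_taylor G b"
  shows "has_taylor (\<lambda>z. F z * G z) (\<lambda>n. \<Sum>i\<le>n. a i * b (n - i))"
  unfolding has_taylor_def
proof (intro allI impI)
  fix w :: complex assume w: "norm w < 1"
  have FG: "(\<lambda>n. a n * w ^ n) sums F w" "(\<lambda>n. b n * w ^ n) sums G w"
    using assms w by (auto simp: has_taylor_def)
  have "(\<lambda>n. \<Sum>i\<le>n. (a i * w ^ i) * (b (n - i) * w ^ (n - i))) sums ((\<Sum>n. a n * w ^ n) * (\<Sum>n. b n * w ^ n))"
    by (rule Cauchy_product_sums) (rule has_taylor_abs_summable[OF assms(1) w] has_taylor_abs_summable[OF assms(2) w])+
  moreover have "(\<Sum>i\<le>n. (a i * w ^ i) * (b (n - i) * w ^ (n - i))) = (\<Sum>i\<le>n. a i * b (n - i)) * w ^ n" for n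
    unfolding sum_distrib_right
  proof (rule sum.cong)
    fix i assume "i \<in> {..n}"
    then have "w ^ i * w ^ (n - i) = w ^ n"
      by (simp flip: power_add)
    then show "(a i * w ^ i) * (b (n - i) * w ^ (n - i)) = a i * b (n - i) * w ^ n"
      by (metis mult.assoc mult.left_commute)
  qed simp
  ultimately show "(\<lambda>n. (\<Sum>i\<le>n. a i * b (n - i)) * w ^ n) sums (F w * G w)"
    using sums_unique[OF FG(1)] sums_unique[OF FG(2)] by simp
qed

lemma boundary_H2:
  assumes "has_taylor F a" "boundary_function F f"
  shows "f \<in> H2"
  using assms(2) fcoef_boundary[OF assms] by (simp add: H2_iff boundary_function_def)

text \<open>The finite convolution of coefficients on the circle is the Cauchy product on the disk.
  That the product is in L2 is assumed, since it is not automatic for two unbounded factors.\<close>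

lemma boundary_function_mult:
  assumes F: "has_taylor F a" "boundary_function F f" and G: "has_taylor G b" "boundary_function G g"
    and fg: "(\<lambda>z. f z * g z) \<in> L2"
  shows "boundary_function (\<lambda>z. F z * G z) (\<lambda>z. f z * g z)"
proof (rule boundary_functionI[OF has_taylor_mult[OF F(1) G(1)] fg])
  show "fcoef (\<lambda>z. f z * g z) n = (if n \<ge> 0 then \<Sum>i\<le>nat n. a i * b (nat n - i) else 0)" for n
    unfolding fcoef_mult_H2[OF boundary_H2[OF F] boundary_H2[OF G]] fcoef_boundary[OF F] fcoef_boundary[OF G]
    by (auto intro!: sum.cong simp: nat_diff_distrib le_nat_iff)
qed

lemma hardy_inf_disk_bounded:
  assumes "F \<in> hardy_inf_disk"
  obtains C where "\<And>w. w \<in> ball 0 1 \<Longrightarrow> norm (F w) \<le> C" "C > 0"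
proof -
  have "bounded (F ` ball 0 1)"
    using assms by (simp add: hardy_inf_disk_def)
  then obtain C where "C > 0" "\<forall>x\<in>F ` ball 0 1. norm x \<le> C"
    by (auto simp: bounded_pos)
  then show thesis
    using that by blast
qed

lemma hardy_inf_diskI:
  assumes "F holomorphic_on ball 0 1" "\<And>w. w \<in> ball 0 1 \<Longrightarrow> norm (F w) \<le> C"
  shows "F \<in> hardy_inf_disk"
  using assms unfolding hardy_inf_disk_def bounded_iff by blast

lemma hardy_inf_disk_taylor:
  assumes "F \<in> hardy_inf_disk"
  obtains a where "has_taylor F a"
  using assms holomorphic_has_taylor by (auto simp: hardy_inf_disk_def)

lemma Hinf_mult:
  assumes "f \<in> Hinf" "g \<in> Hinf"
  shows "(\<lambda>z. f z * g z) \<in> Hinf"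
proof -
  obtain F G where F: "F \<in> hardy_inf_disk" "boundary_function F f"
    and G: "G \<in> hardy_inf_disk" "boundary_function G g"
    using assms by (auto simp: Hinf_def)
  obtain a b where a: "has_taylor F a" and b: "has_taylor G b"
    using hardy_inf_disk_taylor F(1) G(1) by metis
  obtain C where C: "\<And>w. w \<in> ball 0 1 \<Longrightarrow> norm (F w) \<le> C" "C > 0"
    using hardy_inf_disk_bounded[OF F(1)] by blast
  obtain D where D: "\<And>w. w \<in> ball 0 1 \<Longrightarrow> norm (G w) \<le> D" "D > 0"
    using hardy_inf_disk_bounded[OF G(1)] by blast
  have fL2: "f \<in> L2" and gL2: "g \<in> L2"
    using F(2) G(2) by (auto simp: boundary_function_def)
  have "AE z in circle. norm (f z) \<le> C"
    by (rule boundary_bounded[OF has_taylor_holomorphic[OF a] F(2) C(1)])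
  then have fg: "(\<lambda>z. f z * g z) \<in> L2"
    by (rule L2_mult_bounded[OF gL2 L2_measurable[OF fL2]])
  have "(\<lambda>z. F z * G z) \<in> hardy_inf_disk"
  proof (rule hardy_inf_diskI[of _ "C * D"])
    show "(\<lambda>z. F z * G z) holomorphic_on ball 0 1"
      by (intro holomorphic_intros has_taylor_holomorphic[OF a] has_taylor_holomorphic[OF b])
    show "norm (F w * G w) \<le> C * D" if "w \<in> ball 0 1" for w
      unfolding norm_mult by (intro mult_mono C(1) D(1) that) (use C(2) in auto)
  qed
  then show ?thesis
    using boundary_function_mult[OF a F(2) b G(2) fg] unfolding Hinf_def by blast
qed

lemma Hinf_lincomb:
  assumes "f \<in> Hinf" "g \<in> Hinf"
  shows "(\<lambda>z. c * f z + d * g z) \<in> Hinf"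
proof -
  obtain F G where F: "F \<in> hardy_inf_disk" "boundary_function F f"
    and G: "G \<in> hardy_inf_disk" "boundary_function G g"
    using assms by (auto simp: Hinf_def)
  obtain a b where a: "has_taylor F a" and b: "has_taylor G b"
    using hardy_inf_disk_taylor F(1) G(1) by metis
  obtain C where C: "\<And>w. w \<in> ball 0 1 \<Longrightarrow> norm (F w) \<le> C" "C > 0"
    using hardy_inf_disk_bounded[OF F(1)] by blast
  obtain D where D: "\<And>w. w \<in> ball 0 1 \<Longrightarrow> norm (G w) \<le> D" "D > 0"
    using hardy_inf_disk_bounded[OF G(1)] by blast
  have fL2: "f \<in> L2" and gL2: "g \<in> L2"
    using F(2) G(2) by (auto simp: boundary_function_def)
  have "(\<lambda>z. c * F z + d * G z) \<in> hardy_inf_disk"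
  proof (rule hardy_inf_diskI[of _ "norm c * C + norm d * D"])
    show "(\<lambda>z. c * F z + d * G z) holomorphic_on ball 0 1"
      by (intro holomorphic_intros has_taylor_holomorphic[OF a] has_taylor_holomorphic[OF b])
    show "norm (c * F w + d * G w) \<le> norm c * C + norm d * D" if "w \<in> ball 0 1" for w
      by (rule order_trans[OF norm_triangle_ineq], unfold norm_mult)
        (intro add_mono mult_left_mono C(1) D(1) that norm_ge_zero)
  qed
  moreover have "boundary_function (\<lambda>z. c * F z + d * G z) (\<lambda>z. c * f z + d * g z)"
    by (rule boundary_functionI[OF has_taylor_lincomb[OF a b]])
      (simp_all add: L2_lincomb fcoef_lincomb fL2 gL2 L2_integrable fcoef_boundary[OF a F(2)] fcoef_boundary[OF b G(2)])
  ultimately show ?thesis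
    unfolding Hinf_def by blast
qed

lemma Hinf_power: "(\<lambda>z. z powi int n) \<in> Hinf"
proof -
  have t: "has_taylor (\<lambda>z. z ^ n) (\<lambda>j. if j = n then 1 else 0)"
    unfolding has_taylor_def
  proof (intro allI impI)
    fix w :: complex
    have "(\<lambda>j. if j = n then w ^ j else 0) sums w ^ n"
      by (rule sums_single)
    then show "(\<lambda>j. (if j = n then 1 else 0) * w ^ j) sums w ^ n"
      by (rule back_subst[of "\<lambda>s. s sums _"]) auto
  qed
  have "(\<lambda>z::complex. z ^ n) \<in> hardy_inf_disk"
    by (rule hardy_inf_diskI[of _ 1]) (auto intro!: holomorphic_intros power_le_one simp: norm_power)
  moreover have "boundary_function (\<lambda>z. z ^ n) (\<lambda>z. z powi int n)"
    by (rule boundary_functionI[OF t]) (auto simp: fcoef_power_int simp del: power_int_of_nat intro: L2_power_int)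
  ultimately show ?thesis
    unfolding Hinf_def by blast
qed

lemma Hinf_trig:
  assumes "finite F" "\<And>n. n \<in> F \<Longrightarrow> n \<ge> 0"
  shows "trig c F \<in> Hinf"
  using assms
proof (induction F)
  case empty
  show ?case
    using Hinf_lincomb[OF Hinf_power[of 0] Hinf_power[of 0], of 0 0] by (simp add: trig_def)
next
  case (insert n F)
  have "(\<lambda>z. z powi int (nat n)) \<in> Hinf"
    by (rule Hinf_power)
  then have "(\<lambda>z. c n * z powi n + 1 * trig c F z) \<in> Hinf"
    using insert by (intro Hinf_lincomb) auto
  then show ?case
    using insert by (simp add: trig_def)
qed

text \<open>The formula (f - f(0)) / z for the adjoint of the compressed shift, as a concrete
  function; \<open>comp_shift_adj\<close> is a choice that agrees with it a.e. on a model
  space.\<close>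

definition bshift :: "cfun \<Rightarrow> cfun" where
  "bshift f = (\<lambda>z. z powi (-1) * (f z - fcoef f 0))"

lemma bshift_L2: "f \<in> L2 \<Longrightarrow> bshift f \<in> L2"
  unfolding bshift_def by (intro L2_mult_power_int L2_diff) auto

lemma fcoef_bshift:
  assumes "f \<in> H2"
  shows "fcoef (bshift f) n = (if n \<ge> 0 then fcoef f (n + 1) else 0)"
proof -
  have f: "f \<in> L2" "\<And>n. n < 0 \<Longrightarrow> fcoef f n = 0"
    using assms by (auto simp: H2_iff)
  have "fcoef (bshift f) n = fcoef (\<lambda>z. f z - fcoef f 0) (n + 1)"
    unfolding bshift_def using f
    by (subst fcoef_mult_power_int) (auto intro: L2_measurable L2_diff)
  also have "\<dots> = fcoef f (n + 1) - fcoef (\<lambda>z. fcoef f 0 * z powi 0) (n + 1)"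
    using f by (subst fcoef_diff) (auto intro: L2_integrable)
  also have "\<dots> = fcoef f (n + 1) - (if n + 1 = 0 then fcoef f 0 else 0)"
    by (simp add: fcoef_cmult fcoef_power_int del: power_int_0_right)
  finally show ?thesis
    using f(2)[of "n + 1"] by auto
qed

lemma Hinf_bshift:
  assumes "f \<in> Hinf"
  shows "bshift f \<in> Hinf"
proof -
  obtain F where F: "F \<in> hardy_inf_disk" "boundary_function F f"
    using assms by (auto simp: Hinf_def)
  obtain a where a: "has_taylor F a"
    using hardy_inf_disk_taylor F(1) by metis
  obtain C where C: "\<And>w. w \<in> ball 0 1 \<Longrightarrow> norm (F w) \<le> C" "C > 0"
    using hardy_inf_disk_bounded[OF F(1)] by blast
  have F0: "F 0 = a 0"
    using a[unfolded has_taylor_def, rule_format, of 0] by simp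
  \<comment> \<open>The value at 0 fills the removable singularity, so that G is the sum of the
    shifted power series on the whole disk.\<close>
  define G where "G = (\<lambda>w. if w = 0 then a 1 else (F w - a 0) / w)"
  have G: "has_taylor G (\<lambda>n. a (Suc n))"
    unfolding has_taylor_def
  proof (intro allI impI)
    fix w :: complex assume w: "norm w < 1"
    show "(\<lambda>n. a (Suc n) * w ^ n) sums G w"
    proof (cases "w = 0")
      case True
      then show ?thesis
        using powser_sums_zero[of "\<lambda>n. a (Suc n)"] by (simp add: G_def)
    next
      case False
      have "(\<lambda>n. a n * w ^ n) sums F w"
        using a w by (simp add: has_taylor_def)
      then have "(\<lambda>n. a (Suc n) * w ^ Suc n) sums (F w - a 0)"
        by (subst sums_Suc_iff) simp
      then have "(\<lambda>n. a (Suc n) * w ^ Suc n / w) sums ((F w - a 0) / w)"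
        by (rule sums_divide)
      then show ?thesis
        using False by (simp add: G_def)
    qed
  qed
  have "compact (G ` cball 0 (1/2))"
    by (intro compact_continuous_image continuous_on_subset[OF holomorphic_on_imp_continuous_on[OF has_taylor_holomorphic[OF G]]])
      auto
  then obtain D where D: "\<forall>x\<in>G ` cball 0 (1/2). norm x \<le> D"
    using compact_imp_bounded bounded_iff by metis
  \<comment> \<open>D bounds G on the closed disk of radius 1/2 by compactness; outside it |F w - F
    0| \<le> 2 C is divided by more than 1/2.\<close>
  have "norm (G w) \<le> max D (4 * C)" if w: "w \<in> ball 0 1" for w
  proof (cases "norm w \<le> 1/2")
    case True
    then have "norm (G w) \<le> D"
      using D by simp
    then show ?thesis by simp
  next
    case False
    then have "w \<noteq> 0" by auto
    have "norm (F w - a 0) \<le> C + C"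
      using C(1)[OF w] C(1)[of 0] F0 by (intro order_trans[OF norm_triangle_ineq4] add_mono) auto
    then have "norm (G w) \<le> (C + C) / norm w"
      using \<open>w \<noteq> 0\<close> by (simp add: G_def norm_divide divide_right_mono)
    also have "\<dots> \<le> (C + C) / (1/2)"
      using False C(2) by (intro divide_left_mono) auto
    finally show ?thesis by simp
  qed
  then have "G \<in> hardy_inf_disk"
    by (rule hardy_inf_diskI[OF has_taylor_holomorphic[OF G]])
  moreover have "boundary_function G (bshift f)"
  proof (rule boundary_functionI[OF G])
    show "bshift f \<in> L2"
      using F(2) by (intro bshift_L2) (simp add: boundary_function_def)
    show "fcoef (bshift f) n = (if n \<ge> 0 then a (Suc (nat n)) else 0)" for n
      using fcoef_boundary[OF a F(2)]
      by (simp add: fcoef_bshift[OF boundary_H2[OF a F(2)]] Suc_nat_eq_nat_zadd1 add.commute)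
  qed
  ultimately show ?thesis
    unfolding Hinf_def by blast
qed

lemma Hinf_cong:
  assumes "g \<in> Hinf" "f \<in> L2" "\<And>n. fcoef f n = fcoef g n"
  shows "f \<in> Hinf"
  using assms HinfI by (auto simp: Hinf_def)

text \<open>The Riesz projection onto \<open>H2\<close>: truncated coefficients remain square
  summable.\<close>

lemma analytic_part_exists:
  assumes "f \<in> L2"
  obtains p where "p \<in> H2" "\<And>n. fcoef p n = (if n \<ge> 0 then fcoef f n else 0)"
proof -
  have "(\<lambda>n. (norm (if n \<ge> 0 then fcoef f n else 0))\<^sup>2) summable_on UNIV"
    by (rule summable_on_comparison_test[OF Bessel(1)[OF assms]]) auto
  then obtain p where p: "p \<in> L2" "\<And>n. fcoef p n = (if n \<ge> 0 then fcoef f n else 0)"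
    by (rule Riesz_Fischer) blast
  show thesis
    by (rule that[of p]) (use p in \<open>auto simp: H2_iff\<close>)
qed

subsection \<open>Model spaces\<close>

text \<open>\<open>\<alpha>\<close> is given on the disk, while orthogonality and unimodularity are
  statements on the circle; the locale fixes a boundary function \<open>a\<close> with which to
  compute there.\<close>

locale inner_boundary =
  fixes \<alpha> a :: cfun
  assumes inner: "inner_function \<alpha>" and bd: "boundary_function \<alpha> a"
begin

lemma a_Hinf: "a \<in> Hinf"
  using inner bd by (auto simp: Hinf_def inner_function_def)

lemma a_H2: "a \<in> H2"
  by (rule Hinf_H2[OF a_Hinf])

lemma a_L2: "a \<in> L2"
  by (rule H2_L2[OF a_H2])

lemma fcoef_a_neg: "n < 0 \<Longrightarrow> fcoef a n = 0"
  using a_H2 by (simp add: H2_iff)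

text \<open>The a.e. limit of the dilations along a sequence of radii has to coincide with the
  radial limit that an inner function possesses by definition.\<close>

lemma a_unimodular: "AE z in circle. norm (a z) = 1"
proof -
  have hol: "\<alpha> holomorphic_on ball 0 1"
    using inner by (simp add: inner_function_def hardy_inf_disk_def)
  obtain \<rho> where \<rho>: "filterlim \<rho> (at_left (1::real)) sequentially"
    "AE z in circle. (\<lambda>n::nat. \<alpha> (complex_of_real (\<rho> n) * z)) \<longlonglongrightarrow> a z"
    by (rule boundary_AE_subseq[OF hol bd]) blast
  have "AE z in circle. \<exists>l. ((\<lambda>r. \<alpha> (complex_of_real r * z)) \<longlongrightarrow> l) (at_left 1) \<and> norm l = 1"
    using inner by (simp add: inner_function_def)
  with \<rho>(2) show ?thesis
  proof eventually_elim
    case (elim z)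
    then obtain l where l: "((\<lambda>r. \<alpha> (complex_of_real r * z)) \<longlongrightarrow> l) (at_left 1)" "norm l = 1"
      by blast
    have "(\<lambda>n. \<alpha> (complex_of_real (\<rho> n) * z)) \<longlonglongrightarrow> l"
      by (rule filterlim_compose[OF l(1) \<rho>(1)])
    then have "l = a z"
      using elim(1) LIMSEQ_unique by blast
    then show ?case using l(2) by simp
  qed
qed

lemma mult_a_L2: "f \<in> L2 \<Longrightarrow> (\<lambda>z. a z * f z) \<in> L2"
  by (rule L2_mult_bounded[OF _ L2_measurable[OF a_L2], of _ 1]) (use a_unimodular in auto)

lemma mult_cnj_a_L2: "f \<in> L2 \<Longrightarrow> (\<lambda>z. cnj (a z) * f z) \<in> L2"
  by (rule L2_mult_bounded[OF _ L2_measurable[OF L2_cnj[OF a_L2]], of _ 1]) (use a_unimodular in auto)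

lemma ip_mult_a: "ip f (\<lambda>z. a z * g z) = ip (\<lambda>z. cnj (a z) * f z) g"
  unfolding ip_def by (rule Bochner_Integration.integral_cong) (auto simp: mult_ac)

lemma cnj_a_mult_a: "AE z in circle. cnj (a z) * (a z * f z) = f z"
  using a_unimodular
proof eventually_elim
  case (elim z)
  have "cnj (a z) * a z = 1"
    using elim complex_norm_square[of "a z"] by (simp add: mult.commute)
  then show ?case
    by (metis mult.assoc mult_1)
qed

lemma fcoef_cnj_a_mult_a:
  assumes "f \<in> L2"
  shows "fcoef (\<lambda>z. cnj (a z) * (a z * f z)) n = fcoef f n"
  by (rule fcoef_cong_AE[OF cnj_a_mult_a])
    (auto intro!: L2_measurable mult_cnj_a_L2 mult_a_L2 assms)

lemma mult_a_H2: "f \<in> H2 \<Longrightarrow> (\<lambda>z. a z * f z) \<in> H2"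
  using mult_a_L2[OF H2_L2] fcoef_mult_H2[OF a_H2] by (simp add: H2_iff)

text \<open>The boundary function of \<open>\<alpha> z * F z\<close> and the product
  \<open>a z * f z\<close> have the same coefficients. Comparing coefficients rather than functions
  leaves room for changes on null sets.\<close>

lemma inner_times_H2_iff:
  "h \<in> inner_times_H2 \<alpha> \<longleftrightarrow> h \<in> L2 \<and> (\<exists>f\<in>H2. \<forall>n. fcoef h n = fcoef (\<lambda>z. a z * f z) n)"
proof -
  obtain c where c: "has_taylor \<alpha> c"
    using hardy_inf_disk_taylor inner by (auto simp: inner_function_def)
  have *: "boundary_function (\<lambda>z. \<alpha> z * F z) (\<lambda>z. a z * f z)" if "boundary_function F f" "has_taylor F b" for F f b
    by (rule boundary_function_mult[OF c bd that(2,1)])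
      (use that(1) in \<open>auto simp: boundary_function_def intro: mult_a_L2\<close>)
  show ?thesis
  proof (intro iffI conjI)
    assume "h \<in> inner_times_H2 \<alpha>"
    then obtain F where F: "F \<in> hardy2_disk" and h: "boundary_function (\<lambda>z. \<alpha> z * F z) h"
      by (auto simp: inner_times_H2_def)
    obtain b where b: "has_taylor F b"
      using F holomorphic_has_taylor by (auto simp: hardy2_disk_def)
    obtain f where f: "boundary_function F f"
      using hardy2_disk_boundary[OF F] by blast
    show "h \<in> L2"
      using h by (simp add: boundary_function_def)
    show "\<exists>f\<in>H2. \<forall>n. fcoef h n = fcoef (\<lambda>z. a z * f z) n"
      using fcoef_boundary[OF has_taylor_mult[OF c b] h] boundary_H2[OF b f]
        fcoef_boundary[OF has_taylor_mult[OF c b] *[OF f b]]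
      by (intro bexI[of _ f]) auto
  next
    assume "h \<in> L2 \<and> (\<exists>f\<in>H2. \<forall>n. fcoef h n = fcoef (\<lambda>z. a z * f z) n)"
    then obtain f where h: "h \<in> L2" and f: "f \<in> H2" "\<And>n. fcoef h n = fcoef (\<lambda>z. a z * f z) n"
      by blast
    obtain F where F: "F \<in> hardy2_disk" "boundary_function F f"
      using f(1) by (auto simp: H2_def)
    obtain b where b: "has_taylor F b"
      using F holomorphic_has_taylor by (auto simp: hardy2_disk_def)
    have "boundary_function (\<lambda>z. \<alpha> z * F z) h"
      by (rule boundary_functionI[OF has_taylor_mult[OF c b] h])
        (simp only: f(2) fcoef_boundary[OF has_taylor_mult[OF c b] *[OF F(2) b]])
    then show "h \<in> inner_times_H2 \<alpha>"
      using F(1) by (auto simp: inner_times_H2_def)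
  qed
qed

text \<open>Orthogonality to \<open>a z * z powi n\<close> is the vanishing of the n-th coefficient
  of \<open>cnj (a z) * f z\<close>. Conversely, moving \<open>a\<close> across the inner product
  leaves two functions with disjoint frequencies.\<close>

theorem model_space_iff:
  "f \<in> model_space \<alpha> \<longleftrightarrow> f \<in> L2 \<and> (\<forall>n<0. fcoef f n = 0) \<and> (\<forall>n\<ge>0. fcoef (\<lambda>z. cnj (a z) * f z) n = 0)"
proof (intro iffI conjI allI impI)
  assume f: "f \<in> model_space \<alpha>"
  then show "f \<in> L2"
    by (auto simp: model_space_def H2_iff)
  fix n :: int
  show "fcoef f n = 0" if "n < 0"
    using f that by (auto simp: model_space_def H2_iff)
  assume n: "n \<ge> 0"
  have "(\<lambda>z. a z * z powi n) \<in> inner_times_H2 \<alpha>"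
    unfolding inner_times_H2_iff by (auto intro!: mult_a_L2 L2_power_int bexI[OF _ H2_power_int[OF n]])
  then have "ip f (\<lambda>z. a z * z powi n) = 0"
    using f by (auto simp: model_space_def)
  then show "fcoef (\<lambda>z. cnj (a z) * f z) n = 0"
    by (simp add: ip_mult_a fcoef_eq_ip)
next
  assume f: "f \<in> L2 \<and> (\<forall>n<0. fcoef f n = 0) \<and> (\<forall>n\<ge>0. fcoef (\<lambda>z. cnj (a z) * f z) n = 0)"
  have "ip f h = 0" if hh: "h \<in> inner_times_H2 \<alpha>" for h
  proof -
    obtain g where h: "h \<in> L2" and g: "g \<in> H2" "\<And>n. fcoef h n = fcoef (\<lambda>z. a z * g z) n"
      using hh unfolding inner_times_H2_iff by blast
    have "AE z in circle. h z = a z * g z"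
      by (rule fcoef_eq_imp_AE_eq) (use h g in \<open>auto intro: L2_integrable mult_a_L2 H2_L2\<close>)
    then have "ip f h = ip f (\<lambda>z. a z * g z)"
      using f h g by (intro ip_cong_AE) (auto intro: mult_a_L2 H2_L2)
    also have "\<dots> = 0"
      unfolding ip_mult_a
    proof (rule ip_eq_0_disjoint)
      show "fcoef (\<lambda>z. cnj (a z) * f z) n = 0 \<or> fcoef g n = 0" for n
        using f g(1) by (cases "n < 0") (simp_all add: H2_iff)
    qed (use f g in \<open>auto simp: H2_iff intro: mult_cnj_a_L2\<close>)
    finally show ?thesis .
  qed
  then show "f \<in> model_space \<alpha>"
    using f by (auto simp: model_space_def H2_iff)
qed

lemma model_L2: "f \<in> model_space \<alpha> \<Longrightarrow> f \<in> L2"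
  by (simp add: model_space_iff)

lemma model_H2: "f \<in> model_space \<alpha> \<Longrightarrow> f \<in> H2"
  by (simp add: model_space_def)

lemma fcoef_model_neg: "f \<in> model_space \<alpha> \<Longrightarrow> n < 0 \<Longrightarrow> fcoef f n = 0"
  by (simp add: model_space_iff)

lemma model_lincomb:
  assumes "f \<in> model_space \<alpha>" "g \<in> model_space \<alpha>"
  shows "(\<lambda>z. c * f z + d * g z) \<in> model_space \<alpha>"
proof -
  have f: "f \<in> L2" "g \<in> L2"
    using assms model_L2 by auto
  have "(\<lambda>z. cnj (a z) * (c * f z + d * g z)) =
      (\<lambda>z. c * (cnj (a z) * f z) + d * (cnj (a z) * g z))"
    by (simp add: algebra_simps)
  then show ?thesis
    using assms f by (simp add: model_space_iff L2_lincomb fcoef_lincomb L2_integrable mult_cnj_a_L2)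
qed

lemma model_diff: "f \<in> model_space \<alpha> \<Longrightarrow> g \<in> model_space \<alpha> \<Longrightarrow> (\<lambda>z. f z - g z) \<in> model_space \<alpha>"
  using model_lincomb[of f g 1 "-1"] by simp

lemma model_cmult: "f \<in> model_space \<alpha> \<Longrightarrow> (\<lambda>z. c * f z) \<in> model_space \<alpha>"
  using model_lincomb[of f f c 0] by simp

lemma model_eqI:
  assumes "f \<in> model_space \<alpha>" "g \<in> model_space \<alpha>"
    and "\<And>h. h \<in> model_space \<alpha> \<Longrightarrow> ip f h = ip g h"
  shows "AE z in circle. f z = g z"
proof -
  let ?d = "\<lambda>z. f z - g z"
  have d: "?d \<in> model_space \<alpha>"
    by (intro model_diff assms)
  have "ip ?d ?d = 0"
    using assms(3)[OF d] by (simp add: ip_diff_left model_L2 assms d)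
  then have "l2norm ?d = 0"
    by (simp add: ip_self)
  then show ?thesis
    using l2norm_eq_0_AE[OF model_L2[OF d]] by simp
qed

section \<open>Orthogonal projection onto a model space\<close>

lemma projection_exists:
  assumes f: "f \<in> L2"
  obtains p q where "p \<in> H2" "q \<in> H2" "\<And>n. fcoef p n = (if n \<ge> 0 then fcoef f n else 0)"
    "\<And>n. fcoef q n = (if n \<ge> 0 then fcoef (\<lambda>z. cnj (a z) * p z) n else 0)"
    "(\<lambda>z. p z - a z * q z) \<in> model_space \<alpha>"
    "\<And>h. h \<in> model_space \<alpha> \<Longrightarrow> ip (\<lambda>z. f z - (p z - a z * q z)) h = 0"
proof -
  obtain p where p: "p \<in> H2" "\<And>n. fcoef p n = (if n \<ge> 0 then fcoef f n else 0)"
    by (rule analytic_part_exists[OF f]) blast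
  have pL2: "p \<in> L2" by (rule H2_L2[OF p(1)])
  obtain q where q: "q \<in> H2" "\<And>n. fcoef q n = (if n \<ge> 0 then fcoef (\<lambda>z. cnj (a z) * p z) n else 0)"
    by (rule analytic_part_exists[OF mult_cnj_a_L2[OF pL2]]) blast
  have qL2: "q \<in> L2" by (rule H2_L2[OF q(1)])
  \<comment> \<open>With P_+ the Riesz projection this is the formula P_+ f - a P_+(conj(a) P_+ f).
    Its ingredients p and q appear in the statement because boundedness of projected powers is read
    off from them.\<close>
  let ?g = "\<lambda>z. p z - a z * q z"
  have gL2: "?g \<in> L2"
    by (intro L2_diff pL2 mult_a_L2 qL2)
  have "fcoef ?g n = 0" if "n < 0" for n
    using that p(1) mult_a_H2[OF q(1)]
    by (subst fcoef_diff) (auto simp: H2_iff intro!: L2_integrable)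
  moreover have "fcoef (\<lambda>z. cnj (a z) * ?g z) n = 0" if "n \<ge> 0" for n
  proof -
    have "fcoef (\<lambda>z. cnj (a z) * ?g z) n = fcoef (\<lambda>z. cnj (a z) * p z - cnj (a z) * (a z * q z)) n"
      by (simp add: algebra_simps)
    also have "\<dots> = fcoef (\<lambda>z. cnj (a z) * p z) n - fcoef q n"
      by (subst fcoef_diff) (auto intro!: L2_integrable mult_cnj_a_L2 mult_a_L2 pL2 qL2 simp: fcoef_cnj_a_mult_a[OF qL2])
    also have "\<dots> = 0"
      using that by (simp add: q(2))
    finally show ?thesis .
  qed
  ultimately have gK: "?g \<in> model_space \<alpha>"
    using gL2 by (simp add: model_space_iff)
  have "ip (\<lambda>z. f z - ?g z) h = 0" if h: "h \<in> model_space \<alpha>" for h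
  proof -
    have hL2: "h \<in> L2" by (rule model_L2[OF h])
    have 1: "ip (\<lambda>z. f z - p z) h = 0"
    proof (rule ip_eq_0_disjoint)
      show "fcoef (\<lambda>z. f z - p z) n = 0 \<or> fcoef h n = 0" for n
        using fcoef_model_neg[OF h, of n]
        by (cases "n < 0") (auto simp: fcoef_diff L2_integrable f pL2 p(2))
    qed (auto intro: L2_diff f pL2 hL2)
    have "ip h (\<lambda>z. a z * q z) = 0"
      unfolding ip_mult_a
    proof (rule ip_eq_0_disjoint)
      show "fcoef (\<lambda>z. cnj (a z) * h z) n = 0 \<or> fcoef q n = 0" for n
        using h q(1) by (cases "n < 0") (auto simp: model_space_iff H2_iff)
    qed (auto intro: mult_cnj_a_L2 qL2 hL2)
    then have 2: "ip (\<lambda>z. a z * q z) h = 0"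
      by (subst ip_commute) simp
    have "ip (\<lambda>z. (f z - p z) + a z * q z) h = 0"
      by (subst ip_add_left) (auto intro!: L2_diff mult_a_L2 f pL2 qL2 hL2 simp: 1 2)
    then show ?thesis
      by (simp add: algebra_simps)
  qed
  then show thesis
    using that p q gK by blast
qed

lemma proj_model:
  assumes f: "f \<in> L2"
  shows "proj (model_space \<alpha>) f \<in> model_space \<alpha>"
    and "h \<in> model_space \<alpha> \<Longrightarrow> ip (proj (model_space \<alpha>) f) h = ip f h"
proof -
  have "\<exists>g. g \<in> model_space \<alpha> \<and> (\<forall>h\<in>model_space \<alpha>. ip (\<lambda>z. f z - g z) h = 0)"
    using projection_exists[OF f] by metis
  from someI_ex[OF this] have *: "proj (model_space \<alpha>) f \<in> model_space \<alpha>"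
    "\<forall>h\<in>model_space \<alpha>. ip (\<lambda>z. f z - proj (model_space \<alpha>) f z) h = 0"
    by (auto simp: proj_def)
  show "proj (model_space \<alpha>) f \<in> model_space \<alpha>" by (rule *(1))
  assume h: "h \<in> model_space \<alpha>"
  then have "ip f h - ip (proj (model_space \<alpha>) f) h = 0"
    using *(2) by (simp add: ip_diff_left f model_L2 *(1))
  then show "ip (proj (model_space \<alpha>) f) h = ip f h" by simp
qed

lemma proj_eqI:
  assumes "f \<in> L2" "g \<in> model_space \<alpha>" "\<And>h. h \<in> model_space \<alpha> \<Longrightarrow> ip g h = ip f h"
  shows "AE z in circle. proj (model_space \<alpha>) f z = g z"
  by (rule model_eqI) (simp_all add: proj_model assms)

lemma proj_norm_le:
  assumes "f \<in> L2"
  shows "l2norm (proj (model_space \<alpha>) f) \<le> l2norm f"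
proof -
  let ?P = "proj (model_space \<alpha>) f"
  have P: "?P \<in> L2" by (rule model_L2[OF proj_model(1)[OF assms]])
  have "complex_of_real ((l2norm ?P)\<^sup>2) = ip f ?P"
    unfolding ip_self[symmetric] by (rule proj_model(2)[OF assms proj_model(1)[OF assms]])
  then have "(l2norm ?P)\<^sup>2 \<le> l2norm f * l2norm ?P"
    using Cauchy_Schwarz[OF assms P] by (metis abs_of_nonneg norm_of_real zero_le_power2)
  then show ?thesis
    using l2norm_nonneg[of ?P] by (cases "l2norm ?P = 0") (auto simp: power2_eq_square)
qed

lemma proj_lincomb:
  assumes "f \<in> L2" "g \<in> L2"
  shows "AE z in circle. proj (model_space \<alpha>) (\<lambda>z. c * f z + d * g z) z =
    c * proj (model_space \<alpha>) f z + d * proj (model_space \<alpha>) g z"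
  by (rule proj_eqI)
    (auto intro!: L2_lincomb model_lincomb proj_model(1) assms
      simp: ip_lincomb_left model_L2 proj_model assms)

lemma proj_id: "f \<in> model_space \<alpha> \<Longrightarrow> AE z in circle. proj (model_space \<alpha>) f z = f z"
  by (rule proj_eqI) (auto intro: model_L2)

text \<open>In the projection formula p and q are polynomials of degree at most |n|: p keeps at most
  the given power, and q cannot reach higher because conj(a) has only frequencies \<le> 0. Hence p -
  a q is bounded. This is the source of the density of \<open>model_space_inf\<close>.\<close>

lemma proj_power_model_inf: "proj (model_space \<alpha>) (\<lambda>z. z powi n) \<in> model_space_inf \<alpha>"
proof -
  obtain p q where pq: "p \<in> H2" "q \<in> H2" "\<And>m. fcoef p m = (if m \<ge> 0 then fcoef (\<lambda>z. z powi n) m else 0)"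
    "\<And>m. fcoef q m = (if m \<ge> 0 then fcoef (\<lambda>z. cnj (a z) * p z) m else 0)"
    "(\<lambda>z. p z - a z * q z) \<in> model_space \<alpha>"
    "\<And>h. h \<in> model_space \<alpha> \<Longrightarrow> ip (\<lambda>z. z powi n - (p z - a z * q z)) h = 0"
    using projection_exists[OF L2_power_int[of n]] by blast
  have pL2: "p \<in> L2" and qL2: "q \<in> L2"
    using pq H2_L2 by auto
  have "p \<in> Hinf"
  proof (rule Hinf_cong[OF _ pL2])
    show "trig (fcoef p) {0..\<bar>n\<bar>} \<in> Hinf"
      by (rule Hinf_trig) auto
    show "fcoef p m = fcoef (trig (fcoef p) {0..\<bar>n\<bar>}) m" for m
      by (auto simp: fcoef_trig pq(3) fcoef_power_int)
  qed
  moreover have "q \<in> Hinf"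
  proof (rule Hinf_cong[OF _ qL2])
    show "trig (fcoef q) {0..\<bar>n\<bar>} \<in> Hinf"
      by (rule Hinf_trig) auto
    have "fcoef q m = 0" if m: "m > \<bar>n\<bar>" for m
    proof -
      have "((\<lambda>j. fcoef (\<lambda>z. cnj (a z)) j * fcoef p (m - j)) has_sum fcoef (\<lambda>z. cnj (a z) * p z) m) UNIV"
        by (rule fcoef_mult[OF L2_cnj[OF a_L2] pL2])
      moreover have "fcoef (\<lambda>z. cnj (a z)) j * fcoef p (m - j) = 0" for j
        using m fcoef_a_neg[of "-j"] by (auto simp: fcoef_cnj pq(3) fcoef_power_int)
      ultimately have "((\<lambda>j::int. 0) has_sum fcoef (\<lambda>z. cnj (a z) * p z) m) UNIV"
        by simp
      then have "fcoef (\<lambda>z. cnj (a z) * p z) m = 0"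
        using has_sum_unique[OF _ has_sum_0] by blast
      then show ?thesis by (simp add: pq(4))
    qed
    then show "fcoef q m = fcoef (trig (fcoef q) {0..\<bar>n\<bar>}) m" for m
      using pq(4)[of m] by (cases "m > \<bar>n\<bar>") (auto simp: fcoef_trig)
  qed
  ultimately have "(\<lambda>z. 1 * p z + (-1) * (a z * q z)) \<in> Hinf"
    by (intro Hinf_lincomb Hinf_mult a_Hinf)
  then have H: "(\<lambda>z. p z - a z * q z) \<in> Hinf"
    by simp
  let ?P = "proj (model_space \<alpha>) (\<lambda>z. z powi n)"
  have PK: "?P \<in> model_space \<alpha>"
    by (rule proj_model(1)[OF L2_power_int])
  have "AE z in circle. ?P z = p z - a z * q z"
  proof (rule proj_eqI[OF L2_power_int pq(5)])
    fix h assume h: "h \<in> model_space \<alpha>"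
    show "ip (\<lambda>z. p z - a z * q z) h = ip (\<lambda>z. z powi n) h"
      using pq(6)[OF h] ip_diff_left[OF L2_power_int model_L2[OF pq(5)] model_L2[OF h]] by simp
  qed
  then have "fcoef ?P m = fcoef (\<lambda>z. p z - a z * q z) m" for m
    by (rule fcoef_cong_AE) (auto intro!: L2_measurable model_L2 PK pq(5))
  then have "?P \<in> Hinf"
    by (rule Hinf_cong[OF H model_L2[OF PK]])
  then show ?thesis
    using PK by (simp add: model_space_inf_def)
qed

section \<open>The compressed shift, its adjoint and the kernels at the origin\<close>

lemma bshift_model:
  assumes "f \<in> model_space \<alpha>"
  shows "bshift f \<in> model_space \<alpha>"
proof -
  have f: "f \<in> L2" "f \<in> H2" using assms model_L2 model_H2 by auto
  have "fcoef (\<lambda>z. cnj (a z) * bshift f z) n = 0" if n: "n \<ge> 0" for n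
  proof -
    \<comment> \<open>Division by z moves the index n \<ge> 0 to n + 1 > 0, where neither conj(a) f
      nor a multiple of conj(a) has a nonzero coefficient.\<close>
    have "(\<lambda>z. cnj (a z) * bshift f z) =
        (\<lambda>z. z powi (-1) * (cnj (a z) * f z - fcoef f 0 * cnj (a z)))"
      by (simp add: bshift_def algebra_simps)
    then have "fcoef (\<lambda>z. cnj (a z) * bshift f z) n = fcoef (\<lambda>z. cnj (a z) * f z - fcoef f 0 * cnj (a z)) (n + 1)"
      using f by (simp only:, subst fcoef_mult_power_int)
        (auto intro!: L2_measurable L2_diff L2_cmult L2_cnj mult_cnj_a_L2 a_L2)
    also have "\<dots> = fcoef (\<lambda>z. cnj (a z) * f z) (n + 1) - fcoef f 0 * cnj (fcoef a (- (n + 1)))"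
      using f by (subst fcoef_diff)
        (auto intro!: L2_integrable L2_cmult L2_cnj mult_cnj_a_L2 a_L2 simp: fcoef_cmult fcoef_cnj)
    also have "\<dots> = 0"
      using assms n fcoef_a_neg[of "- (n + 1)"] by (simp add: model_space_iff)
    finally show ?thesis .
  qed
  then show ?thesis
    using f by (simp add: model_space_iff bshift_L2 fcoef_bshift)
qed

lemma comp_shift_model:
  assumes "g \<in> model_space \<alpha>"
  shows "comp_shift \<alpha> g \<in> model_space \<alpha>"
    and "h \<in> model_space \<alpha> \<Longrightarrow> ip (comp_shift \<alpha> g) h = ip g (bshift h)"
proof -
  have g: "g \<in> L2" by (rule model_L2[OF assms])
  have zg: "(\<lambda>z. z * g z) \<in> L2"
    using L2_mult_power_int[OF g, of 1] by simp
  show "comp_shift \<alpha> g \<in> model_space \<alpha>"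
    unfolding comp_shift_def by (rule proj_model(1)[OF zg])
  assume h: "h \<in> model_space \<alpha>"
  have hL2: "h \<in> L2" by (rule model_L2[OF h])
  have "ip (comp_shift \<alpha> g) h = ip (\<lambda>z. z * g z) h"
    unfolding comp_shift_def by (rule proj_model(2)[OF zg h])
  \<comment> \<open>On the circle h / z is \<open>bshift h\<close> plus the constant term of h
    divided by z; the latter is orthogonal to g, which has no coefficient of index -1.\<close>
  also have "\<dots> = ip g (\<lambda>z. 1 * bshift h z + fcoef h 0 * z powi (-1))"
    unfolding ip_def
    by (rule Bochner_Integration.integral_cong)
      (auto simp: bshift_def inverse_circle power_int_minus algebra_simps)
  also have "\<dots> = ip g (bshift h) + cnj (fcoef h 0) * fcoef g (-1)"
    using ip_lincomb_right[OF bshift_L2[OF hL2] L2_power_int g, of 1 "fcoef h 0" "-1"]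
    by (simp add: fcoef_eq_ip)
  also have "\<dots> = ip g (bshift h)"
    using fcoef_model_neg[OF assms, of "-1"] by simp
  finally show "ip (comp_shift \<alpha> g) h = ip g (bshift h)" .
qed

text \<open>\<open>bshift f\<close> satisfies the relation defining the adjoint, so the choice is
  not vacuous, and within a model space that relation determines the function a.e.\<close>

lemma comp_shift_adj_model:
  assumes f: "f \<in> model_space \<alpha>"
  shows "comp_shift_adj \<alpha> f \<in> model_space \<alpha>"
    and "fcoef (comp_shift_adj \<alpha> f) n = fcoef (bshift f) n"
proof -
  have "\<exists>g. g \<in> model_space \<alpha> \<and> (\<forall>h\<in>model_space \<alpha>. ip (comp_shift \<alpha> h) f = ip h g)"
    using bshift_model[OF f] comp_shift_model(2)[OF _ f] by blast
  from someI_ex[OF this] have *: "comp_shift_adj \<alpha> f \<in> model_space \<alpha>"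
    "\<forall>h\<in>model_space \<alpha>. ip (comp_shift \<alpha> h) f = ip h (comp_shift_adj \<alpha> f)"
    by (auto simp: comp_shift_adj_def adj_def)
  show "comp_shift_adj \<alpha> f \<in> model_space \<alpha>" by (rule *(1))
  have "AE z in circle. comp_shift_adj \<alpha> f z = bshift f z"
  proof (rule model_eqI[OF *(1) bshift_model[OF f]])
    fix h assume h: "h \<in> model_space \<alpha>"
    then have "ip h (comp_shift_adj \<alpha> f) = ip h (bshift f)"
      using *(2) comp_shift_model(2)[OF h f] by simp
    then show "ip (comp_shift_adj \<alpha> f) h = ip (bshift f) h"
      by (metis ip_commute)
  qed
  then show "fcoef (comp_shift_adj \<alpha> f) n = fcoef (bshift f) n"
    by (rule fcoef_cong_AE) (auto intro!: L2_measurable model_L2 *(1) bshift_model f)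
qed

lemma ip_comp_shift:
  assumes "g \<in> model_space \<alpha>" "h \<in> model_space \<alpha>"
  shows "ip (comp_shift \<alpha> g) h = ip g (comp_shift_adj \<alpha> h)"
proof -
  have "AE z in circle. comp_shift_adj \<alpha> h z = bshift h z"
    by (rule fcoef_eq_imp_AE_eq)
      (auto intro!: L2_integrable model_L2 comp_shift_adj_model bshift_model assms(2))
  then have "ip g (comp_shift_adj \<alpha> h) = ip g (bshift h)"
    by (intro ip_cong_AE) (auto intro!: model_L2 comp_shift_adj_model bshift_model assms)
  then show ?thesis
    using comp_shift_model(2)[OF assms] by simp
qed

lemma fcoef_comp_shift_adj:
  "f \<in> model_space \<alpha> \<Longrightarrow> fcoef (comp_shift_adj \<alpha> f) n = (if n \<ge> 0 then fcoef f (n + 1) else 0)"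
  by (simp add: comp_shift_adj_model fcoef_bshift model_H2)

lemma comp_shift_adj_model_inf:
  assumes "f \<in> model_space_inf \<alpha>"
  shows "comp_shift_adj \<alpha> f \<in> model_space_inf \<alpha>"
proof -
  have f: "f \<in> model_space \<alpha>" "f \<in> Hinf" using assms by (auto simp: model_space_inf_def)
  show ?thesis
    using Hinf_cong[OF Hinf_bshift[OF f(2)] model_L2[OF comp_shift_adj_model(1)[OF f(1)]]]
    by (simp add: model_space_inf_def comp_shift_adj_model f(1))
qed

lemma comp_shift_adj_power_inf:
  "f \<in> model_space_inf \<alpha> \<Longrightarrow> (comp_shift_adj \<alpha> ^^ k) f \<in> model_space_inf \<alpha>"
  by (induction k) (auto intro: comp_shift_adj_model_inf)

lemma comp_shift_adj_power_model:
  "f \<in> model_space \<alpha> \<Longrightarrow> (comp_shift_adj \<alpha> ^^ k) f \<in> model_space \<alpha>"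
  by (induction k) (auto intro: comp_shift_adj_model)

lemma fcoef_comp_shift_adj_power:
  assumes "f \<in> model_space \<alpha>"
  shows "fcoef ((comp_shift_adj \<alpha> ^^ k) f) n = (if n \<ge> 0 then fcoef f (n + int k) else 0)"
proof (induction k arbitrary: n)
  case 0
  then show ?case
    using fcoef_model_neg[OF assms] by auto
next
  case (Suc k)
  show ?case
    using fcoef_comp_shift_adj[OF comp_shift_adj_power_model[OF assms, of k], of n] Suc
    by (simp add: algebra_simps)
qed

text \<open>The factor n! is the one in f^(n)(0) = n! f_n; it reappears as \<open>fact j\<close> in
  the displacement identity.\<close>

lemma ker0_model: "ker0 \<alpha> n \<in> model_space \<alpha>"
  and ip_ker0: "f \<in> model_space \<alpha> \<Longrightarrow> ip f (ker0 \<alpha> n) = fact n * fcoef f (int n)"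
proof -
  have m: "(\<lambda>z. fact n * z ^ n) \<in> L2"
    using L2_cmult[OF L2_power_int[of "int n"], of "fact n"] by simp
  show "ker0 \<alpha> n \<in> model_space \<alpha>"
    unfolding ker0_def by (rule proj_model(1)[OF m])
  assume f: "f \<in> model_space \<alpha>"
  have "ip f (ker0 \<alpha> n) = cnj (ip (\<lambda>z. fact n * z ^ n) f)"
    unfolding ker0_def ip_commute[of f] proj_model(2)[OF m f] by (rule refl)
  also have "\<dots> = ip f (\<lambda>z. fact n * z powi int n)"
    by (simp add: ip_commute[symmetric])
  also have "\<dots> = fact n * fcoef f (int n)"
    unfolding ip_cmult_right fcoef_eq_ip by simp
  finally show "ip f (ker0 \<alpha> n) = fact n * fcoef f (int n)" .
qed

lemma ip_ker0_left: "f \<in> model_space \<alpha> \<Longrightarrow> ip (ker0 \<alpha> n) f = fact n * cnj (fcoef f (int n))"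
  by (subst ip_commute) (simp add: ip_ker0)

end

lemma inner_boundary_exists:
  assumes "inner_function \<alpha>"
  obtains a where "inner_boundary \<alpha> a"
  using hardy2_disk_boundary[of \<alpha>] hardy_inf_disk_subset assms
  by (auto simp: inner_boundary_def inner_function_def)

subsection \<open>Bounded operators and functionals on model spaces\<close>

lemma bounded_opD:
  assumes "bounded_op X Y T"
  shows "f \<in> X \<Longrightarrow> T f \<in> Y"
    and "f \<in> X \<Longrightarrow> g \<in> X \<Longrightarrow> AE z in circle. T (\<lambda>z. c * f z + d * g z) z = c * T f z + d * T g z"
  using assms by (auto simp: bounded_op_def)

lemma bounded_op_bound:
  assumes "bounded_op X Y T"
  obtains C where "C \<ge> 0" "\<And>f. f \<in> X \<Longrightarrow> l2norm (T f) \<le> C * l2norm f"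
proof -
  obtain C where C: "\<forall>f\<in>X. l2norm (T f) \<le> C * l2norm f"
    using assms by (auto simp: bounded_op_def)
  have "l2norm (T f) \<le> max 0 C * l2norm f" if "f \<in> X" for f
    using C that mult_right_mono[of C "max 0 C" "l2norm f"] by fastforce
  then show thesis
    using that[of "max 0 C"] by simp
qed

text \<open>Numbers do not see null sets, so linearity can be exact here, whereas
  \<open>bounded_op\<close> asks for it only a.e. The density arguments below are stated as the
  vanishing of such a functional.\<close>

definition bounded_functional :: "cfun set \<Rightarrow> (cfun \<Rightarrow> complex) \<Rightarrow> bool" where
  "bounded_functional X \<Phi> \<longleftrightarrow>
    (\<forall>f\<in>X. \<forall>g\<in>X. \<forall>c d. \<Phi> (\<lambda>z. c * f z + d * g z) = c * \<Phi> f + d * \<Phi> g) \<and>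
    (\<exists>C. \<forall>f\<in>X. norm (\<Phi> f) \<le> C * l2norm f)"

lemma bounded_functional_ip:
  assumes "X \<subseteq> L2" "h \<in> L2"
  shows "bounded_functional X (\<lambda>f. ip f h)"
  unfolding bounded_functional_def
proof (intro conjI exI ballI allI)
  show "ip (\<lambda>z. c * f z + d * g z) h = c * ip f h + d * ip g h" if "f \<in> X" "g \<in> X" for f g c d
    using that assms by (intro ip_lincomb_left) auto
  show "norm (ip f h) \<le> l2norm h * l2norm f" if "f \<in> X" for f
    using Cauchy_Schwarz[of f h] that assms by (auto simp: mult.commute)
qed

lemma bounded_functional_fcoef:
  assumes "X \<subseteq> L2"
  shows "bounded_functional X (\<lambda>f. fcoef f n)"
  unfolding fcoef_eq_ip by (rule bounded_functional_ip[OF assms L2_power_int])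

lemma bounded_functional_lincomb:
  assumes "bounded_functional X \<Phi>" "bounded_functional X \<Psi>"
  shows "bounded_functional X (\<lambda>f. c * \<Phi> f + d * \<Psi> f)"
proof -
  obtain C D where C: "\<And>f. f \<in> X \<Longrightarrow> norm (\<Phi> f) \<le> C * l2norm f"
    and D: "\<And>f. f \<in> X \<Longrightarrow> norm (\<Psi> f) \<le> D * l2norm f"
    using assms unfolding bounded_functional_def by blast
  have "norm (c * \<Phi> f + d * \<Psi> f) \<le> (norm c * C + norm d * D) * l2norm f" if "f \<in> X" for f
  proof -
    have "norm (c * \<Phi> f + d * \<Psi> f) \<le> norm c * norm (\<Phi> f) + norm d * norm (\<Psi> f)"
      unfolding norm_mult[symmetric] by (rule norm_triangle_ineq)
    also have "\<dots> \<le> norm c * (C * l2norm f) + norm d * (D * l2norm f)"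
      by (intro add_mono mult_left_mono C D that) auto
    finally show ?thesis by (simp add: algebra_simps)
  qed
  then have "\<exists>C. \<forall>f\<in>X. norm (c * \<Phi> f + d * \<Psi> f) \<le> C * l2norm f"
    by blast
  moreover have "\<forall>f\<in>X. \<forall>g\<in>X. \<forall>c' d'. c * \<Phi> (\<lambda>z. c' * f z + d' * g z) + d * \<Psi> (\<lambda>z. c' * f z + d' * g z) =
      c' * (c * \<Phi> f + d * \<Psi> f) + d' * (c * \<Phi> g + d * \<Psi> g)"
    using assms unfolding bounded_functional_def by (simp add: algebra_simps)
  ultimately show ?thesis
    unfolding bounded_functional_def by blast
qed

lemma bounded_functional_add:
  "bounded_functional X \<Phi> \<Longrightarrow> bounded_functional X \<Psi> \<Longrightarrow> bounded_functional X (\<lambda>f. \<Phi> f + \<Psi> f)"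
  using bounded_functional_lincomb[of X \<Phi> \<Psi> 1 1] by simp

lemma bounded_functional_diff:
  "bounded_functional X \<Phi> \<Longrightarrow> bounded_functional X \<Psi> \<Longrightarrow> bounded_functional X (\<lambda>f. \<Phi> f - \<Psi> f)"
  using bounded_functional_lincomb[of X \<Phi> \<Psi> 1 "-1"] by simp

lemma bounded_functional_cmult:
  "bounded_functional X \<Phi> \<Longrightarrow> bounded_functional X (\<lambda>f. c * \<Phi> f)"
  using bounded_functional_lincomb[of X \<Phi> \<Phi> c 0] by simp

lemma bounded_functional_sum:
  assumes "\<And>i. i \<in> I \<Longrightarrow> bounded_functional X (\<Phi> i)"
  shows "bounded_functional X (\<lambda>f. \<Sum>i\<in>I. \<Phi> i f)"
proof -
  have zero: "bounded_functional X (\<lambda>f. 0)"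
    unfolding bounded_functional_def by (auto intro: exI[of _ 0])
  show ?thesis
    using assms
    by (induction I rule: infinite_finite_induct) (auto simp: zero intro: bounded_functional_add)
qed

text \<open>Common frame for L2, where \<open>W k\<close> has to be identified, and for the model
  spaces.\<close>

locale function_space =
  fixes X :: "cfun set"
  assumes L2: "X \<subseteq> L2" and lincomb: "f \<in> X \<Longrightarrow> g \<in> X \<Longrightarrow> (\<lambda>z. c * f z + d * g z) \<in> X"
begin

text \<open>The difference f - g has norm 0, so the functional vanishes at it. This is what allows
  composition with operators that are linear only a.e.\<close>

lemma bounded_functional_cong:
  assumes \<Phi>: "bounded_functional X \<Phi>" and fg: "f \<in> X" "g \<in> X" "AE z in circle. f z = g z"
  shows "\<Phi> f = \<Phi> g"
proof -
  obtain C where C: "\<And>f. f \<in> X \<Longrightarrow> norm (\<Phi> f) \<le> C * l2norm f"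
    using \<Phi> unfolding bounded_functional_def by blast
  let ?d = "\<lambda>z. 1 * f z + (-1) * g z"
  have d: "?d \<in> X"
    by (intro lincomb fg)
  have "l2norm ?d = l2norm (\<lambda>z. 0)"
    by (rule l2norm_cong_AE) (use fg(3) d L2 in \<open>auto intro: L2_measurable\<close>)
  then have "l2norm ?d = 0"
    by (simp add: l2norm_def)
  then have "\<Phi> ?d = 0"
    using C[OF d] by simp
  moreover have "\<Phi> ?d = 1 * \<Phi> f + (-1) * \<Phi> g"
    using \<Phi> fg unfolding bounded_functional_def by blast
  ultimately show ?thesis by simp
qed

lemma bounded_functional_compose:
  assumes \<Phi>: "bounded_functional X \<Phi>" and T: "bounded_op Y X T"
    and Y: "\<And>f g c d. f \<in> Y \<Longrightarrow> g \<in> Y \<Longrightarrow> (\<lambda>z. c * f z + d * g z) \<in> Y"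
  shows "bounded_functional Y (\<lambda>f. \<Phi> (T f))"
  unfolding bounded_functional_def
proof (intro conjI ballI allI)
  obtain C where C: "\<And>f. f \<in> X \<Longrightarrow> norm (\<Phi> f) \<le> C * l2norm f"
    using \<Phi> unfolding bounded_functional_def by blast
  obtain D where D: "\<And>f. f \<in> Y \<Longrightarrow> l2norm (T f) \<le> D * l2norm f"
    by (rule bounded_op_bound[OF T]) blast
  \<comment> \<open>Nothing fixes the sign of C, so its absolute value enters before the estimate
    for T is inserted.\<close>
  have "norm (\<Phi> (T f)) \<le> (\<bar>C\<bar> * D) * l2norm f" if f: "f \<in> Y" for f
  proof -
    have "norm (\<Phi> (T f)) \<le> C * l2norm (T f)"
      by (rule C[OF bounded_opD(1)[OF T f]])
    also have "\<dots> \<le> \<bar>C\<bar> * l2norm (T f)"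
      by (intro mult_right_mono) auto
    also have "\<dots> \<le> \<bar>C\<bar> * (D * l2norm f)"
      by (intro mult_left_mono D f) auto
    finally show ?thesis by (simp add: mult.assoc)
  qed
  then show "\<exists>C. \<forall>f\<in>Y. norm (\<Phi> (T f)) \<le> C * l2norm f"
    by blast
  fix f g c d assume fg: "f \<in> Y" "g \<in> Y"
  have cd: "(\<lambda>z. c * f z + d * g z) \<in> Y"
    by (rule Y[OF fg])
  have "\<Phi> (T (\<lambda>z. c * f z + d * g z)) = \<Phi> (\<lambda>z. c * T f z + d * T g z)"
    by (rule bounded_functional_cong[OF \<Phi> bounded_opD(1)[OF T cd] lincomb bounded_opD(2)[OF T fg]])
      (intro bounded_opD(1)[OF T] fg)+
  also have "\<dots> = c * \<Phi> (T f) + d * \<Phi> (T g)"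
    using \<Phi> bounded_opD(1)[OF T] fg unfolding bounded_functional_def by blast
  finally show "\<Phi> (T (\<lambda>z. c * f z + d * g z)) = c * \<Phi> (T f) + d * \<Phi> (T g)" .
qed

end

context inner_boundary
begin

sublocale model: function_space "model_space \<alpha>"
  by unfold_locales (auto intro: model_L2 model_lincomb)

lemma bounded_op_proj: "bounded_op L2 (model_space \<alpha>) (proj (model_space \<alpha>))"
  unfolding bounded_op_def
proof (intro conjI ballI allI exI)
  show "l2norm (proj (model_space \<alpha>) f) \<le> 1 * l2norm f" if "f \<in> L2" for f
    using proj_norm_le[OF that] by simp
qed (intro proj_model(1) proj_lincomb; assumption)+

text \<open>Precomposed with the projection, the functional lives on L2 and only has to vanish at
  powers of z, whose projections are bounded functions.\<close>

lemma bounded_functional_eq_zero_model: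
  assumes \<Phi>: "bounded_functional (model_space \<alpha>) \<Phi>"
    and zero: "\<And>f. f \<in> model_space_inf \<alpha> \<Longrightarrow> \<Phi> f = 0"
    and f: "f \<in> model_space \<alpha>"
  shows "\<Phi> f = 0"
proof -
  have "bounded_functional L2 (\<lambda>f. \<Phi> (proj (model_space \<alpha>) f))"
    by (rule model.bounded_functional_compose[OF \<Phi> bounded_op_proj L2_lincomb])
  then obtain C where lin: "\<And>f g c d. f \<in> L2 \<Longrightarrow> g \<in> L2 \<Longrightarrow> \<Phi> (proj (model_space \<alpha>) (\<lambda>z. c * f z + d * g z)) =
      c * \<Phi> (proj (model_space \<alpha>) f) + d * \<Phi> (proj (model_space \<alpha>) g)"
    and bound: "\<And>f. f \<in> L2 \<Longrightarrow> norm (\<Phi> (proj (model_space \<alpha>) f)) \<le> C * l2norm f"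
    unfolding bounded_functional_def by blast
  have "\<Phi> (proj (model_space \<alpha>) f) = 0"
    by (rule bounded_functional_eq_zero[where \<Lambda> = "\<lambda>f. \<Phi> (proj (model_space \<alpha>) f)", OF lin bound])
      (auto intro: zero proj_power_model_inf model_L2 f)
  moreover have "\<Phi> (proj (model_space \<alpha>) f) = \<Phi> f"
    by (rule model.bounded_functional_cong[OF \<Phi> proj_model(1)[OF model_L2[OF f]] f proj_id[OF f]])
  ultimately show ?thesis by simp
qed

text \<open>The m-fold adjoint discards the first m coefficients. Both the contraction property and
  the convergence of the powers to 0 are read off from this identity.\<close>

lemma l2norm_comp_shift_adj_power:
  assumes f: "f \<in> model_space \<alpha>"
  shows "(l2norm ((comp_shift_adj \<alpha> ^^ m) f))\<^sup>2 = (l2norm f)\<^sup>2 - (\<Sum>i<m. (norm (fcoef f (int i)))\<^sup>2)"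
proof -
  let ?g = "(comp_shift_adj \<alpha> ^^ m) f"
  have g: "?g \<in> model_space \<alpha>" by (rule comp_shift_adj_power_model[OF f])
  have s: "(\<lambda>n. (norm (fcoef f (int n)))\<^sup>2) sums (l2norm f)\<^sup>2"
    by (rule Parseval_norm_nat[OF model_L2[OF f] fcoef_model_neg[OF f]])
  have "(\<lambda>n. (norm (fcoef ?g (int n)))\<^sup>2) sums (l2norm ?g)\<^sup>2"
    by (rule Parseval_norm_nat[OF model_L2[OF g] fcoef_model_neg[OF g]])
  then have t: "(\<lambda>n. (norm (fcoef f (int (n + m))))\<^sup>2) sums (l2norm ?g)\<^sup>2"
    by (simp add: fcoef_comp_shift_adj_power[OF f])
  show ?thesis
    using suminf_split_initial_segment[OF sums_summable[OF s], of m] sums_unique[OF s] sums_unique[OF t]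
    by simp
qed

lemma l2norm_comp_shift_adj_power_le:
  assumes f: "f \<in> model_space \<alpha>"
  shows "l2norm ((comp_shift_adj \<alpha> ^^ m) f) \<le> l2norm f"
  by (rule power2_le_imp_le) (simp_all add: l2norm_comp_shift_adj_power[OF f] sum_nonneg)

lemma comp_shift_adj_power_tendsto_0:
  assumes f: "f \<in> model_space \<alpha>"
  shows "(\<lambda>m. l2norm ((comp_shift_adj \<alpha> ^^ m) f)) \<longlonglongrightarrow> 0"
proof -
  have s: "(\<lambda>n. (norm (fcoef f (int n)))\<^sup>2) sums (l2norm f)\<^sup>2"
    by (rule Parseval_norm_nat[OF model_L2[OF f] fcoef_model_neg[OF f]])
  have "(\<lambda>m. (l2norm f)\<^sup>2 - (\<Sum>i<m. (norm (fcoef f (int i)))\<^sup>2)) \<longlonglongrightarrow> (l2norm f)\<^sup>2 - (l2norm f)\<^sup>2"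
    using s unfolding sums_def by (intro tendsto_intros)
  then have "(\<lambda>m. (l2norm ((comp_shift_adj \<alpha> ^^ m) f))\<^sup>2) \<longlonglongrightarrow> 0"
    by (simp add: l2norm_comp_shift_adj_power[OF f])
  from tendsto_real_sqrt[OF this] show ?thesis by simp
qed

lemma bounded_op_comp_shift_adj_power:
  "bounded_op (model_space \<alpha>) (model_space \<alpha>) (comp_shift_adj \<alpha> ^^ m)"
  unfolding bounded_op_def
proof (intro conjI ballI allI exI)
  show "(comp_shift_adj \<alpha> ^^ m) f \<in> model_space \<alpha>" if "f \<in> model_space \<alpha>" for f
    by (rule comp_shift_adj_power_model[OF that])
  show "l2norm ((comp_shift_adj \<alpha> ^^ m) f) \<le> 1 * l2norm f" if "f \<in> model_space \<alpha>" for f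
    using l2norm_comp_shift_adj_power_le[OF that] by simp
  fix f g c d assume fg: "f \<in> model_space \<alpha>" "g \<in> model_space \<alpha>"
  show "AE z in circle. (comp_shift_adj \<alpha> ^^ m) (\<lambda>z. c * f z + d * g z) z =
      c * (comp_shift_adj \<alpha> ^^ m) f z + d * (comp_shift_adj \<alpha> ^^ m) g z"
    by (rule fcoef_eq_imp_AE_eq)
      (simp_all add: L2_integrable L2_lincomb model_L2 comp_shift_adj_power_model fg model_lincomb
        fcoef_lincomb fcoef_comp_shift_adj_power)
qed

text \<open>The m-fold backward shift and multiplication by z^(-m) differ only in negative
  frequencies, which are orthogonal to \<open>H2\<close>. It serves to move the shifts of f onto
  \<xi> and those of g onto the \<psi>_j.\<close>

lemma ip_comp_shift_adj_power:
  assumes f: "f \<in> model_space \<alpha>" and h: "h \<in> H2"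
  shows "ip ((comp_shift_adj \<alpha> ^^ m) f) h = ip f (\<lambda>z. z powi int m * h z)"
proof -
  let ?g = "(comp_shift_adj \<alpha> ^^ m) f" and ?s = "\<lambda>z. z powi (- int m) * f z"
  have g: "?g \<in> L2" by (rule model_L2[OF comp_shift_adj_power_model[OF f]])
  have s: "?s \<in> L2" by (rule L2_mult_power_int[OF model_L2[OF f]])
  have hL2: "h \<in> L2" by (rule H2_L2[OF h])
  have "ip (\<lambda>z. ?s z - ?g z) h = 0"
  proof (rule ip_eq_0_disjoint)
    show "fcoef (\<lambda>z. ?s z - ?g z) n = 0 \<or> fcoef h n = 0" for n
      using h by (cases "n \<ge> 0")
        (simp_all add: H2_iff fcoef_diff L2_integrable g s fcoef_mult_power_int L2_measurable model_L2 f
          fcoef_comp_shift_adj_power)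
  qed (intro L2_diff s g hL2)+
  then have "ip ?s h = ip ?g h"
    by (simp add: ip_diff_left s g hL2)
  moreover have "ip ?s h = ip f (\<lambda>z. z powi int m * h z)"
    unfolding ip_def
    by (rule Bochner_Integration.integral_cong)
      (auto simp: cnj_power_int_circle simp del: complex_cnj_power_int power_int_of_nat)
  ultimately show ?thesis by simp
qed

end

subsection \<open>The operator \<open>W k\<close>\<close>

text \<open>Keeping every k-th coefficient does not increase the square sum, so Riesz-Fischer
  supplies a contraction. That its values are mere choices is harmless, as linearity is required
  only a.e.\<close>

lemma W_exists:
  assumes "k \<ge> 1"
  shows "\<exists>T. bounded_op L2 L2 T \<and>
     (\<forall>n::int. AE z in circle. T (\<lambda>z. z powi n) z = (if int k dvd n then z powi (n div int k) else 0))"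
proof -
  have inj: "inj (\<lambda>n::int. int k * n)"
    using assms by (auto simp: inj_def)
  have "\<exists>g. g \<in> L2 \<and> (\<forall>n. fcoef g n = fcoef h (int k * n)) \<and> l2norm g \<le> l2norm h" if h: "h \<in> L2" for h
  proof -
    let ?s = "\<lambda>n. (norm (fcoef h n))\<^sup>2"
    have s: "?s summable_on range (\<lambda>n. int k * n)"
      by (rule summable_on_subset_banach[OF Bessel(1)[OF h]]) simp
    have s': "(\<lambda>n. (norm (fcoef h (int k * n)))\<^sup>2) summable_on UNIV"
      using s by (subst (asm) summable_on_reindex[OF inj]) (simp add: o_def)
    have "infsum ?s (range (\<lambda>n. int k * n)) = infsum (\<lambda>n. (norm (fcoef h (int k * n)))\<^sup>2) UNIV"
      by (subst infsum_reindex[OF inj]) (simp add: o_def)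
    moreover have "infsum ?s (range (\<lambda>n. int k * n)) \<le> infsum ?s UNIV"
      by (rule infsum_mono2[OF s Bessel(1)[OF h]]) auto
    moreover obtain g where g: "g \<in> L2" "\<And>n. fcoef g n = fcoef h (int k * n)"
      "(l2norm g)\<^sup>2 \<le> infsum (\<lambda>n. (norm (fcoef h (int k * n)))\<^sup>2) UNIV"
      by (rule Riesz_Fischer[OF s']) blast
    ultimately have "(l2norm g)\<^sup>2 \<le> (l2norm h)\<^sup>2"
      using Bessel(2)[OF h] by linarith
    then show ?thesis
      using g power2_le_imp_le[OF _ l2norm_nonneg] by blast
  qed
  then obtain T where T: "\<And>h. h \<in> L2 \<Longrightarrow> T h \<in> L2" "\<And>h n. h \<in> L2 \<Longrightarrow> fcoef (T h) n = fcoef h (int k * n)"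
    "\<And>h. h \<in> L2 \<Longrightarrow> l2norm (T h) \<le> l2norm h"
    by metis
  have "bounded_op L2 L2 T"
    unfolding bounded_op_def
  proof (intro conjI ballI allI exI)
    show "l2norm (T f) \<le> 1 * l2norm f" if "f \<in> L2" for f
      using T(3)[OF that] by simp
    fix f g c d assume fg: "f \<in> L2" "g \<in> L2"
    show "AE z in circle. T (\<lambda>z. c * f z + d * g z) z = c * T f z + d * T g z"
      by (rule fcoef_eq_imp_AE_eq) (simp_all add: L2_integrable L2_lincomb T fg fcoef_lincomb)
  qed (rule T(1))
  moreover have "AE z in circle. T (\<lambda>z. z powi n) z = (if int k dvd n then z powi (n div int k) else 0)" for n
  proof (rule fcoef_eq_imp_AE_eq)
    show "integrable circle (T (\<lambda>z. z powi n))"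
      by (intro L2_integrable T(1) L2_power_int)
    show "integrable circle (\<lambda>z. if int k dvd n then z powi (n div int k) else 0)"
      by (cases "int k dvd n") (auto intro: L2_integrable L2_power_int)
    have z: "fcoef (\<lambda>z. 0) m = 0" for m by (simp add: fcoef_def)
    show "fcoef (T (\<lambda>z. z powi n)) m = fcoef (\<lambda>z. if int k dvd n then z powi (n div int k) else 0) m" for m
      using assms by (cases "int k dvd n") (auto simp: T(2) L2_power_int fcoef_power_int z)
  qed
  ultimately show ?thesis by blast
qed

text \<open>\<open>W k\<close> is specified on powers of z alone. The difference of the two sides is
  a bounded functional of f that vanishes there, hence everywhere.\<close>

lemma W_L2: "k \<ge> 1 \<Longrightarrow> f \<in> L2 \<Longrightarrow> W k f \<in> L2"
  and fcoef_W: "k \<ge> 1 \<Longrightarrow> f \<in> L2 \<Longrightarrow> fcoef (W k f) n = fcoef f (int k * n)"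
proof -
  assume k: "k \<ge> 1" and f: "f \<in> L2"
  from someI_ex[OF W_exists[OF k]] have W: "bounded_op L2 L2 (W k)"
    "\<And>n. AE z in circle. W k (\<lambda>z. z powi n) z = (if int k dvd n then z powi (n div int k) else 0)"
    by (auto simp: W_def)
  show "W k f \<in> L2" by (rule bounded_opD(1)[OF W(1) f])
  interpret L2: function_space L2
    by unfold_locales (auto intro: L2_lincomb)
  have "bounded_functional L2 (\<lambda>f. fcoef (W k f) n - fcoef f (int k * n))"
    by (intro bounded_functional_diff bounded_functional_fcoef L2.bounded_functional_compose[OF _ W(1) L2_lincomb] order_refl)
  then obtain C where lin: "\<And>f g c d. f \<in> L2 \<Longrightarrow> g \<in> L2 \<Longrightarrow>
      fcoef (W k (\<lambda>z. c * f z + d * g z)) n - fcoef (\<lambda>z. c * f z + d * g z) (int k * n) =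
      c * (fcoef (W k f) n - fcoef f (int k * n)) + d * (fcoef (W k g) n - fcoef g (int k * n))"
    and bound: "\<And>f. f \<in> L2 \<Longrightarrow> norm (fcoef (W k f) n - fcoef f (int k * n)) \<le> C * l2norm f"
    unfolding bounded_functional_def by blast
  have "fcoef (W k f) n - fcoef f (int k * n) = 0"
  proof (rule bounded_functional_eq_zero[where \<Lambda> = "\<lambda>f. fcoef (W k f) n - fcoef f (int k * n)", OF lin bound _ f])
    fix m
    have z: "fcoef (\<lambda>z. 0) n = 0" by (simp add: fcoef_def)
    have "fcoef (W k (\<lambda>z. z powi m)) n = fcoef (\<lambda>z. if int k dvd m then z powi (m div int k) else 0) n"
    proof (rule fcoef_cong_AE[OF W(2)])
      show "W k (\<lambda>z. z powi m) \<in> borel_measurable circle"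
        by (intro L2_measurable bounded_opD(1)[OF W(1)] L2_power_int)
      show "(\<lambda>z. if int k dvd m then z powi (m div int k) else 0) \<in> borel_measurable circle"
        by (cases "int k dvd m") auto
    qed
    then show "fcoef (W k (\<lambda>z. z powi m)) n - fcoef (\<lambda>z. z powi m) (int k * n) = 0"
      using k by (cases "int k dvd m") (auto simp: fcoef_power_int z)
  qed
  then show "fcoef (W k f) n = fcoef f (int k * n)" by simp
qed

subsection \<open>Interaction of \<open>W k\<close> with multiplication\<close>

text \<open>The function s plays the role of \<psi>(z^k). Built from its coefficients, it can be
  handled by divisibility of indices alone.\<close>

lemma spread_exists:
  assumes k: "k \<ge> 1" and \<psi>: "\<psi> \<in> L2"
  obtains s where "s \<in> L2" "\<And>n. fcoef s n = (if int k dvd n then fcoef \<psi> (n div int k) else 0)"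
proof -
  let ?c = "\<lambda>n. if int k dvd n then fcoef \<psi> (n div int k) else 0"
  have inj: "inj (\<lambda>n::int. int k * n)"
    using k by (auto simp: inj_def)
  have "(\<lambda>n. (norm (?c n))\<^sup>2) summable_on range (\<lambda>n. int k * n)"
    using k Bessel(1)[OF \<psi>] by (subst summable_on_reindex[OF inj]) (simp add: o_def)
  then have "(\<lambda>n. (norm (?c n))\<^sup>2) summable_on UNIV"
    by (rule summable_on_cong_neutral[THEN iffD1, rotated -1]) (auto simp: dvd_def)
  then show thesis
    by (rule Riesz_Fischer) (rule that)
qed

text \<open>In the convolution for the index k n only indices divisible by k contribute, and there
  it is the convolution of the coefficients of \<open>W k F\<close> and \<psi>. The product on the
  right need only be integrable, so the two sides are compared by coefficients.\<close>

lemma W_mult_spread: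
  assumes k: "k \<ge> 1" and F: "F \<in> L2" and \<psi>: "\<psi> \<in> L2"
    and s: "s \<in> L2" "\<And>n. fcoef s n = (if int k dvd n then fcoef \<psi> (n div int k) else 0)"
    and Fs: "(\<lambda>z. F z * s z) \<in> L2"
  shows "AE z in circle. W k (\<lambda>z. F z * s z) z = W k F z * \<psi> z"
proof (rule fcoef_eq_imp_AE_eq)
  show "integrable circle (W k (\<lambda>z. F z * s z))"
    by (intro L2_integrable W_L2 k Fs)
  show "integrable circle (\<lambda>z. W k F z * \<psi> z)"
    by (intro L2_mult_integrable W_L2 k F \<psi>)
  fix n
  have inj: "inj (\<lambda>n::int. int k * n)"
    using k by (auto simp: inj_def)
  have "((\<lambda>m. fcoef F m * fcoef s (int k * n - m)) has_sum fcoef (\<lambda>z. F z * s z) (int k * n)) UNIV"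
    by (rule fcoef_mult[OF F s(1)])
  then have "((\<lambda>m. fcoef F m * fcoef s (int k * n - m)) has_sum fcoef (\<lambda>z. F z * s z) (int k * n))
      (range (\<lambda>l. int k * l))"
  proof (rule has_sum_cong_neutral[THEN iffD1, rotated -1])
    fix m assume "m \<in> UNIV - range (\<lambda>l. int k * l)"
    then have "\<not> int k dvd m" by (auto simp: dvd_def)
    then have "\<not> int k dvd int k * n - m"
      by (simp add: dvd_diff_right_iff)
    then show "fcoef F m * fcoef s (int k * n - m) = 0"
      by (simp add: s(2))
  qed auto
  then have 1: "((\<lambda>l. fcoef F (int k * l) * fcoef s (int k * n - int k * l)) has_sum fcoef (\<lambda>z. F z * s z) (int k * n)) UNIV"
    by (subst (asm) has_sum_reindex[OF inj]) (simp add: o_def)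
  have "fcoef s (int k * n - int k * l) = fcoef \<psi> (n - l)" for l
    using k by (simp add: s(2) flip: right_diff_distrib)
  then have "((\<lambda>l. fcoef (W k F) l * fcoef \<psi> (n - l)) has_sum fcoef (\<lambda>z. F z * s z) (int k * n)) UNIV"
    using 1 by (simp add: fcoef_W[OF k F])
  moreover have "((\<lambda>l. fcoef (W k F) l * fcoef \<psi> (n - l)) has_sum fcoef (\<lambda>z. W k F z * \<psi> z) n) UNIV"
    by (rule fcoef_mult[OF W_L2[OF k F] \<psi>])
  ultimately show "fcoef (W k (\<lambda>z. F z * s z)) n = fcoef (\<lambda>z. W k F z * \<psi> z) n"
    unfolding fcoef_W[OF k Fs] by (rule has_sum_unique)
qed

lemma Hinf_mult_L2:
  assumes "f \<in> Hinf" "\<phi> \<in> L2"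
  shows "(\<lambda>z. \<phi> z * f z) \<in> L2"
proof -
  obtain C where "AE z in circle. norm (f z) \<le> C"
    using Hinf_bounded[OF assms(1)] by blast
  then have "(\<lambda>z. f z * \<phi> z) \<in> L2"
    by (rule L2_mult_bounded[OF assms(2) L2_measurable[OF H2_L2[OF Hinf_H2[OF assms(1)]]]])
  then show ?thesis by (simp add: mult.commute)
qed

text \<open>Dividing f by z^j before applying \<open>W k\<close> extracts the coefficients f_(k i +
  j), and the factor \<psi> is then moved across the inner product. Boundedness of f keeps the
  argument of \<open>W k\<close> in L2; boundedness of g does the same for conj(\<psi>) g.\<close>

lemma ip_W_spread_sums:
  assumes k: "k \<ge> 1" and j: "j < k" and \<psi>: "\<psi> \<in> L2"
    and s: "s \<in> L2" "\<And>n. fcoef s n = (if int k dvd n then fcoef \<psi> (n div int k) else 0)"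
    and f: "f \<in> Hinf" and g: "g \<in> Hinf"
  shows "(\<lambda>i. fcoef f (int (k * i + j)) * ip (\<lambda>z. z powi int i * \<psi> z) g) sums
    ip (W k (\<lambda>z. (z powi (- int j) * s z) * f z)) g"
proof -
  have fL2: "f \<in> L2" and gL2: "g \<in> L2" and fneg: "\<And>n. n < 0 \<Longrightarrow> fcoef f n = 0"
    using Hinf_H2[OF f] Hinf_H2[OF g] by (auto simp: H2_iff)
  define F where "F = (\<lambda>z. z powi (- int j) * f z)"
  have F: "F \<in> L2"
    unfolding F_def by (rule L2_mult_power_int[OF fL2])
  have Fs_eq: "(\<lambda>z. F z * s z) = (\<lambda>z. (z powi (- int j) * s z) * f z)"
    by (simp add: F_def mult_ac)
  have Fs: "(\<lambda>z. F z * s z) \<in> L2"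
    unfolding Fs_eq by (intro Hinf_mult_L2 f L2_mult_power_int s(1))
  have WF: "W k F \<in> L2"
    by (rule W_L2[OF k F])
  have fW: "fcoef (W k F) i = fcoef f (int k * i + int j)" for i
    unfolding fcoef_W[OF k F] by (simp add: F_def fcoef_mult_power_int L2_measurable fL2)
  \<comment> \<open>Here j < k enters: for i < 0 the index k i + j is at most j - k, hence negative,
    and \<open>W k F\<close> is analytic.\<close>
  have WFneg: "fcoef (W k F) i = 0" if "i < 0" for i
  proof -
    have "int k * i \<le> int k * (-1)"
      using that by (intro mult_left_mono) auto
    then have "int k * i + int j < 0" using j by linarith
    then show ?thesis by (simp add: fW fneg)
  qed
  define h where "h = (\<lambda>z. cnj (\<psi> z) * g z)"
  have h: "h \<in> L2"
    unfolding h_def by (rule Hinf_mult_L2[OF g L2_cnj[OF \<psi>]])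
  have "ip (W k (\<lambda>z. F z * s z)) g = ip (W k F) h"
    unfolding ip_def
  proof (rule integral_cong_AE)
    show "AE z in circle. W k (\<lambda>z. F z * s z) z * cnj (g z) = W k F z * cnj (h z)"
      using W_mult_spread[OF k F \<psi> s Fs] by eventually_elim (simp add: h_def)
    show "(\<lambda>z. W k (\<lambda>z. F z * s z) z * cnj (g z)) \<in> borel_measurable circle"
      by (intro borel_measurable_integrable ip_integrable W_L2 k Fs gL2)
    show "(\<lambda>z. W k F z * cnj (h z)) \<in> borel_measurable circle"
      by (intro borel_measurable_integrable ip_integrable WF h)
  qed
  moreover have "(\<lambda>i. fcoef (W k F) (int i) * cnj (fcoef h (int i))) sums ip (W k F) h"
  proof -
    have "(\<lambda>i. cnj (fcoef h (int i) * cnj (fcoef (W k F) (int i)))) sums cnj (ip h (W k F))"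
      by (subst sums_cnj) (rule Parseval_nat[OF h WF WFneg])
    then show ?thesis
      by (simp add: mult.commute flip: ip_commute)
  qed
  moreover have "cnj (fcoef h (int i)) = ip (\<lambda>z. z powi int i * \<psi> z) g" for i
  proof -
    have "cnj (fcoef h (int i)) = ip (\<lambda>z. z powi int i) h"
      by (simp only: fcoef_eq_ip ip_commute[symmetric])
    also have "\<dots> = ip (\<lambda>z. z powi int i * \<psi> z) g"
      by (simp add: ip_def h_def mult.assoc)
    finally show ?thesis .
  qed
  ultimately show ?thesis
    by (simp add: fW Fs_eq)
qed

subsection \<open>The characterization\<close>

locale operator_between_models =
  A: inner_boundary \<alpha> a + B: inner_boundary \<beta> b for \<alpha> a \<beta> b +
  fixes k :: nat and U :: "cfun \<Rightarrow> cfun"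
  assumes k: "k \<ge> 1" and U: "bounded_op (model_space \<alpha>) (model_space \<beta>) U"
begin

abbreviation "SA \<equiv> comp_shift_adj \<alpha>"
abbreviation "SB \<equiv> comp_shift_adj \<beta>"

text \<open>The identity to be characterized, at \<open>f\<close> and tested against \<open>g\<close>.\<close>

definition displacement :: "cfun \<Rightarrow> (nat \<Rightarrow> cfun) \<Rightarrow> cfun \<Rightarrow> cfun \<Rightarrow> bool" where
  "displacement \<xi> \<psi> f g \<longleftrightarrow> ip (U f) g - ip (U ((SA ^^ k) f)) (SB g) =
     cnj (fcoef g 0) * ip f \<xi> + (\<Sum>j<k. fact j * fcoef f (int j) * ip (\<psi> j) g)"

lemma U_model: "f \<in> model_space \<alpha> \<Longrightarrow> U f \<in> model_space \<beta>"
  by (rule bounded_opD(1)[OF U])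

text \<open>Both sides of the operator identity lie in the model space of \<beta>, so testing
  against its elements g loses nothing. Testing moves the compressed shift onto g as its adjoint and
  evaluates the kernels as coefficients.\<close>

lemma displacement_iff:
  assumes \<xi>: "\<xi> \<in> model_space \<alpha>" and \<psi>: "\<And>j. j < k \<Longrightarrow> \<psi> j \<in> model_space \<beta>"
    and f: "f \<in> model_space \<alpha>"
  shows "(AE z in circle. U f z - comp_shift \<beta> (U ((SA ^^ k) f)) z =
       tensor (ker0 \<beta> 0) \<xi> f z + (\<Sum>j<k. tensor (\<psi> j) (ker0 \<alpha> j) f z))
    \<longleftrightarrow> (\<forall>g\<in>model_space \<beta>. displacement \<xi> \<psi> f g)"
proof -
  let ?L = "\<lambda>z. U f z - comp_shift \<beta> (U ((SA ^^ k) f)) z"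
  let ?S = "\<lambda>z. \<Sum>j<k. tensor (\<psi> j) (ker0 \<alpha> j) f z"
  let ?R = "\<lambda>z. tensor (ker0 \<beta> 0) \<xi> f z + ?S z"
  have f': "(SA ^^ k) f \<in> model_space \<alpha>"
    by (rule A.comp_shift_adj_power_model[OF f])
  have sh: "comp_shift \<beta> (U ((SA ^^ k) f)) \<in> model_space \<beta>"
    by (rule B.comp_shift_model(1)[OF U_model[OF f']])
  have L: "?L \<in> model_space \<beta>"
    by (intro B.model_diff U_model f sh)
  have t0: "tensor (ker0 \<beta> 0) \<xi> f \<in> model_space \<beta>"
    unfolding tensor_def by (intro B.model_cmult B.ker0_model)
  have tj: "tensor (\<psi> j) (ker0 \<alpha> j) f \<in> model_space \<beta>" if "j < k" for j
    unfolding tensor_def by (intro B.model_cmult \<psi> that)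
  have zero: "(\<lambda>z. 0) \<in> model_space \<beta>"
    using B.model_cmult[OF B.ker0_model, of 0] by simp
  have S: "(\<lambda>z. \<Sum>j<m. tensor (\<psi> j) (ker0 \<alpha> j) f z) \<in> model_space \<beta>" if "m \<le> k" for m
    using that
  proof (induction m)
    case (Suc m)
    then show ?case
      using B.model_lincomb[OF Suc.IH tj[of m], of 1 1] by simp
  qed (simp add: zero)
  have R: "?R \<in> model_space \<beta>"
    using B.model_lincomb[OF t0 S[OF order_refl], of 1 1] by simp
  have ipL: "ip ?L g = ip (U f) g - ip (U ((SA ^^ k) f)) (SB g)" if g: "g \<in> model_space \<beta>" for g
    by (simp add: ip_diff_left B.model_L2 U_model f sh g B.ip_comp_shift f')
  have ipR: "ip ?R g = cnj (fcoef g 0) * ip f \<xi> + (\<Sum>j<k. fact j * fcoef f (int j) * ip (\<psi> j) g)"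
    if g: "g \<in> model_space \<beta>" for g
  proof -
    have "ip ?R g = ip (tensor (ker0 \<beta> 0) \<xi> f) g + (\<Sum>j<k. ip (tensor (\<psi> j) (ker0 \<alpha> j) f) g)"
      by (subst ip_add_left[OF B.model_L2[OF t0] B.model_L2[OF S[OF order_refl]] B.model_L2[OF g]],
          subst ip_sum_left) (auto intro: B.model_L2 tj g)
    also have "\<dots> = cnj (fcoef g 0) * ip f \<xi> + (\<Sum>j<k. fact j * fcoef f (int j) * ip (\<psi> j) g)"
      unfolding tensor_def ip_cmult_left B.ip_ker0_left[OF g] A.ip_ker0[OF f] by simp
    finally show ?thesis .
  qed
  show ?thesis
  proof
    assume AE: "AE z in circle. ?L z = ?R z"
    show "\<forall>g\<in>model_space \<beta>. displacement \<xi> \<psi> f g"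
    proof
      fix g assume g: "g \<in> model_space \<beta>"
      have "ip ?L g = ip ?R g"
        by (rule ip_cong_AE[OF AE]) (auto intro: B.model_L2 L R g)
      then show "displacement \<xi> \<psi> f g"
        by (simp only: displacement_def ipL[OF g] ipR[OF g])
    qed
  next
    assume D: "\<forall>g\<in>model_space \<beta>. displacement \<xi> \<psi> f g"
    show "AE z in circle. ?L z = ?R z"
      by (rule B.model_eqI[OF L R]) (use D in \<open>simp only: displacement_def ipL ipR\<close>)
  qed
qed

text \<open>For fixed g the two sides of the identity differ by a bounded functional of f, to which
  density of the bounded functions applies.\<close>

lemma displacement_dense:
  assumes \<xi>: "\<xi> \<in> model_space \<alpha>" and g: "g \<in> model_space \<beta>"
    and D: "\<And>f. f \<in> model_space_inf \<alpha> \<Longrightarrow> displacement \<xi> \<psi> f g"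
    and f: "f \<in> model_space \<alpha>"
  shows "displacement \<xi> \<psi> f g"
proof -
  let ?\<Phi> = "\<lambda>f. (ip (U f) g - ip (U ((SA ^^ k) f)) (SB g)) -
     (cnj (fcoef g 0) * ip f \<xi> + (\<Sum>j<k. (fact j * ip (\<psi> j) g) * fcoef f (int j)))"
  have 1: "bounded_functional (model_space \<alpha>) (\<lambda>f. ip (U f) h)" if "h \<in> model_space \<beta>" for h
    by (rule B.model.bounded_functional_compose[OF bounded_functional_ip[OF B.model.L2 B.model_L2[OF that]] U A.model_lincomb])
  have "bounded_functional (model_space \<alpha>) ?\<Phi>"
    by (intro bounded_functional_diff bounded_functional_add bounded_functional_sum
        bounded_functional_cmult bounded_functional_fcoef bounded_functional_ip A.model.L2 A.model_L2 \<xi>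
        1[OF g] A.model.bounded_functional_compose[OF 1[OF B.comp_shift_adj_model(1)[OF g]]
          A.bounded_op_comp_shift_adj_power A.model_lincomb])
  moreover have "?\<Phi> f = 0" if "f \<in> model_space_inf \<alpha>" for f
    using D[OF that] unfolding displacement_def by (simp add: mult_ac)
  ultimately have "?\<Phi> f = 0"
    by (rule A.bounded_functional_eq_zero_model[OF _ _ f])
  then show ?thesis
    unfolding displacement_def by (simp add: mult_ac)
qed

section \<open>From the symbol to the displacement identity\<close>

lemma model_inf_mult_L2: "f \<in> model_space_inf \<gamma> \<Longrightarrow> \<phi> \<in> L2 \<Longrightarrow> (\<lambda>z. \<phi> z * f z) \<in> L2"
  by (rule Hinf_mult_L2) (simp add: model_space_inf_def)

lemma ip_W_displacement:
  assumes \<phi>: "\<phi> \<in> L2" and f: "f \<in> model_space_inf \<alpha>" and g: "g \<in> model_space \<beta>"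
  shows "ip (W k (\<lambda>z. \<phi> z * f z)) g - ip (W k (\<lambda>z. \<phi> z * (SA ^^ k) f z)) (SB g) =
    cnj (fcoef g 0) * fcoef (\<lambda>z. \<phi> z * f z) 0 +
    (\<Sum>j<k. fcoef f (int j) * (ip (W k (\<lambda>z. \<phi> z * z powi int j)) g -
      cnj (fcoef g 0) * fcoef (\<lambda>z. \<phi> z * z powi int j) 0))"
proof -
  let ?f' = "(SA ^^ k) f"
  have fK: "f \<in> model_space \<alpha>" and fL2: "f \<in> L2"
    using f A.model_L2 by (auto simp: model_space_inf_def)
  have f'K: "?f' \<in> model_space \<alpha>" by (rule A.comp_shift_adj_power_model[OF fK])
  have gL2: "g \<in> L2" by (rule B.model_L2[OF g])
  have \<phi>f: "(\<lambda>z. \<phi> z * f z) \<in> L2" by (rule model_inf_mult_L2[OF f \<phi>])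
  have \<phi>f': "(\<lambda>z. \<phi> z * ?f' z) \<in> L2"
    by (rule model_inf_mult_L2[OF A.comp_shift_adj_power_inf[OF f] \<phi>])
  have \<phi>z: "(\<lambda>z. \<phi> z * z powi n) \<in> L2" for n
    using L2_mult_power_int[OF \<phi>, of n] by (simp add: mult.commute)
  \<comment> \<open>The part of f with indices below k, which the k-fold adjoint removes; written
    with \<open>trig\<close>, its coefficients are known.\<close>
  define p where "p = trig (fcoef f) (int ` {..<k})"
  have p: "p = (\<lambda>z. \<Sum>j<k. fcoef f (int j) * z powi int j)"
    unfolding p_def trig_def by (subst sum.reindex) (auto simp: o_def)
  \<comment> \<open>What \<open>W k\<close> makes of \<phi> (f - p), written out termwise because
    \<open>W k\<close> is linear only a.e.\<close>
  define V where "V = (\<lambda>z. W k (\<lambda>z. \<phi> z * f z) z - (\<Sum>j<k. fcoef f (int j) * W k (\<lambda>z. \<phi> z * z powi int j) z))"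
  have S: "(\<lambda>z. \<Sum>j<k. fcoef f (int j) * W k (\<lambda>z. \<phi> z * z powi int j) z) \<in> L2"
    by (intro L2_sum L2_cmult W_L2 k \<phi>z)
  have V: "V \<in> L2"
    unfolding V_def by (intro L2_diff W_L2 k \<phi>f S)
  have sumV: "ip V h = ip (W k (\<lambda>z. \<phi> z * f z)) h - (\<Sum>j<k. fcoef f (int j) * ip (W k (\<lambda>z. \<phi> z * z powi int j)) h)"
    if "h \<in> L2" for h
    unfolding V_def
    by (subst ip_diff_left[OF W_L2[OF k \<phi>f] S that], subst ip_sum_left)
      (auto intro!: L2_cmult W_L2 k \<phi>z that simp: ip_cmult_left simp del: power_int_of_nat)
  have f'_AE: "AE z in circle. ?f' z = z powi (- int k) * (f z - p z)"
  proof (rule fcoef_eq_imp_AE_eq)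
    show "integrable circle ?f'"
      by (rule L2_integrable[OF A.model_L2[OF f'K]])
    have fp: "(\<lambda>z. f z - p z) \<in> L2"
      unfolding p_def by (intro L2_diff fL2 L2_trig)
    then show "integrable circle (\<lambda>z. z powi (- int k) * (f z - p z))"
      by (intro L2_integrable L2_mult_power_int)
    \<comment> \<open>These are the indices -k \<le> n < 0, at which subtracting p cancels the
      coefficients that division by z^k would move below 0.\<close>
    have mem: "n + int k \<in> int ` {..<k} \<longleftrightarrow> n < 0 \<and> n + int k \<ge> 0" for n
      by (auto simp: image_iff intro!: bexI[of _ "nat (n + int k)"])
    show "fcoef ?f' n = fcoef (\<lambda>z. z powi (- int k) * (f z - p z)) n" for n
    proof -
      have "fcoef (\<lambda>z. z powi (- int k) * (f z - p z)) n = fcoef (\<lambda>z. f z - p z) (n + int k)"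
        by (simp only: fcoef_mult_power_int[OF L2_measurable[OF fp]]) simp
      also have "\<dots> = fcoef f (n + int k) - fcoef p (n + int k)"
        unfolding p_def by (intro fcoef_diff L2_integrable fL2 L2_trig)
      also have "\<dots> = fcoef ?f' n"
        using A.fcoef_model_neg[OF fK, of "n + int k"]
        by (simp add: p_def fcoef_trig mem A.fcoef_comp_shift_adj_power[OF fK])
      finally show ?thesis by simp
    qed
  qed
  \<comment> \<open>Division by z^k inside \<open>W k\<close> becomes division by z outside, since k
    n + k = k (n + 1).\<close>
  have W_AE: "AE z in circle. W k (\<lambda>z. \<phi> z * ?f' z) z = z powi (-1) * V z"
  proof (rule fcoef_eq_imp_AE_eq)
    show "integrable circle (W k (\<lambda>z. \<phi> z * ?f' z))"
      by (intro L2_integrable W_L2 k \<phi>f')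
    show "integrable circle (\<lambda>z. z powi (-1) * V z)"
      by (intro L2_integrable L2_mult_power_int V)
    fix n
    let ?q = "\<lambda>z. \<phi> z * f z - (\<Sum>j<k. fcoef f (int j) * (\<phi> z * z powi int j))"
    have q2: "(\<lambda>z. \<Sum>j<k. fcoef f (int j) * (\<phi> z * z powi int j)) \<in> L2"
      by (intro L2_sum L2_cmult \<phi>z)
    have q: "?q \<in> L2"
      by (intro L2_diff \<phi>f q2)
    have "fcoef (W k (\<lambda>z. \<phi> z * ?f' z)) n = fcoef (\<lambda>z. \<phi> z * ?f' z) (int k * n)"
      by (rule fcoef_W[OF k \<phi>f'])
    also have "\<dots> = fcoef (\<lambda>z. z powi (- int k) * ?q z) (int k * n)"
    proof (rule fcoef_cong_AE)
      show "AE z in circle. \<phi> z * ?f' z = z powi (- int k) * ?q z"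
        using f'_AE
      proof eventually_elim
        case (elim z)
        have "\<phi> z * ?f' z = z powi (- int k) * (\<phi> z * f z - \<phi> z * p z)"
          unfolding elim by (simp add: algebra_simps)
        also have "\<phi> z * p z = (\<Sum>j<k. fcoef f (int j) * (\<phi> z * z powi int j))"
          by (simp add: p sum_distrib_left mult_ac)
        finally show ?case .
      qed
    qed (intro L2_measurable \<phi>f' L2_mult_power_int q)+
    also have "\<dots> = fcoef ?q (int k * (n + 1))"
      by (simp only: fcoef_mult_power_int[OF L2_measurable[OF q]]) (simp add: algebra_simps)
    also have "\<dots> = ip (\<lambda>z. \<phi> z * f z) (\<lambda>z. z powi (int k * (n + 1))) -
        (\<Sum>j<k. fcoef f (int j) * ip (\<lambda>z. \<phi> z * z powi int j) (\<lambda>z. z powi (int k * (n + 1))))"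
      unfolding fcoef_eq_ip[of ?q]
      by (subst ip_diff_left[OF \<phi>f q2 L2_power_int], subst ip_sum_left)
        (auto intro!: L2_cmult \<phi>z L2_power_int simp: ip_cmult_left simp del: power_int_of_nat)
    also have "\<dots> = fcoef V (n + 1)"
      unfolding fcoef_eq_ip[of V] sumV[OF L2_power_int]
      by (simp only: fcoef_eq_ip[symmetric] fcoef_W[OF k \<phi>f] fcoef_W[OF k \<phi>z])
    also have "\<dots> = fcoef (\<lambda>z. z powi (-1) * V z) n"
      by (simp only: fcoef_mult_power_int[OF L2_measurable[OF V]]) simp
    finally show "fcoef (W k (\<lambda>z. \<phi> z * ?f' z)) n = fcoef (\<lambda>z. z powi (-1) * V z) n" .
  qed
  have "ip (W k (\<lambda>z. \<phi> z * ?f' z)) (SB g) = ip (\<lambda>z. z powi (-1) * V z) (bshift g)"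
  proof (rule ip_cong_AE[OF W_AE])
    show "AE z in circle. SB g z = bshift g z"
      by (rule fcoef_eq_imp_AE_eq)
        (auto intro!: L2_integrable B.model_L2 B.comp_shift_adj_model B.bshift_model g)
  qed (intro W_L2 k \<phi>f' L2_mult_power_int V bshift_L2 gL2 B.model_L2[OF B.comp_shift_adj_model(1)[OF g]])+
  \<comment> \<open>The factors 1/z in both arguments cancel on the circle; the constant subtracted
    from g then produces the coefficient of V at 0.\<close>
  also have "\<dots> = ip V (\<lambda>z. 1 * g z + (- fcoef g 0) * z powi 0)"
    unfolding ip_def bshift_def
  proof (rule Bochner_Integration.integral_cong)
    fix z assume "z \<in> space circle"
    then have z: "norm z = 1" by simp
    have "z powi (-1) * cnj (z powi (-1)) = 1"
      unfolding complex_norm_square[symmetric] by (simp add: norm_inverse z)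
    then have "z powi (-1) * V z * cnj (z powi (-1) * (g z - fcoef g 0)) = V z * cnj (g z - fcoef g 0)"
      by (simp only: complex_cnj_mult mult_ac) (simp only: mult.assoc[symmetric] mult_1_left)
    then show "z powi (-1) * V z * cnj (z powi (-1) * (g z - fcoef g 0)) =
        V z * cnj (1 * g z + (- fcoef g 0) * z powi 0)"
      by simp
  qed simp
  also have "\<dots> = ip V g - cnj (fcoef g 0) * fcoef V 0"
    using ip_lincomb_right[OF gL2 L2_power_int V, of 1 "- fcoef g 0" 0] by (simp add: fcoef_eq_ip)
  finally have "ip (W k (\<lambda>z. \<phi> z * f z)) g - ip (W k (\<lambda>z. \<phi> z * ?f' z)) (SB g) =
      ip (W k (\<lambda>z. \<phi> z * f z)) g - ip V g + cnj (fcoef g 0) * fcoef V 0"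
    by simp
  moreover have "fcoef V 0 = fcoef (\<lambda>z. \<phi> z * f z) 0 - (\<Sum>j<k. fcoef f (int j) * fcoef (\<lambda>z. \<phi> z * z powi int j) 0)"
  proof -
    have "fcoef V 0 = fcoef (W k (\<lambda>z. \<phi> z * f z)) 0 - (\<Sum>j<k. fcoef f (int j) * fcoef (W k (\<lambda>z. \<phi> z * z powi int j)) 0)"
      unfolding fcoef_eq_ip[of _ 0] by (rule sumV[OF L2_power_int])
    then show ?thesis
      by (simp only: fcoef_W[OF k \<phi>f] fcoef_W[OF k \<phi>z] mult_zero_right)
  qed
  ultimately show ?thesis
    by (simp add: sumV[OF gL2] algebra_simps sum_distrib_left sum.distrib sum_subtractf)
qed

lemma necessity:
  assumes "U \<in> S_class k \<alpha> \<beta>"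
  obtains \<xi> \<psi> where "\<xi> \<in> model_space \<alpha>" "\<And>j. j < k \<Longrightarrow> \<psi> j \<in> model_space \<beta>"
    "\<And>f g. f \<in> model_space \<alpha> \<Longrightarrow> g \<in> model_space \<beta> \<Longrightarrow> displacement \<xi> \<psi> f g"
proof -
  obtain \<phi> where \<phi>: "\<phi> \<in> L2" and U\<phi>: "\<And>f. f \<in> model_space_inf \<alpha> \<Longrightarrow> AE z in circle. U f z = U_op k \<beta> \<phi> f z"
    using assms by (auto simp: S_class_def)
  have \<phi>z: "(\<lambda>z. \<phi> z * z powi n) \<in> L2" for n
    using L2_mult_power_int[OF \<phi>, of n] by (simp add: mult.commute)
  define \<xi> where "\<xi> = proj (model_space \<alpha>) (\<lambda>z. cnj (\<phi> z))"
  \<comment> \<open>\<open>ker0 \<beta> 0\<close> pairs with g to the conjugate of g_0, so the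
    second summand absorbs the terms with the coefficient of \<phi> z^j at 0; dividing by j! offsets
    the normalization of the kernels.\<close>
  define \<psi> where "\<psi> = (\<lambda>j z. (1 / fact j) * proj (model_space \<beta>) (W k (\<lambda>z. \<phi> z * z powi int j)) z +
     (- fcoef (\<lambda>z. \<phi> z * z powi int j) 0 / fact j) * ker0 \<beta> 0 z)"
  have \<xi>: "\<xi> \<in> model_space \<alpha>"
    unfolding \<xi>_def by (intro A.proj_model(1) L2_cnj \<phi>)
  have \<psi>: "\<psi> j \<in> model_space \<beta>" for j
    unfolding \<psi>_def by (intro B.model_lincomb B.proj_model(1) W_L2 k \<phi>z B.ker0_model)
  have ip\<psi>: "fact j * ip (\<psi> j) g = ip (W k (\<lambda>z. \<phi> z * z powi int j)) g -
      cnj (fcoef g 0) * fcoef (\<lambda>z. \<phi> z * z powi int j) 0" if g: "g \<in> model_space \<beta>" for g j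
    unfolding \<psi>_def
    by (subst ip_lincomb_left[OF B.model_L2[OF B.proj_model(1)[OF W_L2[OF k \<phi>z]]]
          B.model_L2[OF B.ker0_model] B.model_L2[OF g]])
      (simp add: B.proj_model(2)[OF W_L2[OF k \<phi>z] g] B.ip_ker0_left[OF g] field_simps
        del: power_int_of_nat)
  have ip\<xi>: "ip f \<xi> = fcoef (\<lambda>z. \<phi> z * f z) 0" if f: "f \<in> model_space \<alpha>" for f
  proof -
    have "ip f \<xi> = cnj (ip (\<lambda>z. cnj (\<phi> z)) f)"
      unfolding \<xi>_def ip_commute[of f] A.proj_model(2)[OF L2_cnj[OF \<phi>] f] by (rule refl)
    also have "\<dots> = ip f (\<lambda>z. cnj (\<phi> z))"
      by (rule ip_commute[symmetric])
    also have "\<dots> = fcoef (\<lambda>z. \<phi> z * f z) 0"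
      by (simp add: ip_def fcoef_def mult.commute)
    finally show ?thesis .
  qed
  have ipU: "ip (U f) g = ip (W k (\<lambda>z. \<phi> z * f z)) g" if f: "f \<in> model_space_inf \<alpha>" and g: "g \<in> model_space \<beta>" for f g
  proof -
    have fK: "f \<in> model_space \<alpha>" using f by (simp add: model_space_inf_def)
    have W: "W k (\<lambda>z. \<phi> z * f z) \<in> L2"
      by (intro W_L2 k model_inf_mult_L2[OF f \<phi>])
    have "ip (U f) g = ip (U_op k \<beta> \<phi> f) g"
      by (rule ip_cong_AE[OF U\<phi>[OF f]])
        (auto intro!: B.model_L2 U_model fK g B.proj_model(1) W simp: U_op_def)
    then show ?thesis
      using B.proj_model(2)[OF W g] by (simp add: U_op_def)
  qed
  have "displacement \<xi> \<psi> f g" if f: "f \<in> model_space_inf \<alpha>" and g: "g \<in> model_space \<beta>" for f g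
  proof -
    have fK: "f \<in> model_space \<alpha>" using f by (simp add: model_space_inf_def)
    have "ip (U f) g - ip (U ((SA ^^ k) f)) (SB g) = cnj (fcoef g 0) * ip f \<xi> +
        (\<Sum>j<k. fcoef f (int j) * (fact j * ip (\<psi> j) g))"
      unfolding ipU[OF f g] ipU[OF A.comp_shift_adj_power_inf[OF f] B.comp_shift_adj_model(1)[OF g]]
        ip\<xi>[OF fK] ip\<psi>[OF g] by (rule ip_W_displacement[OF \<phi> f g])
    then show ?thesis
      by (simp add: displacement_def mult_ac)
  qed
  note inf = this
  show thesis
  proof (rule that[OF \<xi> \<psi>])
    fix f g assume fg: "f \<in> model_space \<alpha>" "g \<in> model_space \<beta>"
    show "displacement \<xi> \<psi> f g"
      by (rule displacement_dense[OF \<xi> fg(2) inf[OF _ fg(2)] fg(1)])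
  qed
qed

section \<open>From the displacement identity to the symbol\<close>

lemma displacement_iterate:
  assumes D: "\<And>f g. f \<in> model_space \<alpha> \<Longrightarrow> g \<in> model_space \<beta> \<Longrightarrow> displacement \<xi> \<psi> f g"
    and f: "f \<in> model_space \<alpha>" and g: "g \<in> model_space \<beta>"
  shows "ip (U f) g - ip (U ((SA ^^ (k * n)) f)) ((SB ^^ n) g) =
    (\<Sum>i<n. cnj (fcoef g (int i)) * ip ((SA ^^ (k * i)) f) \<xi> +
      (\<Sum>j<k. fact j * fcoef f (int (k * i + j)) * ip (\<psi> j) ((SB ^^ i) g)))"
proof (induction n)
  case (Suc n)
  let ?f = "(SA ^^ (k * n)) f" and ?g = "(SB ^^ n) g"
  \<comment> \<open>The identity is taken at the shifted pair, with k shifts of f for each shift of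
    g, so that successive instances telescope.\<close>
  have "displacement \<xi> \<psi> ?f ?g"
    by (intro D A.comp_shift_adj_power_model B.comp_shift_adj_power_model f g)
  moreover have "fcoef ?g 0 = fcoef g (int n)"
    by (simp add: B.fcoef_comp_shift_adj_power[OF g])
  moreover have "fcoef ?f (int j) = fcoef f (int (k * n + j))" for j
    by (simp add: A.fcoef_comp_shift_adj_power[OF f] add.commute)
  ultimately have step: "ip (U ?f) ?g - ip (U ((SA ^^ k) ?f)) (SB ?g) =
      cnj (fcoef g (int n)) * ip ?f \<xi> +
      (\<Sum>j<k. fact j * fcoef f (int (k * n + j)) * ip (\<psi> j) ?g)"
    by (simp only: displacement_def)
  have "ip (U f) g - ip (U ((SA ^^ (k * Suc n)) f)) ((SB ^^ Suc n) g) =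
      (ip (U f) g - ip (U ?f) ?g) + (ip (U ?f) ?g - ip (U ((SA ^^ k) ?f)) (SB ?g))"
    by (simp add: funpow_add)
  then show ?case
    by (simp only: Suc.IH step sum.lessThan_Suc)
qed simp

text \<open>In the remainder f contributes only the contraction property; the decay comes from g.
  Moving the shifts onto \<xi> and the \<psi>_j as powers of z brings the terms into the form that
  \<open>W k\<close> produces.\<close>

lemma displacement_sums:
  assumes \<xi>: "\<xi> \<in> model_space \<alpha>" and \<psi>: "\<And>j. j < k \<Longrightarrow> \<psi> j \<in> model_space \<beta>"
    and D: "\<And>f g. f \<in> model_space \<alpha> \<Longrightarrow> g \<in> model_space \<beta> \<Longrightarrow> displacement \<xi> \<psi> f g"
    and f: "f \<in> model_space \<alpha>" and g: "g \<in> model_space \<beta>"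
  shows "(\<lambda>i. fcoef (\<lambda>z. cnj (\<xi> z) * f z) (int k * int i) * cnj (fcoef g (int i)) +
      (\<Sum>j<k. fact j * (fcoef f (int (k * i + j)) * ip (\<lambda>z. z powi int i * \<psi> j z) g))) sums ip (U f) g"
proof -
  obtain C where C: "C \<ge> 0" "\<And>f. f \<in> model_space \<alpha> \<Longrightarrow> l2norm (U f) \<le> C * l2norm f"
    by (rule bounded_op_bound[OF U]) blast
  have "(\<lambda>n. ip (U ((SA ^^ (k * n)) f)) ((SB ^^ n) g)) \<longlonglongrightarrow> 0"
  proof (rule Lim_null_comparison)
    show "(\<lambda>n. (C * l2norm f) * l2norm ((SB ^^ n) g)) \<longlonglongrightarrow> 0"
      by (rule tendsto_mult_right_zero[OF B.comp_shift_adj_power_tendsto_0[OF g]])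
    show "\<forall>\<^sub>F n in sequentially. norm (ip (U ((SA ^^ (k * n)) f)) ((SB ^^ n) g)) \<le> (C * l2norm f) * l2norm ((SB ^^ n) g)"
    proof (intro always_eventually allI)
      fix n
      have f': "(SA ^^ (k * n)) f \<in> model_space \<alpha>"
        by (rule A.comp_shift_adj_power_model[OF f])
      have "norm (ip (U ((SA ^^ (k * n)) f)) ((SB ^^ n) g)) \<le> l2norm (U ((SA ^^ (k * n)) f)) * l2norm ((SB ^^ n) g)"
        by (intro Cauchy_Schwarz B.model_L2 U_model f' B.comp_shift_adj_power_model g)
      also have "\<dots> \<le> (C * l2norm f) * l2norm ((SB ^^ n) g)"
        using C(1)
        by (intro mult_right_mono order_trans[OF C(2)[OF f']] mult_left_mono A.l2norm_comp_shift_adj_power_le f) auto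
      finally show "norm (ip (U ((SA ^^ (k * n)) f)) ((SB ^^ n) g)) \<le> (C * l2norm f) * l2norm ((SB ^^ n) g)" .
    qed
  qed
  moreover have it: "ip (U f) g - ip (U ((SA ^^ (k * n)) f)) ((SB ^^ n) g) =
    (\<Sum>i<n. cnj (fcoef g (int i)) * ip ((SA ^^ (k * i)) f) \<xi> +
      (\<Sum>j<k. fact j * fcoef f (int (k * i + j)) * ip (\<psi> j) ((SB ^^ i) g)))" for n
    by (rule displacement_iterate[OF _ f g]) (rule D)
  ultimately have "(\<lambda>n. ip (U f) g - ip (U ((SA ^^ (k * n)) f)) ((SB ^^ n) g)) \<longlonglongrightarrow> ip (U f) g - 0"
    by (intro tendsto_diff tendsto_const)
  then have "(\<lambda>i. cnj (fcoef g (int i)) * ip ((SA ^^ (k * i)) f) \<xi> +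
      (\<Sum>j<k. fact j * fcoef f (int (k * i + j)) * ip (\<psi> j) ((SB ^^ i) g))) sums ip (U f) g"
    unfolding sums_def by (simp only: it diff_zero)
  moreover have "ip ((SA ^^ (k * i)) f) \<xi> = fcoef (\<lambda>z. cnj (\<xi> z) * f z) (int k * int i)" for i
  proof -
    have "ip ((SA ^^ (k * i)) f) \<xi> = ip f (\<lambda>z. z powi int (k * i) * \<xi> z)"
      by (rule A.ip_comp_shift_adj_power[OF f A.model_H2[OF \<xi>]])
    also have "\<dots> = ip (\<lambda>z. cnj (\<xi> z) * f z) (\<lambda>z. z powi int (k * i))"
      by (simp add: ip_def mult_ac)
    finally show ?thesis
      by (simp add: fcoef_eq_ip)
  qed
  moreover have "ip (\<psi> j) ((SB ^^ i) g) = ip (\<lambda>z. z powi int i * \<psi> j z) g" if "j < k" for i j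
    using B.ip_comp_shift_adj_power[OF g B.model_H2[OF \<psi>[OF that]], of i] by (metis ip_commute)
  ultimately show ?thesis
    by (simp add: mult_ac)
qed

lemma sufficiency:
  assumes \<xi>: "\<xi> \<in> model_space \<alpha>" and \<psi>: "\<And>j. j < k \<Longrightarrow> \<psi> j \<in> model_space \<beta>"
    and D: "\<And>f g. f \<in> model_space \<alpha> \<Longrightarrow> g \<in> model_space \<beta> \<Longrightarrow> displacement \<xi> \<psi> f g"
  shows "U \<in> S_class k \<alpha> \<beta>"
proof -
  \<comment> \<open>The choice is restricted to j < k, since only these \<open>\<psi> j\<close> are
    known to lie in the model space.\<close>
  have "\<exists>s. \<forall>j\<in>{..<k}. s j \<in> L2 \<and> (\<forall>n. fcoef (s j) n = (if int k dvd n then fcoef (\<psi> j) (n div int k) else 0))"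
    by (rule bchoice) (use spread_exists[OF k B.model_L2[OF \<psi>]] in blast)
  then obtain s where s: "\<And>j. j < k \<Longrightarrow> s j \<in> L2"
    "\<And>j n. j < k \<Longrightarrow> fcoef (s j) n = (if int k dvd n then fcoef (\<psi> j) (n div int k) else 0)"
    by auto
  define \<eta> where "\<eta> = (\<lambda>j z. z powi (- int j) * s j z)"
  \<comment> \<open>\<open>fact j\<close> reproduces the factor with which \<open>ker0\<close>
    enters the displacement identity.\<close>
  define \<phi> where "\<phi> = (\<lambda>z. cnj (\<xi> z) + (\<Sum>j<k. fact j * \<eta> j z))"
  have \<xi>L2: "(\<lambda>z. cnj (\<xi> z)) \<in> L2"
    by (intro L2_cnj A.model_L2 \<xi>)
  have \<eta>: "\<eta> j \<in> L2" if "j < k" for j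
    unfolding \<eta>_def by (intro L2_mult_power_int s that)
  have \<phi>: "\<phi> \<in> L2"
    unfolding \<phi>_def by (intro L2_add L2_sum L2_cmult \<xi>L2 \<eta>) simp
  have "AE z in circle. U f z = U_op k \<beta> \<phi> f z" if f: "f \<in> model_space_inf \<alpha>" for f
  proof -
    have fK: "f \<in> model_space \<alpha>" and fH: "f \<in> Hinf"
      using f by (auto simp: model_space_inf_def)
    let ?W = "W k (\<lambda>z. \<phi> z * f z)"
    have \<phi>f: "(\<lambda>z. \<phi> z * f z) \<in> L2" by (rule model_inf_mult_L2[OF f \<phi>])
    have \<xi>f: "(\<lambda>z. cnj (\<xi> z) * f z) \<in> L2" by (rule model_inf_mult_L2[OF f \<xi>L2])
    have \<eta>f: "(\<lambda>z. \<eta> j z * f z) \<in> L2" if "j < k" for j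
      by (rule model_inf_mult_L2[OF f \<eta>[OF that]])
    have WL2: "?W \<in> L2" by (rule W_L2[OF k \<phi>f])
    \<comment> \<open>At first only for bounded g, because L2 factors of the symbol are moved onto
      g; the other g follow by density below.\<close>
    have inf: "ip (U f) g = ip ?W g" if g: "g \<in> model_space_inf \<beta>" for g
    proof -
      have gK: "g \<in> model_space \<beta>" and gH: "g \<in> Hinf"
        using g by (auto simp: model_space_inf_def)
      have gL2: "g \<in> L2" by (rule B.model_L2[OF gK])
      \<comment> \<open>\<open>W k\<close> is linear only a.e., so its splitting over the summands
        of \<phi> is obtained by comparing coefficients with this sum.\<close>
      let ?V = "\<lambda>z. W k (\<lambda>z. cnj (\<xi> z) * f z) z + (\<Sum>j<k. fact j * W k (\<lambda>z. \<eta> j z * f z) z)"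
      have V2: "(\<lambda>z. \<Sum>j<k. fact j * W k (\<lambda>z. \<eta> j z * f z) z) \<in> L2"
        by (intro L2_sum L2_cmult W_L2 k \<eta>f) simp
      have V: "?V \<in> L2"
        by (intro L2_add V2 W_L2 k \<xi>f)
      have ipV: "ip ?V h = ip (W k (\<lambda>z. cnj (\<xi> z) * f z)) h + (\<Sum>j<k. fact j * ip (W k (\<lambda>z. \<eta> j z * f z)) h)"
        if "h \<in> L2" for h
        by (subst ip_add_left[OF W_L2[OF k \<xi>f] V2 that], subst ip_sum_left)
          (auto intro!: L2_cmult W_L2 k \<eta>f that simp: ip_cmult_left)
      have "fcoef ?W n = fcoef ?V n" for n
      proof -
        have "fcoef ?W n = ip (\<lambda>z. cnj (\<xi> z) * f z + (\<Sum>j<k. fact j * (\<eta> j z * f z))) (\<lambda>z. z powi (int k * n))"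
          unfolding fcoef_W[OF k \<phi>f] unfolding fcoef_eq_ip
          by (simp add: \<phi>_def algebra_simps sum_distrib_left)
        also have "\<dots> = fcoef (\<lambda>z. cnj (\<xi> z) * f z) (int k * n) + (\<Sum>j<k. fact j * fcoef (\<lambda>z. \<eta> j z * f z) (int k * n))"
          unfolding fcoef_eq_ip
          by (subst ip_add_left, rule \<xi>f, intro L2_sum L2_cmult \<eta>f, simp, rule L2_power_int, subst ip_sum_left)
            (auto intro!: L2_cmult \<eta>f L2_power_int simp: ip_cmult_left)
        also have "\<dots> = fcoef (W k (\<lambda>z. cnj (\<xi> z) * f z)) n + (\<Sum>j<k. fact j * fcoef (W k (\<lambda>z. \<eta> j z * f z)) n)"
          by (simp add: fcoef_W[OF k] \<xi>f \<eta>f)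
        also have "\<dots> = fcoef ?V n"
          unfolding fcoef_eq_ip[of _ n] ipV[OF L2_power_int] by (rule refl)
        finally show ?thesis .
      qed
      then have "AE z in circle. ?W z = ?V z"
        by (intro fcoef_eq_imp_AE_eq L2_integrable WL2 V)
      then have "ip ?W g = ip ?V g"
        by (intro ip_cong_AE) (auto intro: WL2 V gL2)
      then have ipW: "ip ?W g = ip (W k (\<lambda>z. cnj (\<xi> z) * f z)) g + (\<Sum>j<k. fact j * ip (W k (\<lambda>z. \<eta> j z * f z)) g)"
        by (simp add: ipV[OF gL2])
      have s1: "(\<lambda>i. fcoef (\<lambda>z. cnj (\<xi> z) * f z) (int k * int i) * cnj (fcoef g (int i))) sums
          ip (W k (\<lambda>z. cnj (\<xi> z) * f z)) g"
        using Parseval_nat[OF W_L2[OF k \<xi>f] gL2 B.fcoef_model_neg[OF gK]] by (simp add: fcoef_W[OF k \<xi>f])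
      have s2: "(\<lambda>i. fcoef f (int (k * i + j)) * ip (\<lambda>z. z powi int i * \<psi> j z) g) sums
          ip (W k (\<lambda>z. \<eta> j z * f z)) g" if "j < k" for j
        unfolding \<eta>_def by (rule ip_W_spread_sums[OF k that B.model_L2[OF \<psi>[OF that]] s(1)[OF that] s(2)[OF that] fH gH])
      have "(\<lambda>i. fcoef (\<lambda>z. cnj (\<xi> z) * f z) (int k * int i) * cnj (fcoef g (int i)) +
          (\<Sum>j<k. fact j * (fcoef f (int (k * i + j)) * ip (\<lambda>z. z powi int i * \<psi> j z) g))) sums ip ?W g"
        unfolding ipW by (intro sums_add s1 sums_sum sums_mult s2) simp
      moreover have "(\<lambda>i. fcoef (\<lambda>z. cnj (\<xi> z) * f z) (int k * int i) * cnj (fcoef g (int i)) +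
          (\<Sum>j<k. fact j * (fcoef f (int (k * i + j)) * ip (\<lambda>z. z powi int i * \<psi> j z) g))) sums ip (U f) g"
        by (rule displacement_sums[OF \<xi> _ _ fK gK]) (rule \<psi> D; assumption)+
      ultimately show ?thesis
        by (rule sums_unique2[symmetric])
    qed
    let ?u = "\<lambda>z. U f z - proj (model_space \<beta>) ?W z"
    have P: "proj (model_space \<beta>) ?W \<in> model_space \<beta>"
      by (rule B.proj_model(1)[OF WL2])
    have u: "?u \<in> model_space \<beta>"
      by (intro B.model_diff U_model fK P)
    have ipu: "ip ?u g = ip (U f) g - ip ?W g" if "g \<in> model_space \<beta>" for g
      by (simp add: ip_diff_left B.model_L2 U_model fK P that B.proj_model(2)[OF WL2 that])
    \<comment> \<open>With \<open>?u\<close> in the second slot the expression is linear in g, as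
      the density argument requires; it is then evaluated at \<open>?u\<close> itself.\<close>
    have "ip g ?u = 0" if g: "g \<in> model_space \<beta>" for g
    proof (rule B.bounded_functional_eq_zero_model[OF _ _ g])
      show "bounded_functional (model_space \<beta>) (\<lambda>g. ip g ?u)"
        by (rule bounded_functional_ip[OF B.model.L2 B.model_L2[OF u]])
      show "ip h ?u = 0" if h: "h \<in> model_space_inf \<beta>" for h
      proof -
        have "ip ?u h = 0"
          using ipu[of h] inf[OF h] h by (simp add: model_space_inf_def)
        then show ?thesis
          by (subst ip_commute) simp
      qed
    qed
    then have "ip ?u ?u = 0"
      using u by blast
    then have "l2norm ?u = 0"
      by (simp add: ip_self)
    then show ?thesis
      using l2norm_eq_0_AE[OF B.model_L2[OF u]] by (simp add: U_op_def)
  qed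
  then show ?thesis
    using U \<phi> unfolding S_class_def by blast
qed

lemma S_class_iff:
  "U \<in> S_class k \<alpha> \<beta> \<longleftrightarrow>
    (\<exists>\<xi> \<psi>. \<xi> \<in> model_space \<alpha> \<and> (\<forall>j<k. \<psi> j \<in> model_space \<beta>) \<and>
      (\<forall>f\<in>model_space \<alpha>. AE z in circle.
         U f z - comp_shift \<beta> (U ((SA ^^ k) f)) z =
         tensor (ker0 \<beta> 0) \<xi> f z + (\<Sum>j<k. tensor (\<psi> j) (ker0 \<alpha> j) f z)))" (is "_ \<longleftrightarrow> ?R")
proof
  assume "U \<in> S_class k \<alpha> \<beta>"
  then obtain \<xi> \<psi> where *: "\<xi> \<in> model_space \<alpha>" "\<And>j. j < k \<Longrightarrow> \<psi> j \<in> model_space \<beta>"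
    and D: "\<And>f g. f \<in> model_space \<alpha> \<Longrightarrow> g \<in> model_space \<beta> \<Longrightarrow> displacement \<xi> \<psi> f g"
    by (rule necessity) blast
  show ?R
  proof (intro exI[of _ \<xi>] exI[of _ \<psi>] conjI allI impI ballI)
    fix f assume f: "f \<in> model_space \<alpha>"
    show "AE z in circle. U f z - comp_shift \<beta> (U ((SA ^^ k) f)) z =
         tensor (ker0 \<beta> 0) \<xi> f z + (\<Sum>j<k. tensor (\<psi> j) (ker0 \<alpha> j) f z)"
    proof (rule iffD2[OF displacement_iff[OF *(1) _ f]])
      show "\<forall>g\<in>model_space \<beta>. displacement \<xi> \<psi> f g"
        by (intro ballI D f)
    qed (rule *(2))
  qed (rule *; assumption?)+
next
  assume ?R
  then obtain \<xi> \<psi> where *: "\<xi> \<in> model_space \<alpha>" "\<And>j. j < k \<Longrightarrow> \<psi> j \<in> model_space \<beta>"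
    "\<And>f. f \<in> model_space \<alpha> \<Longrightarrow> AE z in circle. U f z - comp_shift \<beta> (U ((SA ^^ k) f)) z =
         tensor (ker0 \<beta> 0) \<xi> f z + (\<Sum>j<k. tensor (\<psi> j) (ker0 \<alpha> j) f z)"
    by blast
  show "U \<in> S_class k \<alpha> \<beta>"
  proof (rule sufficiency[OF *(1)])
    fix f g assume f: "f \<in> model_space \<alpha>" and g: "g \<in> model_space \<beta>"
    have "\<forall>g\<in>model_space \<beta>. displacement \<xi> \<psi> f g"
      by (rule iffD1[OF displacement_iff[OF *(1) _ f] *(3)[OF f]]) (rule *(2))
    then show "displacement \<xi> \<psi> f g"
      using g by blast
  qed (rule *(2))
qed

end

theorem theorem3p5:
  fixes \<alpha> \<beta> :: "complex \<Rightarrow> complex"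
    and k :: nat
    and U :: "(complex \<Rightarrow> complex) \<Rightarrow> (complex \<Rightarrow> complex)"
  assumes "inner_function \<alpha>"
    and "inner_function \<beta>"
    and "k \<ge> 1"
    and "bounded_op (model_space \<alpha>) (model_space \<beta>) U"
  shows "U \<in> S_class k \<alpha> \<beta> \<longleftrightarrow>
    (\<exists>\<xi> \<psi>. \<xi> \<in> model_space \<alpha> \<and> (\<forall>j<k. \<psi> j \<in> model_space \<beta>) \<and>
      (\<forall>f\<in>model_space \<alpha>. AE \<zeta> in circle.
         U f \<zeta> - comp_shift \<beta> (U ((comp_shift_adj \<alpha> ^^ k) f)) \<zeta> =
         tensor (ker0 \<beta> 0) \<xi> f \<zeta> + (\<Sum>j<k. tensor (\<psi> j) (ker0 \<alpha> j) f \<zeta>)))"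
proof -
  obtain a where a: "inner_boundary \<alpha> a"
    by (rule inner_boundary_exists[OF assms(1)])
  obtain b where b: "inner_boundary \<beta> b"
    by (rule inner_boundary_exists[OF assms(2)])
  interpret operator_between_models \<alpha> a \<beta> b k U
    by (intro operator_between_models.intro operator_between_models_axioms.intro a b assms(3,4))
  show ?thesis
    by (rule S_class_iff)
qed

end
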